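(* Let $L_1$ and $L_2$ be two non isotopic (classical) links distinguished by $\mathcal{F}$ but not by the Homflypt polynomial $P$. Then any pair of singular links obtained by adding to $L_r$ ($r=1,2$) a new component making a singular crossing and a negative crossing with whatever component of $L_r$ is distinguished by $\Phi_{x,y}$ and by $\Psi_{x,y}$ but not by $\mathrm{I}_{PR}$.
   Context: Links are oriented. A singular link is a link in $\mathbb{R}^3$ admitting simple singular double points; its components are those of the classical link obtained by replacing each singular point by a positive crossing. A cts-link is a pair $(L,J)$, $L$ a singular link with $k$ numbered components and $J$ a set partition of $\{1,\dots,k\}$ (the components), up to isotopy of singular links carrying partition to partition. $\mathbf{1}_k$ is the partition into singletons. For an invariant $\mathrm{I}$ of cts-links, two (singular) links $L,L'$ with $k$ components are distinguished by $\mathrm{I}$ if $\mathrm{I}(L,\mathbf{1}_k)\ne\mathrm{I}(L',\mathbf{1}_k)$; for $P$ and $\mathrm{I}_{PR}$, if the values on $L$, $L'$ differ. The new component is a small unknotted circle whose only crossings with the rest of the diagram are two crossings with one strand of the chosen component of $L_r$, one singular and one negative (so replacing the singular crossing by a positive one unlinks the circle, and smoothing the singular crossing gives back $L_r$ up to isotopy). Let $u,a,b,x,y$ be variables, $c=\frac{a+(1-u)b}{au}$; values lie in a field containing $\mathbb{C}(u,a,b,x,y)$ and $\sqrt c$. Notation: $(L_+,J),(L_-,J),(L_\times,J)$ are cts-links with diagrams identical except at one crossing, respectively positive, negative, singular; $J'$ is obtained from $J$ by merging the blocks containing the two components at the crossing ($J'=J$ if they are in the same block); $L_0$ is the oriented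 smoothing, and $J''$ is the partition of the components of $L_0$ induced by $J'$ (components through the smoothed strands lie in the merged block). $O$ is an unlinked unknot. $\Phi_{x,y}$ and $\Psi_{x,y}$ are the invariants of cts-links determined by the common rules (for $\mathrm{I}=\Phi_{x,y},\Psi_{x,y}$): I: value $1$ on the unknot; II: $\mathrm{I}(L\sqcup O,\iota(J))=\frac{1}{a\sqrt c}\mathrm{I}(L,J)$, where $\iota(J)$ is $J$ with the new component added as a singleton block; III: $\frac{1}{\sqrt c}\mathrm{I}(L_+,J)-\sqrt c\,\mathrm{I}(L_-,J)=\frac{1}{\sqrt c}(1-u^{-1})\mathrm{I}(L_+,J')+(1-u^{-1})\mathrm{I}(L_0,J'')$; and respectively $\Phi_{x,y}(L_\times,J)=x\Phi_{x,y}(L_0,J'')+y\Phi_{x,y}(L_+,J')$, $\Psi_{x,y}(L_\times,J)=x\Psi_{x,y}(L_0,J'')+y\Psi_{x,y}(L_+,J)$. $\mathcal{F}$ is the invariant of (nonsingular) combinatoric tied links determined by rules I, II, III; it is the common restriction of $\Phi_{x,y}$ and $\Psi_{x,y}$ to nonsingular links. $P$ is the Homflypt polynomial of classical links; up to renaming of variables it is given by $P(O)=1$ and $\frac{1}{u\sqrt c}P(L_+)-\sqrt c\,P(L_-)=(1-u^{-1})P(L_0)$, i.e. $P(L)=\mathcal{F}(L,I)$ with $I$ the partition with a unique block. $\mathrm{I}_{PR}$ is the Paris–Rabenda polynomial invariant of singular links; up to renaming of variables it coincides with $P$ on classical links and satisfies $\mathrm{I}_{PR}(L_\times)=x\,\mathrm{I}_{PR}(L_0)+y\,\mathrm{I}_{PR}(L_+)$.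 *)

theory Defs
  imports "HOL-Analysis.Analysis" "HOL-Library.Disjoint_Sets"
begin

section \<open>Singular links in three-space\<close>

text \<open>
  An oriented curve is a 1-periodic regular \<open>C\<^sup>1\<close> map from the reals to three-space.
  A link with \<open>k\<close> numbered components is a list of \<open>k\<close> such curves; the components carry the
  numbers \<open>0, \<dots>, k - 1\<close>. At a singular point the curves simply pass through each other, so the
  components are those of the classical link obtained by resolving the singular points into
  crossings.
\<close>

type_synonym curve = "real \<Rightarrow> real^3"
type_synonym link = "curve list"

definition velocity :: "curve \<Rightarrow> curve" where
  "velocity \<gamma> s = vector_derivative \<gamma> (at s)"

definition closed_curve :: "curve \<Rightarrow> bool" where
  "closed_curve \<gamma> \<longleftrightarrow>
     (\<forall>s. \<gamma> (s + 1) = \<gamma> s) \<and>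
     (\<forall>s. \<gamma> differentiable (at s)) \<and>
     continuous_on UNIV (velocity \<gamma>) \<and>
     (\<forall>s. velocity \<gamma> s \<noteq> 0)"

definition pt :: "link \<Rightarrow> nat \<times> real \<Rightarrow> real^3" where
  "pt L p = (L ! fst p) (snd p)"

definition vel :: "link \<Rightarrow> nat \<times> real \<Rightarrow> real^3" where
  "vel L p = velocity (L ! fst p) (snd p)"

definition params :: "link \<Rightarrow> (nat \<times> real) set" where
  "params L = {..<length L} \<times> {0..<1}"

definition double_pairs :: "link \<Rightarrow> ((nat \<times> real) \<times> (nat \<times> real)) set" where
  "double_pairs L = {(p, q). p \<in> params L \<and> q \<in> params L \<and> p \<noteq> q \<and> pt L p = pt L q}"

definition singular_link :: "link \<Rightarrow> bool" where
  "singular_link L \<longleftrightarrow>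
     L \<noteq> [] \<and> (\<forall>\<gamma>\<in>set L. closed_curve \<gamma>) \<and>
     finite (double_pairs L) \<and>
     (\<forall>(p, q)\<in>double_pairs L. \<not> collinear {0, vel L p, vel L q}) \<and>
     (\<forall>p q q'. (p, q) \<in> double_pairs L \<and> (p, q') \<in> double_pairs L \<longrightarrow> q = q')"

definition classical_link :: "link \<Rightarrow> bool" where
  "classical_link L \<longleftrightarrow> singular_link L \<and> double_pairs L = {}"


section \<open>Isotopy\<close>

definition reparametrization :: "(real \<Rightarrow> real) \<Rightarrow> bool" where
  "reparametrization \<phi> \<longleftrightarrow>
     (\<forall>s. \<phi> (s + 1) = \<phi> s + 1) \<and>
     (\<exists>\<phi>'. continuous_on UNIV \<phi>' \<and> (\<forall>s. (\<phi> has_real_derivative \<phi>' s) (at s) \<and> \<phi>' s > 0))"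

text \<open>
  An isotopy is a path of singular links, continuous in the \<open>C\<^sup>1\<close> sense, along which exactly the
  same pairs of parameters stay identified. Its final link is the target link up to an
  orientation preserving reparametrization of each component and the renumbering \<open>\<sigma>\<close> of
  the components.
\<close>

definition isotopic_via :: "(nat \<Rightarrow> nat) \<Rightarrow> link \<Rightarrow> link \<Rightarrow> bool" where
  "isotopic_via \<sigma> L L' \<longleftrightarrow>
     singular_link L \<and> singular_link L' \<and> length L = length L' \<and> \<sigma> permutes {..<length L} \<and>
     (\<exists>H :: real \<Rightarrow> link.
        H 0 = L \<and>
        (\<forall>t\<in>{0..1}. length (H t) = length L \<and> singular_link (H t) \<and>
                    double_pairs (H t) = double_pairs L) \<and>
        (\<forall>i<length L.
           continuous_on ({0..1} \<times> UNIV) (\<lambda>(t, s). (H t ! i) s) \<and>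
           continuous_on ({0..1} \<times> UNIV) (\<lambda>(t, s). velocity (H t ! i) s) \<and>
           (\<exists>\<phi>. reparametrization \<phi> \<and> H 1 ! i = (L' ! \<sigma> i) \<circ> \<phi>)))"

definition isotopic :: "link \<Rightarrow> link \<Rightarrow> bool" where
  "isotopic L L' \<longleftrightarrow> (\<exists>\<sigma>. isotopic_via \<sigma> L L')"

definition cts_link :: "link \<Rightarrow> nat set set \<Rightarrow> bool" where
  "cts_link L J \<longleftrightarrow> singular_link L \<and> partition_on {..<length L} J"

definition singletons :: "nat \<Rightarrow> nat set set" where
  "singletons k = (\<lambda>i. {i}) ` {..<k}"

definition isotopic_cts :: "link \<times> nat set set \<Rightarrow> link \<times> nat set set \<Rightarrow> bool" where
  "isotopic_cts = (\<lambda>(L, J) (L', J').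
     cts_link L J \<and> cts_link L' J' \<and> (\<exists>\<sigma>. isotopic_via \<sigma> L L' \<and> J' = (\<lambda>B. \<sigma> ` B) ` J))"


section \<open>Diagrams, crossings and smoothings\<close>

text \<open>
  The diagram of a link is its projection along the third axis, the third coordinate being the
  height. The part of the diagram in which two links may differ is a compact convex disc \<open>D\<close> of
  the projection plane. A strand \<open>(i, a, b)\<close> is the piece of component \<open>i\<close> parametrized by
  the interval from \<open>a\<close> to \<open>b\<close>.
\<close>

definition plane_proj :: "real^3 \<Rightarrow> real \<times> real" where
  "plane_proj v = (v $ 1, v $ 2)"

definition disc :: "(real \<times> real) set \<Rightarrow> bool" where
  "disc D \<longleftrightarrow> compact D \<and> convex D \<and> interior D \<noteq> {}"

type_synonym strand = "nat \<times> real \<times> real"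

definition proper_strand :: "(real \<times> real) set \<Rightarrow> link \<Rightarrow> strand \<Rightarrow> bool" where
  "proper_strand D L = (\<lambda>(i, a, b).
     i < length L \<and> a < b \<and>
     inj_on (\<lambda>s. plane_proj ((L ! i) s)) {a..b} \<and>
     (\<forall>s\<in>{a<..<b}. plane_proj ((L ! i) s) \<in> interior D) \<and>
     plane_proj ((L ! i) a) \<in> frontier D \<and> plane_proj ((L ! i) b) \<in> frontier D)"

definition on_strand :: "strand \<Rightarrow> nat \<Rightarrow> real \<Rightarrow> bool" where
  "on_strand = (\<lambda>(i, a, b) m s. m = i \<and> (\<exists>n::int. s + of_int n \<in> {a..b}))"

definition two_strands :: "(real \<times> real) set \<Rightarrow> link \<Rightarrow> strand \<Rightarrow> strand \<Rightarrow> bool" where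
  "two_strands D L \<alpha> \<beta> \<longleftrightarrow>
     disc D \<and> proper_strand D L \<alpha> \<and> proper_strand D L \<beta> \<and>
     (\<forall>m<length L. \<forall>s. plane_proj ((L ! m) s) \<in> D \<longrightarrow> on_strand \<alpha> m s \<or> on_strand \<beta> m s)"

definition det2 :: "real \<times> real \<Rightarrow> real \<times> real \<Rightarrow> real" where
  "det2 v w = fst v * snd w - snd v * fst w"

text \<open>
  At a crossing, the over-strand turned counterclockwise by less than a half turn becomes the
  under-strand if and only if the crossing is positive; the sign is 0 when both strands are at
  the same height, i.e. at a singular crossing.
\<close>

definition crossing_sign :: "link \<Rightarrow> nat \<times> real \<Rightarrow> nat \<times> real \<Rightarrow> real" where
  "crossing_sign L p q =
     sgn (det2 (plane_proj (vel L p)) (plane_proj (vel L q)) * (pt L p $ 3 - pt L q $ 3))"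

text \<open>Over \<open>D\<close> the diagram of \<open>L\<close> consists of one transversal crossing, of sign \<open>e\<close>.\<close>

definition single_crossing ::
    "(real \<times> real) set \<Rightarrow> strand \<Rightarrow> strand \<Rightarrow> real \<Rightarrow> link \<Rightarrow> bool" where
  "single_crossing D = (\<lambda>(i, a, b) (j, c, d) e L.
     two_strands D L (i, a, b) (j, c, d) \<and>
     (\<exists>s\<in>{a<..<b}. \<exists>t\<in>{c<..<d}.
        (\<forall>s'\<in>{a..b}. \<forall>t'\<in>{c..d}.
           plane_proj ((L ! i) s') = plane_proj ((L ! j) t') \<longleftrightarrow> s' = s \<and> t' = t) \<and>
        det2 (plane_proj (vel L (i, s))) (plane_proj (vel L (j, t))) \<noteq> 0 \<and>
        crossing_sign L (i, s) (j, t) = e))"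

definition same_diagram_outside :: "(real \<times> real) set \<Rightarrow> link \<Rightarrow> link \<Rightarrow> bool" where
  "same_diagram_outside D L L' \<longleftrightarrow>
     length L = length L' \<and>
     (\<forall>m<length L. \<forall>s. plane_proj ((L ! m) s) = plane_proj ((L' ! m) s) \<and>
                       (plane_proj ((L ! m) s) \<notin> D \<longrightarrow> (L ! m) s = (L' ! m) s))"

text \<open>
  The smoothing has a different number of components and different parametrizations, so outside
  the disc it is compared with the original link through the oriented points (a point together
  with the unit tangent vector there).
\<close>

definition oriented_points_outside ::
    "(real \<times> real) set \<Rightarrow> curve \<Rightarrow> ((real^3) \<times> (real^3)) set" where
  "oriented_points_outside D \<gamma> =
     {(\<gamma> s, sgn (velocity \<gamma> s)) | s. plane_proj (\<gamma> s) \<notin> D}"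

definition smoothing ::
    "(real \<times> real) set \<Rightarrow> strand \<Rightarrow> strand \<Rightarrow> link \<Rightarrow> link \<Rightarrow> bool" where
  "smoothing D = (\<lambda>(i, a, b) (j, c, d) L L0.
     (\<Union>\<gamma>\<in>set L0. oriented_points_outside D \<gamma>) = (\<Union>\<gamma>\<in>set L. oriented_points_outside D \<gamma>) \<and>
     (\<exists>i0 a0 b0 j0 c0 d0.
        two_strands D L0 (i0, a0, b0) (j0, c0, d0) \<and>
        (\<forall>s\<in>{a0..b0}. \<forall>t\<in>{c0..d0}. plane_proj ((L0 ! i0) s) \<noteq> plane_proj ((L0 ! j0) t)) \<and>
        (L0 ! i0) a0 = (L ! i) a \<and> (L0 ! i0) b0 = (L ! j) d \<and>
        (L0 ! j0) c0 = (L ! j) c \<and> (L0 ! j0) d0 = (L ! i) b))"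

text \<open>
  \<open>L\<close> and \<open>L'\<close> have diagrams identical except at one crossing, which involves the components
  \<open>i\<close> and \<open>j\<close> and has sign \<open>e\<close> in \<open>L\<close> and \<open>e'\<close> in \<open>L'\<close>; \<open>L0\<close> is the oriented smoothing.
\<close>

definition skein_triple ::
    "(real \<times> real) set \<Rightarrow> nat \<Rightarrow> nat \<Rightarrow> real \<Rightarrow> real \<Rightarrow> link \<Rightarrow> link \<Rightarrow> link \<Rightarrow> bool" where
  "skein_triple D i j e e' L L' L0 \<longleftrightarrow>
     (\<exists>a b c d.
        single_crossing D (i, a, b) (j, c, d) e L \<and>
        single_crossing D (i, a, b) (j, c, d) e' L' \<and>
        same_diagram_outside D L L' \<and>
        smoothing D (i, a, b) (j, c, d) L L0)"

definition merge :: "nat \<Rightarrow> nat \<Rightarrow> nat set set \<Rightarrow> nat set set" where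
  "merge i j J = {B \<in> J. i \<notin> B \<and> j \<notin> B} \<union> {\<Union>{B \<in> J. i \<in> B \<or> j \<in> B}}"

definition induced_partition ::
    "(real \<times> real) set \<Rightarrow> link \<Rightarrow> link \<Rightarrow> nat set set \<Rightarrow> nat set set" where
  "induced_partition D L L0 J =
     (\<lambda>B. {m. m < length L0 \<and>
              (\<exists>i\<in>B. oriented_points_outside D (L0 ! m) \<inter> oriented_points_outside D (L ! i) \<noteq> {})}) ` J"

definition round_circle :: "real^3 \<Rightarrow> real^3 \<Rightarrow> real^3 \<Rightarrow> curve" where
  "round_circle c v w = (\<lambda>s. c + cos (2 * pi * s) *\<^sub>R v + sin (2 * pi * s) *\<^sub>R w)"

definition radii :: "real^3 \<Rightarrow> real^3 \<Rightarrow> bool" where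
  "radii v w \<longleftrightarrow> v \<noteq> 0 \<and> norm v = norm w \<and> v \<bullet> w = 0"

definition flat_disc :: "real^3 \<Rightarrow> real^3 \<Rightarrow> real^3 \<Rightarrow> (real^3) set" where
  "flat_disc c v w = {c + \<alpha> *\<^sub>R v + \<beta> *\<^sub>R w | \<alpha> \<beta>. \<alpha>\<^sup>2 + \<beta>\<^sup>2 \<le> 1}"

text \<open>\<open>L'\<close> is \<open>L\<close> together with an unlinked unknot, which bounds a disc disjoint from \<open>L\<close>.\<close>

definition add_unknot :: "link \<Rightarrow> link \<Rightarrow> bool" where
  "add_unknot L L' \<longleftrightarrow>
     (\<exists>c v w. radii v w \<and> L' = L @ [round_circle c v w] \<and>
              (\<forall>\<gamma>\<in>set L. range \<gamma> \<inter> flat_disc c v w = {}))"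


section \<open>The invariants\<close>

definition isotopy_invariant :: "(link \<Rightarrow> bool) \<Rightarrow> (link \<Rightarrow> nat set set \<Rightarrow> 'k) \<Rightarrow> bool" where
  "isotopy_invariant \<C> I \<longleftrightarrow>
     (\<forall>L J L' J'. \<C> L \<and> \<C> L' \<and> isotopic_cts (L, J) (L', J') \<longrightarrow> I L J = I L' J')"

text \<open>The common rules on the class \<open>\<C>\<close> of links; \<open>r\<close> is the square root of \<open>c\<close>.\<close>

definition tied_rules ::
    "(link \<Rightarrow> bool) \<Rightarrow> 'k::field \<Rightarrow> 'k \<Rightarrow> 'k \<Rightarrow> (link \<Rightarrow> nat set set \<Rightarrow> 'k) \<Rightarrow> bool" where
  "tied_rules \<C> u a r I \<longleftrightarrow>
     isotopy_invariant \<C> I \<and>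
     (\<forall>c v w. radii v w \<longrightarrow> I [round_circle c v w] {{0}} = 1) \<and>
     (\<forall>L L' J. \<C> L \<and> \<C> L' \<and> cts_link L J \<and> add_unknot L L' \<longrightarrow>
        I L' (insert {length L} J) = 1 / (a * r) * I L J) \<and>
     (\<forall>D i j Lp Lm L0 J.
        \<C> Lp \<and> \<C> Lm \<and> \<C> L0 \<and> cts_link Lp J \<and> skein_triple D i j 1 (-1) Lp Lm L0 \<longrightarrow>
        1 / r * I Lp J - r * I Lm J =
          1 / r * (1 - 1 / u) * I Lp (merge i j J) +
          (1 - 1 / u) * I L0 (induced_partition D Lp L0 (merge i j J)))"

definition is_F :: "'k::field \<Rightarrow> 'k \<Rightarrow> 'k \<Rightarrow> (link \<Rightarrow> nat set set \<Rightarrow> 'k) \<Rightarrow> bool" where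
  "is_F u a r F \<longleftrightarrow> tied_rules classical_link u a r F"

definition restricts_to ::
    "(link \<Rightarrow> nat set set \<Rightarrow> 'k) \<Rightarrow> (link \<Rightarrow> nat set set \<Rightarrow> 'k) \<Rightarrow> bool" where
  "restricts_to I F \<longleftrightarrow> (\<forall>L J. classical_link L \<and> cts_link L J \<longrightarrow> I L J = F L J)"

definition is_Phi ::
    "'k::field \<Rightarrow> 'k \<Rightarrow> 'k \<Rightarrow> 'k \<Rightarrow> 'k \<Rightarrow> (link \<Rightarrow> nat set set \<Rightarrow> 'k) \<Rightarrow> bool" where
  "is_Phi u a r x y \<Phi> \<longleftrightarrow>
     tied_rules singular_link u a r \<Phi> \<and>
     (\<forall>D i j Lx Lp L0 J.
        singular_link Lp \<and> singular_link L0 \<and> cts_link Lx J \<and>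
        skein_triple D i j 0 1 Lx Lp L0 \<longrightarrow>
        \<Phi> Lx J = x * \<Phi> L0 (induced_partition D Lx L0 (merge i j J)) + y * \<Phi> Lp (merge i j J))"

definition is_Psi ::
    "'k::field \<Rightarrow> 'k \<Rightarrow> 'k \<Rightarrow> 'k \<Rightarrow> 'k \<Rightarrow> (link \<Rightarrow> nat set set \<Rightarrow> 'k) \<Rightarrow> bool" where
  "is_Psi u a r x y \<Psi> \<longleftrightarrow>
     tied_rules singular_link u a r \<Psi> \<and>
     (\<forall>D i j Lx Lp L0 J.
        singular_link Lp \<and> singular_link L0 \<and> cts_link Lx J \<and>
        skein_triple D i j 0 1 Lx Lp L0 \<longrightarrow>
        \<Psi> Lx J = x * \<Psi> L0 (induced_partition D Lx L0 (merge i j J)) + y * \<Psi> Lp J)"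

definition is_Homflypt :: "'k::field \<Rightarrow> 'k \<Rightarrow> (link \<Rightarrow> 'k) \<Rightarrow> bool" where
  "is_Homflypt u r P \<longleftrightarrow>
     (\<forall>L L'. classical_link L \<and> classical_link L' \<and> isotopic L L' \<longrightarrow> P L = P L') \<and>
     (\<forall>c v w. radii v w \<longrightarrow> P [round_circle c v w] = 1) \<and>
     (\<forall>D i j Lp Lm L0.
        classical_link Lp \<and> classical_link Lm \<and> classical_link L0 \<and>
        skein_triple D i j 1 (-1) Lp Lm L0 \<longrightarrow>
        1 / (u * r) * P Lp - r * P Lm = (1 - 1 / u) * P L0)"

definition is_Paris_Rabenda :: "'k::field \<Rightarrow> 'k \<Rightarrow> (link \<Rightarrow> 'k) \<Rightarrow> (link \<Rightarrow> 'k) \<Rightarrow> bool" where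
  "is_Paris_Rabenda x y P Q \<longleftrightarrow>
     (\<forall>L L'. isotopic L L' \<longrightarrow> Q L = Q L') \<and>
     (\<forall>L. classical_link L \<longrightarrow> Q L = P L) \<and>
     (\<forall>D i j Lx Lp L0.
        singular_link Lx \<and> singular_link Lp \<and> singular_link L0 \<and>
        skein_triple D i j 0 1 Lx Lp L0 \<longrightarrow>
        Q Lx = x * Q L0 + y * Q Lp)"

definition distinguished :: "(link \<Rightarrow> nat set set \<Rightarrow> 'k) \<Rightarrow> link \<Rightarrow> link \<Rightarrow> bool" where
  "distinguished I L L' \<longleftrightarrow>
     length L = length L' \<and> I L (singletons (length L)) \<noteq> I L' (singletons (length L'))"

definition distinguished_plain :: "(link \<Rightarrow> 'k) \<Rightarrow> link \<Rightarrow> link \<Rightarrow> bool" where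
  "distinguished_plain I L L' \<longleftrightarrow> length L = length L' \<and> I L \<noteq> I L'"


section \<open>Adding a new component\<close>

text \<open>
  Over the disc of radius 2 the diagram of \<open>L\<close> is a straight strand of component \<open>i\<close> along the
  first axis, at height 0. The new component \<open>C\<close> projects onto the unit circle, hence crosses the
  strand over the two points \<open>(\<eta>, 0)\<close> (at time 0) and \<open>(-\<eta>, 0)\<close> (at time 1/2). The former
  crossing is singular and the latter is negative. The sign \<open>\<eta>\<close> selects which of the two comes
  first along the strand, and \<open>\<epsilon>\<close> then selects the orientation of \<open>C\<close>.
\<close>

definition add_touching_circle :: "link \<Rightarrow> nat \<Rightarrow> link \<Rightarrow> bool" where
  "add_touching_circle L i M \<longleftrightarrow>
     singular_link L \<and> singular_link M \<and> i < length L \<and>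
     (\<exists>a b C \<eta> \<epsilon>.
        a < b \<and> M = L @ [C] \<and> \<eta> \<in> {-1, 1} \<and> \<epsilon> \<in> {-1, 1} \<and>
        (\<forall>s\<in>{a..b}. (L ! i) s = vector [4 * (s - a) / (b - a) - 2, 0, 0]) \<and>
        (\<forall>m<length L. \<forall>s. plane_proj ((L ! m) s) \<in> cball (0, 0) 2 \<longrightarrow> on_strand (i, a, b) m s) \<and>
        (\<forall>s. plane_proj (C s) = (\<eta> * cos (2 * pi * s), \<epsilon> * sin (2 * pi * s))) \<and>
        C 0 $ 3 = 0 \<and>
        crossing_sign M (i, a + (2 - \<eta>) * (b - a) / 4) (length L, 1 / 2) = -1)"

text \<open>\<open>M\<close> is obtained from \<open>L\<close>, up to isotopy, by the above addition at component \<open>i\<close> of \<open>L\<close>.\<close>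

definition obtained_by_adding :: "link \<Rightarrow> nat \<Rightarrow> link \<Rightarrow> bool" where
  "obtained_by_adding L i M \<longleftrightarrow>
     (\<exists>\<sigma> L' M'. isotopic_via \<sigma> L L' \<and> add_touching_circle L' (\<sigma> i) M' \<and> isotopic M' M)"


section \<open>The field of values\<close>

definition complex_embedding :: "(complex \<Rightarrow> 'k::field) \<Rightarrow> bool" where
  "complex_embedding h \<longleftrightarrow>
     h 1 = 1 \<and> (\<forall>z w. h (z + w) = h z + h w) \<and> (\<forall>z w. h (z * w) = h z * h w)"

text \<open>
  The elements of the list \<open>vs\<close> are algebraically independent over the embedded complex numbers:
  no polynomial, given by its coefficients \<open>q\<close> on a finite set of exponent lists, vanishes at
  them unless all its coefficients are zero.
\<close>

definition independent_variables :: "(complex \<Rightarrow> 'k::field) \<Rightarrow> 'k list \<Rightarrow> bool" where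
  "independent_variables h vs \<longleftrightarrow>
     (\<forall>S q. finite S \<and> (\<forall>es\<in>S. length es = length vs) \<and>
        (\<Sum>es\<in>S. h (q es) * (\<Prod>i<length vs. (vs ! i) ^ (es ! i))) = 0 \<longrightarrow>
        (\<forall>es\<in>S. q es = 0))"

end

(* All values are computed from a normal form of the pair (link, added circle), reached by straight-line
   homotopies: over a square the link is a straight strand along the first axis, and the circle is a
   slightly tilted unit circle meeting the strand once. Smoothing the singular crossing gives the strand
   with a detour once around the circle, which can be pulled straight again; making it positive gives an
   unlinked circle. The value of the link with an unlinked circle, lying in the block of the strand, follows
   from the skein rule III at the self-crossing of a curl, because both curls are isotopic to the strand
   and their smoothing is the strand with an unlinked circle. So Phi(M) = (x + y t) F(L),
   Psi(M) = (x + y / (a sqrt c)) F(L) and I_PR(M) = (x + y t) P(L) with t independent of L, and the two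
   factors do not vanish because the variables are independent. *)

theory Submission
  imports Defs
begin

section \<open>Curves, links and straight-line isotopies\<close>

text \<open>Isotopies and skein triples are conditions on parametrized curves, so every move needs
  an explicit path of curves. Linear interpolation suffices because each path keeps something that
  certifies injectivity: the projection up to translation, a linear functional that increases along
  the strand, or an invertible 2x2 matrix that keeps the circle off the axis. Apart from a
  homothety, all motion takes place over a region containing a single straight strand, so the rest
  of the link never enters the estimates.

  The obstacle is the partition. In the rule for Phi the positive resolution carries the merged
  partition, whereas rule II evaluates an unlinked circle only as a block of its own. Rule III at a
  self-crossing leaves the partition of the link alone and yet has a smoothing whose new circle
  shares the block of the strand; it gives t = (1/(u r) - r)/(1 - 1/u), with r the root of c. In the
  rule for Psi nothing is merged in the positive resolution, and rule II gives 1/(a r). Since r is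
  known only through its square, the factors are shown to be nonzero by eliminating r.\<close>

abbreviation vec3 :: "real \<Rightarrow> real \<Rightarrow> real \<Rightarrow> real^3" where
  "vec3 x y z \<equiv> vector [x, y, z]"

section \<open>Calculus of continuously differentiable curves\<close>

lemma vec3_eq_iff: "(v :: real^3) = w \<longleftrightarrow> v $ 1 = w $ 1 \<and> v $ 2 = w $ 2 \<and> v $ 3 = w $ 3"
  by (auto simp: vec_eq_iff forall_3)

lemma has_vector_derivative_vec3:
  assumes "(x has_real_derivative x') (at s)" "(y has_real_derivative y') (at s)"
    "(z has_real_derivative z') (at s)"
  shows "((\<lambda>s. vec3 (x s) (y s) (z s)) has_vector_derivative vec3 x' y' z') (at s)"
proof -
  have e: "vec3 p q r = p *\<^sub>R axis 1 1 + q *\<^sub>R axis 2 1 + r *\<^sub>R axis 3 1" for p q r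
    by (simp add: vec3_eq_iff axis_def)
  show ?thesis
    unfolding e by (auto intro!: derivative_eq_intros assms)
qed

lemma has_real_derivative_vec_nth:
  assumes "((f :: real \<Rightarrow> real^3) has_vector_derivative f') (at s)"
  shows "((\<lambda>s. f s $ k) has_real_derivative f' $ k) (at s)"
  using bounded_linear.has_vector_derivative[OF bounded_linear_vec_nth assms]
  by (simp add: has_real_derivative_iff_has_vector_derivative)

lemma continuous_on_vec3:
  assumes "continuous_on S x" "continuous_on S y" "continuous_on S z"
  shows "continuous_on S (\<lambda>s. vec3 (x s) (y s) (z s))"
proof -
  have e: "vec3 p q r = p *\<^sub>R axis 1 1 + q *\<^sub>R axis 2 1 + r *\<^sub>R axis 3 1" for p q r
    by (simp add: vec3_eq_iff axis_def)
  show ?thesis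
    unfolding e by (intro continuous_intros assms)
qed

text \<open>The derivative is carried along as a second curve, so that interpolation, gluing and
  periodization act on pairs; \<open>velocity\<close> is identified with it afterwards by uniqueness
  of derivatives.\<close>

definition C1 :: "curve \<Rightarrow> curve \<Rightarrow> bool" where
  "C1 \<gamma> \<gamma>' \<longleftrightarrow> (\<forall>s. (\<gamma> has_vector_derivative \<gamma>' s) (at s)) \<and> continuous_on UNIV \<gamma>'"

lemma C1_D: "C1 \<gamma> \<gamma>' \<Longrightarrow> (\<gamma> has_vector_derivative \<gamma>' s) (at s)"
  by (simp add: C1_def)

lemma C1_velocity: "C1 \<gamma> \<gamma>' \<Longrightarrow> velocity \<gamma> = \<gamma>'"
  by (auto simp: C1_def velocity_def fun_eq_iff intro: vector_derivative_at)

lemma closed_curve_iff: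
  "closed_curve \<gamma> \<longleftrightarrow> (\<forall>s. \<gamma> (s + 1) = \<gamma> s) \<and> C1 \<gamma> (velocity \<gamma>) \<and> (\<forall>s. velocity \<gamma> s \<noteq> 0)"
  unfolding closed_curve_def C1_def velocity_def vector_derivative_works[symmetric] by blast

lemma closed_curveI:
  assumes "\<And>s. \<gamma> (s + 1) = \<gamma> s" "C1 \<gamma> \<gamma>'" "\<And>s. \<gamma>' s \<noteq> 0"
  shows "closed_curve \<gamma>"
  using assms by (simp add: closed_curve_iff C1_velocity[OF assms(2)])

lemma closed_curve_C1: "closed_curve \<gamma> \<Longrightarrow> C1 \<gamma> (velocity \<gamma>)"
  by (simp add: closed_curve_iff)

lemma C1_lerp:
  assumes "C1 f f'" "C1 g g'"
  shows "C1 (\<lambda>s. a *\<^sub>R f s + b *\<^sub>R g s) (\<lambda>s. a *\<^sub>R f' s + b *\<^sub>R g' s)"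
  using assms by (auto simp: C1_def intro!: derivative_eq_intros continuous_intros)

lemma C1_affine_param:
  assumes "C1 f f'"
  shows "C1 (\<lambda>s. f (v * (s - c))) (\<lambda>s. v *\<^sub>R f' (v * (s - c)))"
  unfolding C1_def
proof (intro conjI allI)
  fix s
  have "((\<lambda>s. v * (s - c)) has_real_derivative v) (at s)"
    by (auto intro!: derivative_eq_intros)
  then have "((\<lambda>s. v * (s - c)) has_vector_derivative v) (at s)"
    by (simp only: has_real_derivative_iff_has_vector_derivative)
  from vector_diff_chain_at[OF this C1_D[OF assms]]
  show "((\<lambda>s. f (v * (s - c))) has_vector_derivative v *\<^sub>R f' (v * (s - c))) (at s)"
    by (simp add: o_def)
next
  have "continuous_on UNIV f'" using assms by (simp add: C1_def)
  then have "continuous_on UNIV (\<lambda>s. f' (v * (s - c)))"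
    by (rule continuous_on_compose2) (auto intro!: continuous_intros)
  then show "continuous_on UNIV (\<lambda>s. v *\<^sub>R f' (v * (s - c)))"
    by (intro continuous_intros)
qed

lemma C1_continuous: "C1 f f' \<Longrightarrow> continuous_on UNIV f"
  by (meson C1_D continuous_at_imp_continuous_on has_vector_derivative_continuous)

lemma C1_If:
  assumes f: "C1 f f'" and g: "C1 g g'" and "f c = g c" "f' c = g' c"
  shows "C1 (\<lambda>s. if s \<le> c then f s else g s) (\<lambda>s. if s \<le> c then f' s else g' s)"
  unfolding C1_def
proof (intro conjI allI)
  fix s :: real
  have eq: "s \<in> closure {..c} \<Longrightarrow> s \<in> closure {c<..} \<Longrightarrow> s = c"
    by (simp add: closure_greaterThan)
  have "((\<lambda>x. if x \<in> {..c} then f x else g x) has_vector_derivative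
      (if s \<in> {..c} then f' s else g' s)) (at s within UNIV)"
  proof (rule has_vector_derivative_If_within_closures[where T = "{c<..}"])
    show "s \<in> {..c} \<union> {c<..}" "UNIV = {..c} \<union> {c<..}" by auto
    show "(f has_vector_derivative f' s) (at s within {..c} \<union> closure {..c} \<inter> closure {c<..})"
      "(g has_vector_derivative g' s) (at s within {c<..} \<union> closure {..c} \<inter> closure {c<..})"
      by (rule has_vector_derivative_at_within, rule C1_D[OF f] C1_D[OF g])+
    show "f s = g s" "f' s = g' s" if "s \<in> closure {..c}" "s \<in> closure {c<..}"
      using eq[OF that] assms by simp_all
  qed
  then show "((\<lambda>s. if s \<le> c then f s else g s) has_vector_derivative
      (if s \<le> c then f' s else g' s)) (at s)" by simp
next
  have "continuous_on ({..c} \<union> {c..}) (\<lambda>s. if s \<le> c then f' s else g' s)"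
    by (rule continuous_on_cases)
      (use assms in \<open>auto simp: C1_def intro: continuous_on_subset\<close>)
  moreover have "{..c} \<union> {c..} = UNIV" by auto
  ultimately show "continuous_on UNIV (\<lambda>s. if s \<le> c then f' s else g' s)" by simp
qed

lemma C1_vec3:
  assumes "\<And>s. (x has_real_derivative x' s) (at s)" "\<And>s. (y has_real_derivative y' s) (at s)"
    "\<And>s. (z has_real_derivative z' s) (at s)"
    "continuous_on UNIV x'" "continuous_on UNIV y'" "continuous_on UNIV z'"
  shows "C1 (\<lambda>s. vec3 (x s) (y s) (z s)) (\<lambda>s. vec3 (x' s) (y' s) (z' s))"
  using assms by (auto simp: C1_def intro!: has_vector_derivative_vec3 continuous_on_vec3)

text \<open>\<open>p\<close> reduces the parameter to the period centred at \<open>s0\<close> and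
  jumps half a period away from it. Both \<open>f\<close> and \<open>f'\<close> vanish there, so
  near every parameter the periodized function is a mere translate of \<open>f\<close>, and
  differentiability is local.\<close>

lemma C1_periodize:
  fixes s0 \<rho> :: real
  assumes f: "C1 f f'" and \<rho>: "\<rho> < 1 / 2"
    and z: "\<And>s. \<bar>s - s0\<bar> \<ge> \<rho> \<Longrightarrow> f s = 0 \<and> f' s = 0"
  defines "p \<equiv> \<lambda>s. s - of_int \<lfloor>s - s0 + 1 / 2\<rfloor>"
  shows "C1 (\<lambda>s. f (p s)) (\<lambda>s. f' (p s))"
proof -
  \<comment> \<open>If two parameters this close are reduced by different integers, a jump lies
    between them, and either integer sends \<open>s'\<close> to a point at distance at least \<rho>
    from \<open>s0\<close>, where everything is 0.\<close>
  have loc: "f (p s') = f (s' - of_int \<lfloor>s - s0 + 1 / 2\<rfloor>) \<and>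
      f' (p s') = f' (s' - of_int \<lfloor>s - s0 + 1 / 2\<rfloor>)" if d: "dist s' s < 1 / 2 - \<rho>" for s s'
  proof -
    define n n' where "n = \<lfloor>s - s0 + 1 / 2\<rfloor>" and "n' = \<lfloor>s' - s0 + 1 / 2\<rfloor>"
    have n: "of_int n \<le> s - s0 + 1 / 2" "s - s0 + 1 / 2 < of_int n + 1"
      unfolding n_def by (rule of_int_floor_le, rule floor_correct[THEN conjunct2, unfolded of_int_add of_int_1])
    have n': "of_int n' \<le> s' - s0 + 1 / 2" "s' - s0 + 1 / 2 < of_int n' + 1"
      unfolding n'_def by (rule of_int_floor_le, rule floor_correct[THEN conjunct2, unfolded of_int_add of_int_1])
    have d': "s' - s < 1 / 2 - \<rho>" "s - s' < 1 / 2 - \<rho>" using d by (simp_all add: dist_real_def abs_less_iff)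
    show ?thesis
      unfolding p_def n_def[symmetric] n'_def[symmetric]
    proof (cases "n = n'")
      case False
      then have "n + 1 \<le> n' \<or> n' + 1 \<le> n" by arith
      then have "real_of_int (n + 1) \<le> of_int n' \<or> real_of_int (n' + 1) \<le> of_int n"
        by (simp only: of_int_le_iff)
      then consider "real_of_int n + 1 \<le> of_int n'" | "real_of_int n' + 1 \<le> of_int n"
        by (auto simp only: of_int_add of_int_1)
      then have "\<bar>s' - of_int n - s0\<bar> \<ge> \<rho> \<and> \<bar>s' - of_int n' - s0\<bar> \<ge> \<rho>"
      proof cases
        case 1
        then have "s' - of_int n - s0 \<ge> \<rho>" "- (s' - of_int n' - s0) \<ge> \<rho>"
          using n n' d' \<rho> by linarith+
        then show ?thesis by linarith
      next
        case 2
        then have "- (s' - of_int n - s0) \<ge> \<rho>" "s' - of_int n' - s0 \<ge> \<rho>"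
          using n n' d' \<rho> by linarith+
        then show ?thesis by linarith
      qed
      then show "f (s' - of_int n') = f (s' - of_int n) \<and> f' (s' - of_int n') = f' (s' - of_int n)"
        using z by metis
    qed simp
  qed
  have pos: "0 < 1 / 2 - \<rho>" using \<rho> by simp
  show ?thesis
    unfolding C1_def
  proof (intro conjI allI)
    fix s
    let ?n = "real_of_int \<lfloor>s - s0 + 1 / 2\<rfloor>"
    have "((\<lambda>s'. f (1 * (s' - ?n))) has_vector_derivative 1 *\<^sub>R f' (1 * (s - ?n))) (at s)"
      by (rule C1_D[OF C1_affine_param[OF f]])
    then have "((\<lambda>s'. f (s' - ?n)) has_vector_derivative f' (p s)) (at s)"
      by (simp add: p_def)
    then show "((\<lambda>s. f (p s)) has_vector_derivative f' (p s)) (at s)"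
    proof (rule has_vector_derivative_transform_within[OF _ pos])
      show "f (s' - ?n) = f (p s')" if "dist s' s < 1 / 2 - \<rho>" for s'
        using loc[OF that] by (rule conjunct1[THEN sym])
    qed simp
  next
    show "continuous_on UNIV (\<lambda>s. f' (p s))"
    proof (intro continuous_at_imp_continuous_on ballI)
      fix s :: real
      let ?n = "real_of_int \<lfloor>s - s0 + 1 / 2\<rfloor>"
      have c: "continuous_on UNIV f'" using f by (simp add: C1_def)
      have "continuous_on UNIV (\<lambda>s'. f' (s' - ?n))"
        by (rule continuous_on_compose2[OF c]) (auto intro!: continuous_intros)
      then have "isCont (\<lambda>s'. f' (s' - ?n)) s"
        by (simp add: continuous_on_eq_continuous_at)
      then show "isCont (\<lambda>s. f' (p s)) s"
      proof (rule continuous_transform_within[OF _ pos])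
        show "f' (s' - ?n) = f' (p s')" if "dist s' s < 1 / 2 - \<rho>" for s'
          using loc[OF that] by (rule conjunct2[THEN sym])
      qed simp
    qed
  qed
qed

lemma closed_curve_shift_int:
  assumes "closed_curve \<gamma>"
  shows "\<gamma> (s + of_int n) = \<gamma> s"
proof -
  have N: "\<gamma> (s + of_nat k) = \<gamma> s" for s k
  proof (induction k)
    case (Suc k)
    have "\<gamma> ((s + of_nat k) + 1) = \<gamma> (s + of_nat k)" using assms by (simp add: closed_curve_def)
    then show ?case using Suc by (simp add: add_ac)
  qed simp
  show ?thesis
  proof (cases "n \<ge> 0")
    case True then show ?thesis using N[of s "nat n"] by simp
  next
    case False then show ?thesis using N[of "s + of_int n" "nat (- n)"] by simp
  qed
qed

lemma closed_curve_Ints: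
  assumes "closed_curve \<gamma>" "s - t \<in> \<int>" shows "\<gamma> s = \<gamma> t"
proof -
  obtain n where "s - t = of_int n" using assms by (auto elim: Ints_cases)
  then have "s = t + of_int n" by simp
  then show ?thesis using closed_curve_shift_int[OF assms(1)] by simp
qed

lemma velocity_Ints:
  assumes "closed_curve \<gamma>" "s - t \<in> \<int>"
  shows "velocity \<gamma> s = velocity \<gamma> t"
proof -
  have D: "(\<gamma> has_vector_derivative velocity \<gamma> t) (at t)"
    by (rule C1_D[OF closed_curve_C1[OF assms(1)]])
  have "((\<lambda>s'. s' - (s - t)) has_vector_derivative 1) (at s)"
    by (auto intro!: derivative_eq_intros)
  from vector_diff_chain_at[OF this, of \<gamma> "velocity \<gamma> t"]
  have "((\<lambda>s'. \<gamma> (s' - (s - t))) has_vector_derivative velocity \<gamma> t) (at s)"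
    using D by (simp add: o_def)
  moreover have "(\<lambda>s'. \<gamma> (s' - (s - t))) = \<gamma>"
  proof
    fix s'
    have "s' - (s - t) - s' \<in> \<int>" using Ints_minus[OF assms(2)] by simp
    then show "\<gamma> (s' - (s - t)) = \<gamma> s'" by (rule closed_curve_Ints[OF assms(1)])
  qed
  ultimately show ?thesis
    unfolding velocity_def using vector_derivative_at by auto
qed

section \<open>Parameters modulo the integers and embedded links\<close>

lemma frac_diff_Ints: "frac s - s \<in> \<int>" "s - frac s \<in> \<int>"
  by (auto simp: frac_def)

lemma frac_params: "m < length L \<Longrightarrow> (m, frac s) \<in> params L"
  by (simp add: params_def frac_lt_1)

text \<open>Injectivity on a disjoint union of circles, with real parameters taken modulo the
  integers: reparametrized and recentred parameters do not stay among the representatives in [0, 1)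
  used by \<open>double_pairs\<close>.\<close>

definition embedded :: "link \<Rightarrow> bool" where
  "embedded L \<longleftrightarrow> (\<forall>m n s t. m < length L \<longrightarrow> n < length L \<longrightarrow> (L ! m) s = (L ! n) t \<longrightarrow>
     m = n \<and> s - t \<in> \<int>)"

lemma embeddedD:
  "embedded L \<Longrightarrow> m < length L \<Longrightarrow> n < length L \<Longrightarrow> (L ! m) s = (L ! n) t \<Longrightarrow> m = n \<and> s - t \<in> \<int>"
  by (auto simp: embedded_def)

lemma Ints_unit_interval:
  assumes "s - t \<in> \<int>" "s \<in> {0..<1}" "t \<in> {0..<1::real}" shows "s = t"
proof -
  obtain n where n: "s - t = of_int n" using assms by (auto elim: Ints_cases)
  then have "of_int n < (1 :: real)" "of_int n > (-1 :: real)" using assms by auto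
  then have "n = 0" by linarith
  then show ?thesis using n by simp
qed

lemma embedded_iff:
  assumes "\<forall>\<gamma>\<in>set L. closed_curve \<gamma>"
  shows "embedded L \<longleftrightarrow> double_pairs L = {}"
proof
  assume "embedded L"
  then show "double_pairs L = {}"
  proof (intro equals0I)
    fix pq assume "embedded L" "pq \<in> double_pairs L"
    then obtain m s n t where "pq = ((m, s), (n, t))" "m < length L" "n < length L"
      "s \<in> {0..<1}" "t \<in> {0..<1}" "(L ! m) s = (L ! n) t" "(m, s) \<noteq> (n, t)"
      by (cases pq; cases "fst pq"; cases "snd pq") (simp add: double_pairs_def params_def pt_def)
    then show False
      using embeddedD[OF \<open>embedded L\<close>] Ints_unit_interval by blast
  qed
next
  assume *: "double_pairs L = {}"
  show "embedded L" unfolding embedded_def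
  proof (intro allI impI)
    fix m n s t assume a: "m < length L" "n < length L" "(L ! m) s = (L ! n) t"
    have "(L ! m) (frac s) = (L ! m) s" "(L ! n) (frac t) = (L ! n) t"
      using a(1,2) assms by (metis nth_mem closed_curve_Ints frac_diff_Ints(1))+
    then have "pt L (m, frac s) = pt L (n, frac t)" using a by (simp add: pt_def)
    then have "m = n \<and> frac s = frac t"
      using * a frac_params[of m L s] frac_params[of n L t]
      unfolding double_pairs_def by blast
    moreover have "s - t = of_int (\<lfloor>s\<rfloor> - \<lfloor>t\<rfloor>)" if "frac s = frac t"
      using that by (simp add: frac_def)
    ultimately show "m = n \<and> s - t \<in> \<int>" by (metis Ints_of_int)
  qed
qed

lemma classical_iff:
  "classical_link L \<longleftrightarrow> L \<noteq> [] \<and> (\<forall>\<gamma>\<in>set L. closed_curve \<gamma>) \<and> embedded L"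
  using embedded_iff by (auto simp: classical_link_def singular_link_def)

lemma classical_singular: "classical_link L \<Longrightarrow> singular_link L"
  by (simp add: classical_link_def)

section \<open>Interpolation of links\<close>

definition lerp :: "real \<Rightarrow> link \<Rightarrow> link \<Rightarrow> link" where
  "lerp t L L' = map2 (\<lambda>\<gamma> \<delta> s. (1 - t) *\<^sub>R \<gamma> s + t *\<^sub>R \<delta> s) L L'"

lemma length_lerp [simp]: "length L = length L' \<Longrightarrow> length (lerp t L L') = length L"
  by (simp add: lerp_def)

lemma nth_lerp:
  "length L = length L' \<Longrightarrow> i < length L \<Longrightarrow>
    lerp t L L' ! i = (\<lambda>s. (1 - t) *\<^sub>R (L ! i) s + t *\<^sub>R (L' ! i) s)"
  by (simp add: lerp_def)

lemma lerp_0: "length L = length L' \<Longrightarrow> lerp 0 L L' = L"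
  by (auto simp: nth_lerp intro!: nth_equalityI)

lemma lerp_1: "length L = length L' \<Longrightarrow> lerp 1 L L' = L'"
  by (auto simp: nth_lerp intro!: nth_equalityI)

lemma reparametrization_id: "reparametrization (\<lambda>s. s)"
  unfolding reparametrization_def
  by (auto intro!: exI[of _ "\<lambda>_. 1"] derivative_eq_intros)

text \<open>The interpolation and its velocity are jointly continuous in time and parameter, being
  affine combinations of continuous curves, so only singularity type and double pairs have to be
  watched; the closing reparametrization is the identity.\<close>

lemma isotopic_via_lerp:
  assumes len: "length L = length L'"
    and cc: "\<forall>\<gamma>\<in>set L. closed_curve \<gamma>" "\<forall>\<gamma>\<in>set L'. closed_curve \<gamma>"
    and sing: "\<And>t. t \<in> {0..1} \<Longrightarrow> singular_link (lerp t L L') \<and>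
      double_pairs (lerp t L L') = double_pairs L"
  shows "isotopic_via id L L'"
  unfolding isotopic_via_def
proof (intro conjI exI[of _ "\<lambda>t. lerp t L L'"] ballI allI impI)
  show "singular_link L" using sing[of 0] lerp_0[OF len] by simp
  show "singular_link L'" using sing[of 1] lerp_1[OF len] by simp
  show "length L = length L'" by (fact len)
  show "id permutes {..<length L}" by (rule permutes_id)
  show "lerp 0 L L' = L" by (rule lerp_0[OF len])
  show "length (lerp t L L') = length L" if "t \<in> {0..1}" for t using len by simp
  show "singular_link (lerp t L L')" "double_pairs (lerp t L L') = double_pairs L"
    if "t \<in> {0..1}" for t using sing[OF that] by auto
next
  fix i assume i: "i < length L"
  have c: "C1 (L ! i) (velocity (L ! i))" "C1 (L' ! i) (velocity (L' ! i))"
    using i len cc by (auto intro!: closed_curve_C1)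
  note cont = C1_continuous[OF c(1)] C1_continuous[OF c(2)]
    conjunct2[OF c(1)[unfolded C1_def]] conjunct2[OF c(2)[unfolded C1_def]]
  have sub: "continuous_on ({0..1} \<times> UNIV) (\<lambda>p :: real \<times> real. f (snd p))"
    if "continuous_on UNIV f" for f :: curve
    by (rule continuous_on_compose2[OF that continuous_on_snd[OF continuous_on_id]]) simp
  note cont = cont[THEN sub]
  show "continuous_on ({0..1} \<times> UNIV) (\<lambda>(t, s). (lerp t L L' ! i) s)"
    unfolding nth_lerp[OF len i] case_prod_beta
    by (intro continuous_intros cont)
  have v: "velocity (lerp t L L' ! i) = (\<lambda>s. (1 - t) *\<^sub>R velocity (L ! i) s + t *\<^sub>R velocity (L' ! i) s)" for t
    unfolding nth_lerp[OF len i] by (rule C1_velocity[OF C1_lerp[OF c]])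
  show "continuous_on ({0..1} \<times> UNIV) (\<lambda>(t, s). velocity (lerp t L L' ! i) s)"
    unfolding v case_prod_beta
    by (intro continuous_intros cont)
  show "\<exists>\<phi>. reparametrization \<phi> \<and> lerp 1 L L' ! i = (L' ! id i) \<circ> \<phi>"
    by (rule exI[of _ "\<lambda>s. s"]) (simp add: reparametrization_id lerp_1[OF len] o_def)
qed

lemma isotopic_via_lerp_classical:
  assumes "length L = length L'" "classical_link L" "classical_link L'"
    and "\<And>t. t \<in> {0..1} \<Longrightarrow> classical_link (lerp t L L')"
  shows "isotopic_via id L L'"
  by (rule isotopic_via_lerp) (use assms in \<open>auto simp: classical_link_def singular_link_def\<close>)

section \<open>Reparametrizations and the transfer of embeddedness\<close>

lemma reparametrization_shift_int:
  assumes "reparametrization \<phi>"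
  shows "\<phi> (s + of_int n) = \<phi> s + of_int n"
proof -
  have N: "\<phi> (s + of_nat k) = \<phi> s + of_nat k" for s k
  proof (induction k)
    case (Suc k)
    have "\<phi> ((s + of_nat k) + 1) = \<phi> (s + of_nat k) + 1"
      using assms by (simp add: reparametrization_def)
    then show ?case using Suc by (simp add: add_ac)
  qed simp
  show ?thesis
  proof (cases "n \<ge> 0")
    case True then show ?thesis using N[of s "nat n"] by simp
  next
    case False then show ?thesis using N[of "s + of_int n" "nat (- n)"] by simp
  qed
qed

lemma reparametrization_surj:
  assumes "reparametrization \<phi>"
  obtains t where "\<phi> t = s"
proof -
  \<comment> \<open>\<phi> takes the ends of the interval from \<open>n\<close> to
    \<open>n + 1\<close> to the ends of an interval of length 1 that contains
    \<open>s\<close>.\<close>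
  define n where "n = \<lfloor>s - \<phi> 0\<rfloor>"
  have c: "isCont \<phi> x" for x
    using assms by (auto simp: reparametrization_def intro: DERIV_isCont)
  have e: "\<phi> (of_int n) = \<phi> 0 + of_int n" "\<phi> (of_int n + 1) = \<phi> 0 + of_int n + 1"
    using reparametrization_shift_int[OF assms, of 0 n] assms
    by (auto simp: reparametrization_def)
  have "\<phi> (of_int n) \<le> s" unfolding e using of_int_floor_le[of "s - \<phi> 0"] unfolding n_def by argo
  moreover have "s \<le> \<phi> (of_int n + 1)"
    using e floor_correct[of "s - \<phi> 0"] by (simp only: n_def of_int_add of_int_1) linarith
  ultimately obtain t where "\<phi> t = s"
    using IVT[of \<phi> "of_int n" s "of_int n + 1"] c by auto
  then show ?thesis by (rule that)
qed

text \<open>Double pairs are preserved up to the end of the path, but the target is a renumbered and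
  reparametrized copy of that end. A coincidence in the target is pulled back through the surjective
  reparametrizations; the integer difference of parameters found there is carried forward, since
  reparametrizations commute with integer shifts.\<close>

lemma isotopic_via_classical:
  assumes iso: "isotopic_via \<sigma> L L'" and cl: "classical_link L"
  shows "classical_link L'"
proof -
  have L': "singular_link L'" "length L = length L'" and \<sigma>: "\<sigma> permutes {..<length L}"
    using iso[unfolded isotopic_via_def] by (blast+)
  obtain H where Ht: "\<forall>t\<in>{0..1::real}. length (H t) = length L \<and> singular_link (H t) \<and>
        double_pairs (H t) = double_pairs L"
    and Hi: "\<forall>i<length L. continuous_on ({0..1} \<times> UNIV) (\<lambda>(t, s). (H t ! i) s) \<and>
           continuous_on ({0..1} \<times> UNIV) (\<lambda>(t, s). velocity (H t ! i) s) \<and>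
           (\<exists>\<phi>. reparametrization \<phi> \<and> H 1 ! i = (L' ! \<sigma> i) \<circ> \<phi>)"
    using iso[unfolded isotopic_via_def] by (elim conjE exE) (rule that)
  have H: "length (H 1) = length L" "singular_link (H 1)" "double_pairs (H 1) = double_pairs L"
    using Ht by simp_all
  have re: "\<forall>i<length L. \<exists>\<phi>. reparametrization \<phi> \<and> H 1 ! i = (L' ! \<sigma> i) \<circ> \<phi>"
    using Hi by blast
  define \<phi> where "\<phi> i = (SOME \<phi>. reparametrization \<phi> \<and> H 1 ! i = (L' ! \<sigma> i) \<circ> \<phi>)" for i
  have \<phi>: "reparametrization (\<phi> i)" "H 1 ! i = (L' ! \<sigma> i) \<circ> \<phi> i" if "i < length L" for i
    using someI_ex[OF re[rule_format, OF that]] unfolding \<phi>_def by blast+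
  have emb: "embedded (H 1)"
    using H cl embedded_iff[of "H 1"] by (auto simp: classical_link_def singular_link_def)
  have im: "\<sigma> ` {..<length L} = {..<length L}" by (rule permutes_image[OF \<sigma>])
  have "embedded L'" unfolding embedded_def
  proof (intro allI impI)
    fix m n s t
    assume a: "m < length L'" "n < length L'" "(L' ! m) s = (L' ! n) t"
    obtain i j where ij: "i < length L" "j < length L" "m = \<sigma> i" "n = \<sigma> j"
    proof -
      have "m \<in> \<sigma> ` {..<length L}" "n \<in> \<sigma> ` {..<length L}" using a L' im by simp_all
      then show thesis using that by blast
    qed
    obtain s' t' where st: "\<phi> i s' = s" "\<phi> j t' = t"
      using reparametrization_surj[OF \<phi>(1)[OF ij(1)]] reparametrization_surj[OF \<phi>(1)[OF ij(2)]] by metis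
    have "(H 1 ! i) s' = (H 1 ! j) t'" using \<phi>(2) ij st a by simp
    then have *: "i = j" "s' - t' \<in> \<int>" using embeddedD[OF emb] ij H by auto
    then obtain k where "s' - t' = of_int k" by (auto elim: Ints_cases)
    then have "s' = t' + of_int k" by simp
    then have "s = t + of_int k"
      using reparametrization_shift_int[OF \<phi>(1)[OF ij(2)]] st * by metis
    then show "m = n \<and> s - t \<in> \<int>" using ij * by simp
  qed
  then show ?thesis using L' by (auto simp: classical_iff singular_link_def)
qed

section \<open>Adding a loop\<close>

lemma classical_append_loop:
  assumes L: "classical_link L" and C: "closed_curve C" "\<And>s t. C s = C t \<Longrightarrow> s - t \<in> \<int>"
    and dis: "\<And>m s t. m < length L \<Longrightarrow> (L ! m) s \<noteq> C t"
  shows "classical_link (L @ [C])"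
  unfolding classical_iff embedded_def
proof (intro conjI allI impI)
  show "L @ [C] \<noteq> []" by simp
  show "\<forall>\<gamma>\<in>set (L @ [C]). closed_curve \<gamma>" using L C by (simp add: classical_iff)
  fix m n s t
  assume a: "m < length (L @ [C])" "n < length (L @ [C])" "((L @ [C]) ! m) s = ((L @ [C]) ! n) t"
  have emb: "embedded L" using L by (simp add: classical_iff)
  have "m < length L \<or> m = length L" "n < length L \<or> n = length L" using a by auto
  then consider "m < length L" "n < length L" | "m = length L" "n = length L"
    | "m < length L" "n = length L" | "m = length L" "n < length L" by blast
  then have "m = n \<and> s - t \<in> \<int>"
  proof cases
    case 1 then show ?thesis using a embeddedD[OF emb] by (simp add: nth_append)
  next
    case 2 then show ?thesis using a C(2) by simp
  next
    case 3 then show ?thesis using a dis[of m s t] by (simp add: nth_append)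
  next
    case 4 then show ?thesis using a dis[of n t s] by (simp add: nth_append)
  qed
  then show "m = n" "s - t \<in> \<int>" by auto
qed

text \<open>The double pairs are computed exactly, with \<open>frac sp\<close> and 0 as
  representatives in [0, 1). An isotopy of singular links must keep this very set, and any two loops
  touching at the same parameters share it.\<close>

lemma singular_append_touching:
  assumes L: "classical_link L" and i: "i < length L"
    and C: "closed_curve C" "\<And>s t. C s = C t \<Longrightarrow> s - t \<in> \<int>"
    and touch: "\<And>m s t. m < length L \<Longrightarrow> (L ! m) s = C t \<Longrightarrow> m = i \<and> s - sp \<in> \<int> \<and> t \<in> \<int>"
    and meet: "(L ! i) sp = C 0"
    and trans: "\<not> collinear {0, velocity (L ! i) sp, velocity C 0}"
  shows "singular_link (L @ [C]) \<and>
    double_pairs (L @ [C]) = {((i, frac sp), (length L, 0)), ((length L, 0), (i, frac sp))}"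
proof -
  let ?M = "L @ [C]" and ?k = "length L"
  have emb: "embedded L" and cc: "\<forall>\<gamma>\<in>set L. closed_curve \<gamma>" using L by (simp_all add: classical_iff)
  have cci: "closed_curve (L ! i)" using cc i by simp
  have sp: "(L ! i) (frac sp) = (L ! i) sp" "velocity (L ! i) (frac sp) = velocity (L ! i) sp"
    by (rule closed_curve_Ints[OF cci frac_diff_Ints(1)], rule velocity_Ints[OF cci frac_diff_Ints(1)])
  have fr: "frac sp \<in> {0..<1}" by (simp add: frac_lt_1)
  have fI: "s = frac sp" if "s \<in> {0..<1}" "s - sp \<in> \<int>" for s
  proof -
    have "s - frac sp = (s - sp) + (sp - frac sp)" by simp
    then have "s - frac sp \<in> \<int>" using that(2) frac_diff_Ints(2) Ints_add by metis
    then show ?thesis using Ints_unit_interval[OF _ that(1) fr] by blast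
  qed
  have zI: "t = 0" if "t \<in> {0..<1}" "t \<in> \<int>" for t :: real
    using Ints_unit_interval[of t 0] that by simp
  have dp: "double_pairs ?M = {((i, frac sp), (?k, 0)), ((?k, 0), (i, frac sp))}" (is "?A = ?B")
  proof
    show "?A \<subseteq> ?B"
    proof
      fix pq assume "pq \<in> ?A"
      then obtain m s n t where pq: "pq = ((m, s), (n, t))" "m < Suc ?k" "n < Suc ?k"
        "s \<in> {0..<1}" "t \<in> {0..<1}" "(?M ! m) s = (?M ! n) t" "(m, s) \<noteq> (n, t)"
        by (cases pq; cases "fst pq"; cases "snd pq") (simp add: double_pairs_def params_def pt_def)
      have "m < length L \<or> m = length L" "n < length L \<or> n = length L" using pq by auto
      then consider "m < length L" "n < length L" | "m = length L" "n = length L"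
        | "m < length L" "n = length L" | "m = length L" "n < length L" by blast
      then show "pq \<in> ?B"
      proof cases
        case 1
        then have "m = n \<and> s - t \<in> \<int>" using pq embeddedD[OF emb] by (simp add: nth_append)
        then show ?thesis using pq Ints_unit_interval by blast
      next
        case 2
        then have "s - t \<in> \<int>" using pq C(2) by simp
        then show ?thesis using pq 2 Ints_unit_interval by blast
      next
        case 3
        then have "m = i \<and> s - sp \<in> \<int> \<and> t \<in> \<int>" using pq touch[of m s t] by (simp add: nth_append)
        then show ?thesis using pq 3 fI zI by blast
      next
        case 4
        then have "n = i \<and> t - sp \<in> \<int> \<and> s \<in> \<int>" using pq touch[of n t s] by (simp add: nth_append)
        then show ?thesis using pq 4 fI zI by blast
      qed
    qed
    show "?B \<subseteq> ?A"
      using i meet sp fr by (auto simp: double_pairs_def params_def pt_def nth_append)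
  qed
  have "singular_link ?M"
    unfolding singular_link_def dp
  proof (intro conjI)
    have v: "vel ?M (i, frac sp) = velocity (L ! i) sp" "vel ?M (?k, 0) = velocity C 0"
      using i sp by (simp_all add: vel_def nth_append)
    have "\<not> collinear {0, velocity C 0, velocity (L ! i) sp}"
      using trans by (simp add: insert_commute)
    then show "\<forall>(p, q)\<in>{((i, frac sp), (?k, 0)), ((?k, 0), (i, frac sp))}.
        \<not> collinear {0, vel ?M p, vel ?M q}"
      using trans v by simp
    show "\<forall>p q q'. (p, q) \<in> {((i, frac sp), (?k, 0::real)), ((?k, 0), (i, frac sp))} \<and>
        (p, q') \<in> {((i, frac sp), (?k, 0)), ((?k, 0), (i, frac sp))} \<longrightarrow> q = q'"
      using i by auto
  qed (use cc C in auto)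
  then show ?thesis using dp by blast
qed

text \<open>Over \<Omega> the link is part of the first axis. A loop over \<Omega> can therefore
  meet the link only where its second and third coordinates vanish, whatever the link does
  elsewhere.\<close>

definition near_axis :: "(real \<times> real) set \<Rightarrow> link \<Rightarrow> bool" where
  "near_axis \<Omega> L \<longleftrightarrow> (\<forall>m<length L. \<forall>s. plane_proj ((L ! m) s) \<in> \<Omega> \<longrightarrow>
     (L ! m) s $ 2 = 0 \<and> (L ! m) s $ 3 = 0)"

definition simple_loop :: "(real \<times> real) set \<Rightarrow> curve \<Rightarrow> bool" where
  "simple_loop \<Omega> C \<longleftrightarrow> closed_curve C \<and> (\<forall>s t. C s = C t \<longrightarrow> s - t \<in> \<int>) \<and>
     (\<forall>s. plane_proj (C s) \<in> \<Omega>)"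

text \<open>Meeting the axis stands for meeting the link. The last clause is transversality, because
  the strand moves along the axis.\<close>

definition touching_loop :: "(real \<times> real) set \<Rightarrow> real^3 \<Rightarrow> curve \<Rightarrow> bool" where
  "touching_loop \<Omega> p C \<longleftrightarrow> simple_loop \<Omega> C \<and> C 0 = p \<and>
     (\<forall>s. C s $ 2 = 0 \<and> C s $ 3 = 0 \<longrightarrow> s \<in> \<int>) \<and>
     (velocity C 0 $ 2 \<noteq> 0 \<or> velocity C 0 $ 3 \<noteq> 0)"

definition free_loop :: "(real \<times> real) set \<Rightarrow> curve \<Rightarrow> bool" where
  "free_loop \<Omega> C \<longleftrightarrow> simple_loop \<Omega> C \<and> (\<forall>s. C s $ 2 \<noteq> 0 \<or> C s $ 3 \<noteq> 0)"

lemma singular_touching_loop: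
  assumes L: "classical_link L" "near_axis \<Omega> L" "i < length L" "(L ! i) sp = p"
      "velocity (L ! i) sp $ 2 = 0" "velocity (L ! i) sp $ 3 = 0"
    and C: "touching_loop \<Omega> p C"
  shows "singular_link (L @ [C]) \<and>
    double_pairs (L @ [C]) = {((i, frac sp), (length L, 0)), ((length L, 0), (i, frac sp))}"
proof (rule singular_append_touching[OF L(1,3)])
  have emb: "embedded L" using L by (simp add: classical_iff)
  have C': "closed_curve C" "\<And>s t. C s = C t \<Longrightarrow> s - t \<in> \<int>" "\<And>s. plane_proj (C s) \<in> \<Omega>" "C 0 = p"
    "\<And>s. C s $ 2 = 0 \<Longrightarrow> C s $ 3 = 0 \<Longrightarrow> s \<in> \<int>" "velocity C 0 $ 2 \<noteq> 0 \<or> velocity C 0 $ 3 \<noteq> 0"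
    using C unfolding touching_loop_def simple_loop_def by blast+
  show "closed_curve C" "\<And>s t. C s = C t \<Longrightarrow> s - t \<in> \<int>" using C' by blast+
  show "(L ! i) sp = C 0" using C' L by simp
  show "m = i \<and> s - sp \<in> \<int> \<and> t \<in> \<int>" if m: "m < length L" and e: "(L ! m) s = C t" for m s t
  proof -
    have "plane_proj ((L ! m) s) \<in> \<Omega>" using e C'(3) by simp
    then have "C t $ 2 = 0" "C t $ 3 = 0" using L(2) m e unfolding near_axis_def by (metis)+
    then have t: "t \<in> \<int>" using C'(5) by blast
    then have "C t = C 0" using closed_curve_Ints[OF C'(1), of t 0] by simp
    then have "(L ! m) s = (L ! i) sp" using e C'(4) L(4) by simp
    then show ?thesis using embeddedD[OF emb m L(3)] t by blast
  qed
  \<comment> \<open>The velocity of the strand is a nonzero multiple of the first basis vector, that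
    of the loop is not.\<close>
  show "\<not> collinear {0, velocity (L ! i) sp, velocity C 0}"
  proof
    assume c: "collinear {0, velocity (L ! i) sp, velocity C 0}"
    have "velocity (L ! i) sp \<noteq> 0" using L(1,3) by (simp add: classical_iff closed_curve_iff)
    moreover have "velocity C 0 \<noteq> 0" using C'(6) by auto
    ultimately obtain c where "velocity C 0 = c *\<^sub>R velocity (L ! i) sp"
      using c by (auto simp: collinear_lemma)
    then show False using C'(6) L(5,6) by simp
  qed
qed

lemma lerp_append_loop:
  "lerp t (L @ [C]) (L @ [C']) = L @ [\<lambda>s. (1 - t) *\<^sub>R C s + t *\<^sub>R C' s]"
proof (rule nth_equalityI)
  show "length (lerp t (L @ [C]) (L @ [C'])) = length (L @ [\<lambda>s. (1 - t) *\<^sub>R C s + t *\<^sub>R C' s])"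
    by simp
  fix m assume m: "m < length (lerp t (L @ [C]) (L @ [C']))"
  have e: "(1 - t) *\<^sub>R v + t *\<^sub>R v = v" for v :: "real^3"
    by (simp add: scaleR_left_distrib[symmetric])
  show "lerp t (L @ [C]) (L @ [C']) ! m = (L @ [\<lambda>s. (1 - t) *\<^sub>R C s + t *\<^sub>R C' s]) ! m"
    using m by (cases "m < length L") (auto simp: nth_lerp nth_append e)
qed

lemma isotopic_touching_loops:
  assumes L: "classical_link L" "near_axis \<Omega> L" "i < length L" "(L ! i) sp = p"
      "velocity (L ! i) sp $ 2 = 0" "velocity (L ! i) sp $ 3 = 0"
    and C: "\<And>t. t \<in> {0..1} \<Longrightarrow> touching_loop \<Omega> p (\<lambda>s. (1 - t) *\<^sub>R C s + t *\<^sub>R C' s)"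
  shows "isotopic_via id (L @ [C]) (L @ [C'])"
proof (rule isotopic_via_lerp)
  have "touching_loop \<Omega> p C" "touching_loop \<Omega> p C'" using C[of 0] C[of 1] by simp_all
  then have "closed_curve C" "closed_curve C'" and
    dC: "double_pairs (L @ [C]) = {((i, frac sp), (length L, 0)), ((length L, 0), (i, frac sp))}"
    using singular_touching_loop[OF L] by (simp_all add: touching_loop_def simple_loop_def)
  then show "\<forall>\<gamma>\<in>set (L @ [C]). closed_curve \<gamma>" "\<forall>\<gamma>\<in>set (L @ [C']). closed_curve \<gamma>"
    using L(1) by (simp_all add: classical_iff)
  fix t :: real assume t: "t \<in> {0..1}"
  show "singular_link (lerp t (L @ [C]) (L @ [C'])) \<and>
      double_pairs (lerp t (L @ [C]) (L @ [C'])) = double_pairs (L @ [C])"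
    unfolding lerp_append_loop dC using singular_touching_loop[OF L C[OF t]] .
qed simp

lemma classical_free_loop:
  assumes L: "classical_link L" "near_axis \<Omega> L" and C: "free_loop \<Omega> C"
  shows "classical_link (L @ [C])"
proof (rule classical_append_loop[OF L(1)])
  show "closed_curve C" "\<And>s t. C s = C t \<Longrightarrow> s - t \<in> \<int>"
    using C unfolding free_loop_def simple_loop_def by blast+
  show "(L ! m) s \<noteq> C t" if "m < length L" for m s t
    using C that L(2) unfolding free_loop_def simple_loop_def near_axis_def by metis
qed

lemma isotopic_free_loops:
  assumes L: "classical_link L" "near_axis \<Omega> L"
    and C: "\<And>t. t \<in> {0..1} \<Longrightarrow> free_loop \<Omega> (\<lambda>s. (1 - t) *\<^sub>R C s + t *\<^sub>R C' s)"
  shows "isotopic_via id (L @ [C]) (L @ [C'])"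
proof (rule isotopic_via_lerp_classical)
  have "free_loop \<Omega> C" "free_loop \<Omega> C'" using C[of 0] C[of 1] by simp_all
  then show "classical_link (L @ [C])" "classical_link (L @ [C'])"
    using classical_free_loop[OF L] by blast+
  show "classical_link (lerp t (L @ [C]) (L @ [C']))" if "t \<in> {0..1}" for t
    unfolding lerp_append_loop using classical_free_loop[OF L C[OF that]] .
qed simp

section \<open>Homotheties and translations\<close>

definition similar :: "real \<Rightarrow> real^3 \<Rightarrow> link \<Rightarrow> link" where
  "similar \<mu> v L = map (\<lambda>\<gamma> s. \<mu> *\<^sub>R \<gamma> s + v) L"

lemma length_similar [simp]: "length (similar \<mu> v L) = length L"
  by (simp add: similar_def)

lemma nth_similar: "m < length L \<Longrightarrow> similar \<mu> v L ! m = (\<lambda>s. \<mu> *\<^sub>R (L ! m) s + v)"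
  by (simp add: similar_def)

lemma C1_similar:
  assumes "C1 f f'" shows "C1 (\<lambda>s. \<mu> *\<^sub>R f s + v) (\<lambda>s. \<mu> *\<^sub>R f' s)"
  using assms unfolding C1_def
  by (auto intro!: derivative_eq_intros continuous_intros)

lemma velocity_similar:
  assumes "closed_curve f" shows "velocity (\<lambda>s. \<mu> *\<^sub>R f s + v) = (\<lambda>s. \<mu> *\<^sub>R velocity f s)"
  by (rule C1_velocity[OF C1_similar[OF closed_curve_C1[OF assms]]])

lemma closed_curve_similar:
  assumes "closed_curve f" "\<mu> \<noteq> 0" shows "closed_curve (\<lambda>s. \<mu> *\<^sub>R f s + v)"
  using assms
  by (intro closed_curveI[OF _ C1_similar[OF closed_curve_C1[OF assms(1)]]]) (auto simp: closed_curve_iff)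

lemma singular_similar:
  assumes L: "singular_link L" and \<mu>: "\<mu> \<noteq> 0"
  shows "singular_link (similar \<mu> v L) \<and> double_pairs (similar \<mu> v L) = double_pairs L"
proof -
  have cc: "\<forall>\<gamma>\<in>set L. closed_curve \<gamma>" using L by (simp add: singular_link_def)
  have pt: "pt (similar \<mu> v L) p = \<mu> *\<^sub>R pt L p + v" "vel (similar \<mu> v L) p = \<mu> *\<^sub>R vel L p"
    if "p \<in> params L" for p
  proof -
    have "fst p < length L" using that by (auto simp: params_def)
    then show "pt (similar \<mu> v L) p = \<mu> *\<^sub>R pt L p + v" "vel (similar \<mu> v L) p = \<mu> *\<^sub>R vel L p"
      using cc by (simp_all add: pt_def vel_def nth_similar velocity_similar)
  qed
  have par: "params (similar \<mu> v L) = params L" by (simp add: params_def)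
  have eq: "pt (similar \<mu> v L) p = pt (similar \<mu> v L) q \<longleftrightarrow> pt L p = pt L q"
    if "p \<in> params L" "q \<in> params L" for p q
    using that \<mu> by (simp add: pt)
  have dp: "double_pairs (similar \<mu> v L) = double_pairs L"
    unfolding double_pairs_def par using eq by blast
  have col: "collinear {0, \<mu> *\<^sub>R x, \<mu> *\<^sub>R y} \<longleftrightarrow> collinear {0, x, y}" for x y :: "real^3"
  proof -
    have "(\<exists>c. \<mu> *\<^sub>R y = c *\<^sub>R (\<mu> *\<^sub>R x)) \<longleftrightarrow> (\<exists>c. y = c *\<^sub>R x)"
    proof -
      have "\<mu> *\<^sub>R y = c *\<^sub>R (\<mu> *\<^sub>R x) \<longleftrightarrow> y = c *\<^sub>R x" for c
      proof -
        have "c *\<^sub>R (\<mu> *\<^sub>R x) = \<mu> *\<^sub>R (c *\<^sub>R x)" by (simp add: mult.commute)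
        then show ?thesis using \<mu> by (metis scaleR_cancel_left)
      qed
      then show ?thesis by blast
    qed
    then show ?thesis unfolding collinear_lemma using \<mu> by simp
  qed
  have "singular_link (similar \<mu> v L)"
    unfolding singular_link_def dp
  proof (intro conjI)
    show "similar \<mu> v L \<noteq> []" using L by (simp add: similar_def singular_link_def)
    show "\<forall>\<gamma>\<in>set (similar \<mu> v L). closed_curve \<gamma>"
      using cc closed_curve_similar[OF _ \<mu>] by (auto simp: similar_def)
    show "finite (double_pairs L)" using L by (simp add: singular_link_def)
    show "\<forall>p q q'. (p, q) \<in> double_pairs L \<and> (p, q') \<in> double_pairs L \<longrightarrow> q = q'"
      using L unfolding singular_link_def by blast
    show "\<forall>(p, q)\<in>double_pairs L. \<not> collinear {0, vel (similar \<mu> v L) p, vel (similar \<mu> v L) q}"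
    proof safe
      fix m s n t
      assume pq: "((m, s), (n, t)) \<in> double_pairs L"
        and c: "collinear {0, vel (similar \<mu> v L) (m, s), vel (similar \<mu> v L) (n, t)}"
      have "(m, s) \<in> params L" "(n, t) \<in> params L" using pq by (simp_all add: double_pairs_def)
      then have "collinear {0, vel L (m, s), vel L (n, t)}" using c col by (simp add: pt)
      then show False using L pq unfolding singular_link_def by blast
    qed
  qed
  then show ?thesis using dp by blast
qed

text \<open>The interpolation from the identity to a similarity consists of similarities, with the
  factor \<open>(1 - t) + t * \<mu>\<close>, which stays positive.\<close>

lemma isotopic_similar:
  assumes L: "singular_link L" and \<mu>: "\<mu> > 0"
  shows "isotopic_via id L (similar \<mu> v L)"
proof (rule isotopic_via_lerp)
  show "\<forall>\<gamma>\<in>set L. closed_curve \<gamma>" using L by (simp add: singular_link_def)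
  show "\<forall>\<gamma>\<in>set (similar \<mu> v L). closed_curve \<gamma>"
    using singular_similar[OF L, of \<mu> v] \<mu> by (simp add: singular_link_def)
  fix t :: real assume t: "t \<in> {0..1}"
  have "(1 - t) + t * \<mu> \<noteq> 0"
  proof (cases "t = 0")
    case False
    then have "t * \<mu> > 0" using t \<mu> by simp
    then show ?thesis using t by auto
  qed simp
  moreover have "lerp t L (similar \<mu> v L) = similar ((1 - t) + t * \<mu>) (t *\<^sub>R v) L"
    by (rule nth_equalityI)
      (simp_all add: nth_lerp nth_similar scaleR_left_distrib scaleR_right_distrib fun_eq_iff)
  ultimately show "singular_link (lerp t L (similar \<mu> v L)) \<and>
      double_pairs (lerp t L (similar \<mu> v L)) = double_pairs L"
    using singular_similar[OF L] by simp
qed simp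

section \<open>Replacing a straight strand\<close>

definition line :: curve where "line \<tau> = vec3 \<tau> 0 0"

lemma C1_line: "C1 line (\<lambda>_. vec3 1 0 0)"
  unfolding line_def by (rule C1_vec3) (auto intro!: derivative_eq_intros continuous_intros)

text \<open>Values and derivatives agree with those of \<open>line\<close> from parameter 5 on in
  both directions, so the arc can replace a straight piece without a kink. The bound on the first
  two coordinates confines the projection to the square of radius 5, over which nothing but the
  strand lies; heights are left free for passing over and under.\<close>

definition arc :: "curve \<Rightarrow> curve \<Rightarrow> bool" where
  "arc G G' \<longleftrightarrow> C1 G G' \<and> (\<forall>\<tau>. \<bar>\<tau>\<bar> \<ge> 5 \<longrightarrow> G \<tau> = line \<tau> \<and> G' \<tau> = vec3 1 0 0) \<and>
     (\<forall>\<tau>. \<bar>\<tau>\<bar> \<le> 5 \<longrightarrow> \<bar>G \<tau> $ 1\<bar> \<le> 5 \<and> \<bar>G \<tau> $ 2\<bar> \<le> 5)"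

definition regular_arc :: "curve \<Rightarrow> curve \<Rightarrow> bool" where
  "regular_arc G G' \<longleftrightarrow> arc G G' \<and> (\<forall>\<tau>. \<bar>\<tau>\<bar> \<le> 5 \<longrightarrow> G' \<tau> \<noteq> 0) \<and> inj_on G {-5..5}"

lemma arc_line: "arc line (\<lambda>_. vec3 1 0 0)"
  using C1_line by (simp add: arc_def) (simp add: line_def)

lemma arc_lerp:
  assumes "arc G G'" "arc H H'" "t \<in> {0..1}"
  shows "arc (\<lambda>\<tau>. (1 - t) *\<^sub>R G \<tau> + t *\<^sub>R H \<tau>) (\<lambda>\<tau>. (1 - t) *\<^sub>R G' \<tau> + t *\<^sub>R H' \<tau>)"
  unfolding arc_def
proof (intro conjI allI impI)
  show "C1 (\<lambda>\<tau>. (1 - t) *\<^sub>R G \<tau> + t *\<^sub>R H \<tau>) (\<lambda>\<tau>. (1 - t) *\<^sub>R G' \<tau> + t *\<^sub>R H' \<tau>)"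
    using assms by (intro C1_lerp) (simp_all add: arc_def)
  show "(1 - t) *\<^sub>R G \<tau> + t *\<^sub>R H \<tau> = line \<tau>" "(1 - t) *\<^sub>R G' \<tau> + t *\<^sub>R H' \<tau> = vec3 1 0 0"
    if "\<bar>\<tau>\<bar> \<ge> 5" for \<tau>
    using assms that by (simp_all add: arc_def scaleR_left_distrib[symmetric])
  have conv: "\<bar>(1 - t) * p + t * q\<bar> \<le> 5" if "\<bar>p\<bar> \<le> 5" "\<bar>q\<bar> \<le> 5" for p q
  proof -
    have "(1 - t) *\<^sub>R p + t *\<^sub>R q \<in> {-5..5}"
      using that assms(3) by (intro convexD) (auto simp: abs_le_iff)
    then show ?thesis by auto
  qed
  show "\<bar>((1 - t) *\<^sub>R G \<tau> + t *\<^sub>R H \<tau>) $ 1\<bar> \<le> 5" "\<bar>((1 - t) *\<^sub>R G \<tau> + t *\<^sub>R H \<tau>) $ 2\<bar> \<le> 5"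
    if "\<bar>\<tau>\<bar> \<le> 5" for \<tau>
    using assms that conv by (simp_all add: arc_def)
qed

text \<open>Over the square of radius 5 the link consists of a straight strand of component \<open>i\<close>, and nothing
  is assumed elsewhere. The coordinate \<open>w\<close> along this strand, reduced modulo the period of the component,
  is the parameter of the arcs that replace the strand.\<close>

locale straight_strand =
  fixes L :: link and i :: nat and s0 V :: real
  assumes classical: "classical_link L" and i: "i < length L" and V: "V > 12"
    and straight: "\<And>s. \<bar>V * (s - s0)\<bar> < 6 \<Longrightarrow> (L ! i) s = line (V * (s - s0))"
    and box: "\<And>m s. m < length L \<Longrightarrow> \<bar>(L ! m) s $ 1\<bar> \<le> 5 \<Longrightarrow> \<bar>(L ! m) s $ 2\<bar> \<le> 5 \<Longrightarrow>
      m = i \<and> \<bar>V * (s - of_int \<lfloor>s - s0 + 1 / 2\<rfloor> - s0)\<bar> \<le> 5"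
begin

text \<open>The parameter is recentred to the period around \<open>s0\<close> and scaled by the
  speed \<open>V\<close>. So \<open>w\<close> runs through [-V/2, V/2), and the bound on
  \<open>V\<close> makes this contain [-6, 6].\<close>

definition w :: "real \<Rightarrow> real" where "w s = V * (s - of_int \<lfloor>s - s0 + 1 / 2\<rfloor> - s0)"

lemma boxD:
  "m < length L \<Longrightarrow> \<bar>(L ! m) s $ 1\<bar> \<le> 5 \<Longrightarrow> \<bar>(L ! m) s $ 2\<bar> \<le> 5 \<Longrightarrow> m = i \<and> \<bar>w s\<bar> \<le> 5"
  unfolding w_def by (rule box)

lemma emb: "embedded L" and nonempty: "L \<noteq> []"
  and closed: "m < length L \<Longrightarrow> closed_curve (L ! m)"
  using classical by (simp_all add: classical_iff)

lemma w_Ints: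
  assumes "w s = w t" shows "s - t \<in> \<int>"
proof -
  have "s - of_int \<lfloor>s - s0 + 1 / 2\<rfloor> - s0 = t - of_int \<lfloor>t - s0 + 1 / 2\<rfloor> - s0"
    using assms V by (simp add: w_def)
  then have "s - t = of_int (\<lfloor>s - s0 + 1 / 2\<rfloor> - \<lfloor>t - s0 + 1 / 2\<rfloor>)" by simp
  then show ?thesis by (metis Ints_of_int)
qed

lemma w_periodic: "w (s + 1) = w s"
proof -
  have "(s + 1) - s0 + 1 / 2 = (s - s0 + 1 / 2) + 1" by argo
  then have "\<lfloor>(s + 1) - s0 + 1 / 2\<rfloor> = \<lfloor>(s - s0 + 1 / 2) + 1\<rfloor>" by (rule arg_cong)
  also have "\<dots> = \<lfloor>s - s0 + 1 / 2\<rfloor> + 1"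
    using floor_add_int[of "s - s0 + 1 / 2" 1] by (simp only: of_int_1)
  finally show ?thesis by (simp add: w_def)
qed

lemma w_eq:
  assumes "\<bar>\<tau>\<bar> \<le> 6" shows "w (s0 + \<tau> / V) = \<tau>"
proof -
  have "\<bar>\<tau> / V\<bar> < 1 / 2" using assms V by (simp add: abs_divide field_simps)
  then have "- (1 / 2) < \<tau> / V" "\<tau> / V < 1 / 2" by (simp_all only: abs_less_iff) linarith
  then have "\<lfloor>(s0 + \<tau> / V) - s0 + 1 / 2\<rfloor> = 0"
    by (intro floor_eq_iff[THEN iffD2]) (simp_all only: of_int_0, linarith)
  then show ?thesis using V by (simp add: w_def)
qed

text \<open>The parameter opposite to the strand: here \<open>w\<close> is below -6, so component
  \<open>i\<close> has a point that does not lie over the square.\<close>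

lemma w_far: "w (s0 + 1 / 2) = - V / 2"
proof -
  have "s0 + 1 / 2 - s0 + 1 / 2 = 1" by simp
  then show ?thesis by (simp add: w_def)
qed

text \<open>Straightness up to 6 rather than 5 gives an open neighbourhood of every parameter that
  the arcs may change, so that velocities agree there too, including the ends of the arcs.\<close>

lemma on_line:
  assumes "\<bar>w s\<bar> < 6"
  shows "(L ! i) s = line (w s)" "velocity (L ! i) s = V *\<^sub>R vec3 1 0 0"
proof -
  define t where "t = s - of_int \<lfloor>s - s0 + 1 / 2\<rfloor>"
  have t: "s - t \<in> \<int>" "w s = V * (t - s0)" by (simp_all add: t_def w_def)
  have tt: "\<bar>V * (t - s0)\<bar> < 6" using assms t by simp
  show "(L ! i) s = line (w s)"
    using closed_curve_Ints[OF closed[OF i] t(1)] straight[OF tt] t(2) by simp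
  have "((\<lambda>s. line (V * (s - s0))) has_vector_derivative V *\<^sub>R vec3 1 0 0) (at t)"
    using C1_D[OF C1_affine_param[OF C1_line]] .
  moreover have "open {t. \<bar>V * (t - s0)\<bar> < 6}"
    by (intro open_Collect_less continuous_intros)
  ultimately have "((L ! i) has_vector_derivative V *\<^sub>R vec3 1 0 0) (at t)"
    by (rule has_vector_derivative_transform_within_open) (use tt straight in auto)
  then have "velocity (L ! i) t = V *\<^sub>R vec3 1 0 0"
    unfolding velocity_def by (rule vector_derivative_at)
  then show "velocity (L ! i) s = V *\<^sub>R vec3 1 0 0"
    using velocity_Ints[OF closed[OF i] t(1)] by simp
qed

text \<open>The arc enters as a periodic perturbation of the old component. This makes grafting
  affine in \<open>G\<close>, so that interpolated arcs give interpolated links, and reduces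
  differentiability to \<open>C1_periodize\<close>.\<close>

definition gcurve :: "curve \<Rightarrow> curve" where
  "gcurve G s = (L ! i) s + (G (w s) - line (w s))"

definition graft :: "curve \<Rightarrow> link" where
  "graft G = L[i := gcurve G]"

lemma length_graft [simp]: "length (graft G) = length L"
  by (simp add: graft_def)

lemma nth_graft: "m < length L \<Longrightarrow> graft G ! m = (if m = i then gcurve G else L ! m)"
  by (simp add: graft_def)

lemma graft_line: "graft line = L"
  by (simp add: graft_def gcurve_def[abs_def])

lemma gcurve_eq:
  assumes "arc G G'"
  shows "gcurve G s = (if \<bar>w s\<bar> \<le> 5 then G (w s) else (L ! i) s)"
  using assms on_line(1)[of s] by (auto simp: gcurve_def arc_def)

lemma C1_gcurve:
  assumes G: "arc G G'"
  shows "C1 (gcurve G) (\<lambda>s. velocity (L ! i) s + V *\<^sub>R (G' (w s) - vec3 1 0 0))"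
proof -
  define f where "f s = G (V * (s - s0)) - line (V * (s - s0))" for s
  define f' where "f' s = V *\<^sub>R (G' (V * (s - s0)) - vec3 1 0 0)" for s
  have "C1 (\<lambda>\<tau>. 1 *\<^sub>R G \<tau> + (-1) *\<^sub>R line \<tau>) (\<lambda>\<tau>. 1 *\<^sub>R G' \<tau> + (-1) *\<^sub>R vec3 1 0 0)"
    using G by (intro C1_lerp C1_line) (simp add: arc_def)
  from C1_affine_param[OF this, of V s0] have f: "C1 f f'"
    by (simp add: f_def[abs_def] f'_def[abs_def])
  \<comment> \<open>The perturbation is supported within 5/V of \<open>s0\<close>, which is less
    than half a period.\<close>
  have "5 / V < 1 / 2" using V by (simp add: field_simps)
  moreover have "f s = 0 \<and> f' s = 0" if "\<bar>s - s0\<bar> \<ge> 5 / V" for s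
  proof -
    have "5 \<le> V * \<bar>s - s0\<bar>" using that V by (simp add: field_simps)
    also have "\<dots> = \<bar>V * (s - s0)\<bar>" using V by (simp add: abs_mult)
    finally have "\<bar>V * (s - s0)\<bar> \<ge> 5" .
    then show ?thesis using G by (simp add: f_def f'_def arc_def)
  qed
  ultimately have "C1 (\<lambda>s. f (s - of_int \<lfloor>s - s0 + 1 / 2\<rfloor>)) (\<lambda>s. f' (s - of_int \<lfloor>s - s0 + 1 / 2\<rfloor>))"
    by (intro C1_periodize[OF f]) auto
  from C1_lerp[OF closed_curve_C1[OF closed[OF i]] this, of 1 1]
  show ?thesis
    by (simp add: gcurve_def[abs_def] f_def f'_def w_def)
qed

lemma velocity_gcurve:
  assumes "arc G G'"
  shows "velocity (gcurve G) s = (if \<bar>w s\<bar> \<le> 5 then V *\<^sub>R G' (w s) else velocity (L ! i) s)"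
  using assms on_line(2)[of s]
  by (auto simp: C1_velocity[OF C1_gcurve[OF assms]] arc_def algebra_simps)

lemma gcurve_box:
  assumes "arc G G'" and b: "\<bar>gcurve G s $ 1\<bar> \<le> 5" "\<bar>gcurve G s $ 2\<bar> \<le> 5"
  shows "\<bar>w s\<bar> \<le> 5"
  using boxD[OF i, of s] b gcurve_eq[OF assms(1), of s] by (auto split: if_splits)

text \<open>The arc stays over the square, where the old link has only the strand that is being
  replaced. Hence the arc could only meet itself, and this is excluded by injectivity of
  \<open>G\<close>.\<close>

lemma classical_graft:
  assumes G: "regular_arc G G'"
  shows "classical_link (graft G)"
proof -
  have a: "arc G G'" using G by (simp add: regular_arc_def)
  have cc: "closed_curve (gcurve G)"
  proof (rule closed_curveI[OF _ C1_gcurve[OF a]])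
    show "gcurve G (s + 1) = gcurve G s" for s
      using closed[OF i] by (simp add: gcurve_def w_periodic closed_curve_def)
    show "velocity (L ! i) s + V *\<^sub>R (G' (w s) - vec3 1 0 0) \<noteq> 0" for s
      using velocity_gcurve[OF a, of s] G V closed[OF i]
      by (auto simp: C1_velocity[OF C1_gcurve[OF a]] regular_arc_def closed_curve_iff split: if_splits)
  qed
  have on: "gcurve G s \<noteq> (L ! m) t" if "\<bar>w s\<bar> \<le> 5" "m < length L" "m \<noteq> i \<or> \<bar>w t\<bar> > 5" for s t m
  proof
    assume e: "gcurve G s = (L ! m) t"
    have "gcurve G s = G (w s)" using gcurve_eq[OF a] that by simp
    then have "\<bar>gcurve G s $ 1\<bar> \<le> 5" "\<bar>gcurve G s $ 2\<bar> \<le> 5" using a that by (auto simp: arc_def)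
    then show False using boxD[OF that(2), of t] that e by auto
  qed
  have i_other: "gcurve G s \<noteq> (L ! m) t" if "m < length L" "m \<noteq> i" for s t m
    using on[of s m t] embeddedD[OF emb i that(1), of s t] that gcurve_eq[OF a, of s] by auto
  have i_i: "s - t \<in> \<int>" if e: "gcurve G s = gcurve G t" for s t
  proof -
    consider "\<bar>w s\<bar> \<le> 5" "\<bar>w t\<bar> \<le> 5" | "\<bar>w s\<bar> \<le> 5" "\<bar>w t\<bar> > 5" | "\<bar>w s\<bar> > 5" "\<bar>w t\<bar> \<le> 5"
      | "\<bar>w s\<bar> > 5" "\<bar>w t\<bar> > 5" by linarith
    then show ?thesis
    proof cases
      case 1
      then have "G (w s) = G (w t)" "w s \<in> {-5..5}" "w t \<in> {-5..5}"
        using gcurve_eq[OF a] e by auto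
      then have "w s = w t" using G by (auto simp: regular_arc_def inj_on_def)
      then show ?thesis by (rule w_Ints)
    next
      case 2 then show ?thesis using on[OF 2(1) i, of t] e gcurve_eq[OF a, of t] by auto
    next
      case 3 then show ?thesis using on[OF 3(2) i, of s] e gcurve_eq[OF a, of s] by auto
    next
      case 4 then show ?thesis
        using e gcurve_eq[OF a, of s] gcurve_eq[OF a, of t] embeddedD[OF emb i i] by auto
    qed
  qed
  have "embedded (graft G)"
    unfolding embedded_def
  proof (intro allI impI)
    fix m n s t
    assume h: "m < length (graft G)" "n < length (graft G)" "(graft G ! m) s = (graft G ! n) t"
    show "m = n \<and> s - t \<in> \<int>"
      using h i_i[of s t] i_other[of n s t] i_other[of m t s] embeddedD[OF emb, of m n s t]
      by (auto simp: nth_graft split: if_splits)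
  qed
  moreover have "\<forall>\<gamma>\<in>set (graft G). closed_curve \<gamma>"
    using classical cc set_update_subset_insert[of L i "gcurve G"]
    by (auto simp: graft_def classical_iff)
  moreover have "graft G \<noteq> []" using nonempty by (simp add: graft_def)
  ultimately show ?thesis by (simp add: classical_iff)
qed

lemma lerp_graft:
  "lerp t (graft G) (graft H) = graft (\<lambda>\<tau>. (1 - t) *\<^sub>R G \<tau> + t *\<^sub>R H \<tau>)"
proof (rule nth_equalityI)
  fix m assume "m < length (lerp t (graft G) (graft H))"
  then have m: "m < length L" by simp
  have e: "(1 - t) *\<^sub>R v + t *\<^sub>R v = v" for v :: "real^3"
    by (simp add: scaleR_left_distrib[symmetric])
  have "(1 - t) *\<^sub>R gcurve G s + t *\<^sub>R gcurve H s =
      gcurve (\<lambda>\<tau>. (1 - t) *\<^sub>R G \<tau> + t *\<^sub>R H \<tau>) s" for s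
    by (simp add: gcurve_def algebra_simps)
  then show "lerp t (graft G) (graft H) ! m = graft (\<lambda>\<tau>. (1 - t) *\<^sub>R G \<tau> + t *\<^sub>R H \<tau>) ! m"
    using m by (auto simp: nth_lerp nth_graft e)
qed simp

lemma isotopic_grafts:
  assumes "arc G G'" "arc H H'"
    and "\<And>t \<tau>. t \<in> {0..1} \<Longrightarrow> \<bar>\<tau>\<bar> \<le> 5 \<Longrightarrow> (1 - t) *\<^sub>R G' \<tau> + t *\<^sub>R H' \<tau> \<noteq> 0"
    and "\<And>t. t \<in> {0..1} \<Longrightarrow> inj_on (\<lambda>\<tau>. (1 - t) *\<^sub>R G \<tau> + t *\<^sub>R H \<tau>) {-5..5}"
  shows "isotopic_via id (graft G) (graft H)"
proof -
  have *: "classical_link (graft (\<lambda>\<tau>. (1 - t) *\<^sub>R G \<tau> + t *\<^sub>R H \<tau>))" if "t \<in> {0..1}" for t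
    using assms that arc_lerp[OF assms(1,2) that] by (intro classical_graft) (auto simp: regular_arc_def)
  show ?thesis
    using *[of 0] *[of 1] *
    by (intro isotopic_via_lerp_classical) (simp_all add: lerp_graft)
qed

text \<open>The functional x + c z increases along \<open>G\<close> and along the line, hence along
  every mixture of the two, which is then injective. Its derivative along \<open>G\<close> is only
  assumed nonnegative, because it vanishes at joints of the detour: for t > 0 the line contributes a
  positive amount, and at t = 0 regularity of \<open>G\<close> takes over.\<close>

lemma isotopic_graft_line:
  assumes G: "regular_arc G G'"
    and mono: "\<And>\<sigma> \<tau>. -5 \<le> \<sigma> \<Longrightarrow> \<sigma> < \<tau> \<Longrightarrow> \<tau> \<le> 5 \<Longrightarrow>
      G \<sigma> $ 1 + c * G \<sigma> $ 3 < G \<tau> $ 1 + c * G \<tau> $ 3"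
    and mono': "\<And>\<tau>. \<bar>\<tau>\<bar> \<le> 5 \<Longrightarrow> G' \<tau> $ 1 + c * G' \<tau> $ 3 \<ge> 0"
  shows "isotopic_via id (graft G) L"
proof -
  have a: "arc G G'" using G by (simp add: regular_arc_def)
  have "isotopic_via id (graft G) (graft line)"
  proof (rule isotopic_grafts[OF a arc_line])
    fix t \<tau> :: real assume t: "t \<in> {0..1}" and \<tau>: "\<bar>\<tau>\<bar> \<le> 5"
    let ?v = "(1 - t) *\<^sub>R G' \<tau> + t *\<^sub>R vec3 1 0 0"
    show "?v \<noteq> 0"
    proof (cases "t = 0")
      case True then show ?thesis using G \<tau> by (simp add: regular_arc_def)
    next
      case False
      have "?v $ 1 + c * ?v $ 3 = (1 - t) * (G' \<tau> $ 1 + c * G' \<tau> $ 3) + t"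
        by (simp add: algebra_simps)
      moreover have "(1 - t) * (G' \<tau> $ 1 + c * G' \<tau> $ 3) \<ge> 0" using mono'[OF \<tau>] t by simp
      ultimately have *: "?v $ 1 + c * ?v $ 3 > 0" using False t by simp
      have "u $ 1 + c * u $ 3 = 0" if "u = 0" for u :: "real^3" using that by simp
      then show ?thesis using * by (metis less_irrefl)
    qed
  next
    fix t :: real assume t: "t \<in> {0..1}"
    let ?H = "\<lambda>\<tau>. (1 - t) *\<^sub>R G \<tau> + t *\<^sub>R line \<tau>"
    have "?H \<sigma> \<noteq> ?H \<tau>" if "-5 \<le> \<sigma>" "\<sigma> < \<tau>" "\<tau> \<le> 5" for \<sigma> \<tau>
    proof -
      have e: "?H \<tau> $ 1 + c * ?H \<tau> $ 3 = (1 - t) * (G \<tau> $ 1 + c * G \<tau> $ 3) + t * \<tau>" for \<tau>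
        by (simp add: line_def algebra_simps)
      have "(1 - t) * (G \<sigma> $ 1 + c * G \<sigma> $ 3) + t * \<sigma> < (1 - t) * (G \<tau> $ 1 + c * G \<tau> $ 3) + t * \<tau>"
      proof (cases "t = 0")
        case True then show ?thesis using mono[OF that] by simp
      next
        case False
        then have "t * \<sigma> < t * \<tau>" using t that by simp
        moreover have "(1 - t) * (G \<sigma> $ 1 + c * G \<sigma> $ 3) \<le> (1 - t) * (G \<tau> $ 1 + c * G \<tau> $ 3)"
          using mono[OF that] t by (intro mult_left_mono) auto
        ultimately show ?thesis by linarith
      qed
      then show ?thesis using e by (metis less_irrefl)
    qed
    then show "inj_on ?H {-5..5}"
      by (intro inj_onI) (metis atLeastAtMost_iff linorder_neqE_linordered_idom)
  qed
  then show ?thesis by (simp add: graft_line)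
qed

end

section \<open>Splitting an arc into a line and a loop\<close>

lemma UN_set_nth: "(\<Union>\<gamma>\<in>set L. f \<gamma>) = (\<Union>m<length L. f (L ! m))"
  by (auto simp: set_conv_nth)

lemma oriented_point_outsideI:
  "plane_proj (\<gamma> s) \<notin> D \<Longrightarrow> (\<gamma> s, sgn (velocity \<gamma> s)) \<in> oriented_points_outside D \<gamma>"
  by (auto simp: oriented_points_outside_def)

lemma sgn_scaleR_pos: "(c :: real) > 0 \<Longrightarrow> sgn (c *\<^sub>R v) = sgn (v :: 'a :: real_normed_vector)"
  by (simp add: sgn_scaleR)

definition square :: "(real \<times> real) set" where "square = {-5..5} \<times> {-5..5}"

lemma plane_proj_square: "plane_proj v \<in> square \<longleftrightarrow> \<bar>v $ 1\<bar> \<le> 5 \<and> \<bar>v $ 2\<bar> \<le> 5"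
  by (auto simp: plane_proj_def square_def abs_le_iff)

text \<open>Outside \<open>D\<close> the arc \<open>G\<close> consists of the line and of the loop \<open>C\<close>; so the link with \<open>G\<close> grafted
  and the link with \<open>C\<close> added have the same diagram outside \<open>D\<close>, whichever of the two is the
  smoothing of the other.\<close>

definition splits_into_loop :: "(real \<times> real) set \<Rightarrow> curve \<Rightarrow> curve \<Rightarrow> curve \<Rightarrow> curve \<Rightarrow> bool" where
  "splits_into_loop D G G' C C' \<longleftrightarrow>
     arc G G' \<and> D \<subseteq> square \<and> (\<forall>s. plane_proj (C s) \<in> square) \<and>
     (\<forall>\<tau>. \<bar>\<tau>\<bar> \<le> 5 \<longrightarrow> plane_proj (G \<tau>) \<notin> D \<longrightarrow>
        G \<tau> = line \<tau> \<and> G' \<tau> = vec3 1 0 0 \<or> (\<exists>s. C s = G \<tau> \<and> sgn (C' s) = sgn (G' \<tau>))) \<and>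
     (\<forall>s. plane_proj (C s) \<notin> D \<longrightarrow> (\<exists>\<tau>. \<bar>\<tau>\<bar> \<le> 5 \<and> C s = G \<tau> \<and> sgn (C' s) = sgn (G' \<tau>))) \<and>
     (\<forall>\<tau>. \<bar>\<tau>\<bar> \<le> 5 \<longrightarrow> plane_proj (line \<tau>) \<notin> D \<longrightarrow> G \<tau> = line \<tau> \<and> G' \<tau> = vec3 1 0 0) \<and>
     (\<exists>s. plane_proj (C s) \<notin> D) \<and>
     (\<forall>s \<tau>. plane_proj (C s) \<notin> D \<longrightarrow> C s \<noteq> line \<tau>)"

section \<open>Partitions into singletons, their merges and the induced partitions\<close>

lemma singletons_Suc: "insert {k} (singletons k) = singletons (Suc k)"
  by (auto simp: singletons_def lessThan_Suc)

lemma partition_singletons: "partition_on {..<k} (singletons k)"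
  by (auto simp: partition_on_def singletons_def disjoint_def)

lemma merge_refl_singletons: "i < k \<Longrightarrow> merge i i (singletons k) = singletons k"
proof -
  assume i: "i < k"
  have "{B \<in> singletons k. i \<in> B \<or> i \<in> B} = {{i}}"
    using i by (auto simp: singletons_def)
  moreover have "{B \<in> singletons k. i \<notin> B \<and> i \<notin> B} \<union> {{i}} = singletons k"
    using i by (auto simp: singletons_def)
  ultimately show ?thesis by (simp add: merge_def)
qed

lemma merge_singletons_Suc:
  assumes "i < k"
  shows "merge i k (singletons (Suc k)) = insert {i, k} ((\<lambda>j. {j}) ` ({..<k} - {i}))"
proof -
  have "{B \<in> singletons (Suc k). i \<in> B \<or> k \<in> B} = {{i}, {k}}"
    using assms by (auto simp: singletons_def)
  moreover have "{B \<in> singletons (Suc k). i \<notin> B \<and> k \<notin> B} = (\<lambda>j. {j}) ` ({..<k} - {i})"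
    using assms by (auto simp: singletons_def less_Suc_eq)
  ultimately show ?thesis by (auto simp: merge_def)
qed

context straight_strand
begin

lemma near_axis_square: "near_axis square L"
  unfolding near_axis_def plane_proj_square
proof (intro allI impI)
  fix m s assume "m < length L" "\<bar>(L ! m) s $ 1\<bar> \<le> 5 \<and> \<bar>(L ! m) s $ 2\<bar> \<le> 5"
  then have "m = i" "\<bar>w s\<bar> \<le> 5" using boxD by blast+
  then show "(L ! m) s $ 2 = 0 \<and> (L ! m) s $ 3 = 0"
    using on_line(1)[of s] by (simp add: line_def)
qed

text \<open>Arc, strand and circle run at different speeds, so tangents are compared after
  normalization; the factor \<open>V\<close> of the arc is positive and disappears under
  \<open>sgn\<close>.\<close>

lemma outer_points_curves:
  assumes sp: "splits_into_loop D G G' C C'" and C: "C1 C C'"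
  shows "oriented_points_outside D (gcurve G) =
    oriented_points_outside D (L ! i) \<union> oriented_points_outside D C"
proof -
  have a: "arc G G'" using sp by (simp add: splits_into_loop_def)
  have vC: "velocity C = C'" by (rule C1_velocity[OF C])
  note gv = gcurve_eq[OF a] velocity_gcurve[OF a]
  have V0: "V > 0" using V by simp
  show ?thesis
  proof (intro subset_antisym subsetI)
    fix x assume "x \<in> oriented_points_outside D (gcurve G)"
    then obtain s where x: "x = (gcurve G s, sgn (velocity (gcurve G) s))"
      and s: "plane_proj (gcurve G s) \<notin> D"
      by (auto simp: oriented_points_outside_def)
    show "x \<in> oriented_points_outside D (L ! i) \<union> oriented_points_outside D C"
    proof (cases "\<bar>w s\<bar> \<le> 5")
      case False
      then have "x = ((L ! i) s, sgn (velocity (L ! i) s))" "plane_proj ((L ! i) s) \<notin> D"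
        using x s by (simp_all add: gv)
      then show ?thesis using oriented_point_outsideI[of "L ! i" s D] by simp
    next
      case True
      then have x': "x = (G (w s), sgn (G' (w s)))" and D: "plane_proj (G (w s)) \<notin> D"
        using x s V0 by (simp_all add: gv sgn_scaleR_pos)
      have "G (w s) = line (w s) \<and> G' (w s) = vec3 1 0 0 \<or>
          (\<exists>t. C t = G (w s) \<and> sgn (C' t) = sgn (G' (w s)))"
        using sp True D unfolding splits_into_loop_def by blast
      then show ?thesis
      proof (elim disjE conjE exE)
        assume "G (w s) = line (w s)" "G' (w s) = vec3 1 0 0"
        then have "x = ((L ! i) s, sgn (velocity (L ! i) s))" "plane_proj ((L ! i) s) \<notin> D"
          using x' D V0 on_line[of s] True by (simp_all add: sgn_scaleR_pos)
        then show ?thesis using oriented_point_outsideI[of "L ! i" s D] by simp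
      next
        fix t assume "C t = G (w s)" "sgn (C' t) = sgn (G' (w s))"
        then have "x = (C t, sgn (velocity C t))" "plane_proj (C t) \<notin> D"
          using x' D vC by simp_all
        then show ?thesis using oriented_point_outsideI[of C t D] by simp
      qed
    qed
  next
    fix x assume "x \<in> oriented_points_outside D (L ! i) \<union> oriented_points_outside D C"
    then show "x \<in> oriented_points_outside D (gcurve G)"
    proof
      assume "x \<in> oriented_points_outside D (L ! i)"
      then obtain s where x: "x = ((L ! i) s, sgn (velocity (L ! i) s))"
        and s: "plane_proj ((L ! i) s) \<notin> D"
        by (auto simp: oriented_points_outside_def)
      have "gcurve G s = (L ! i) s \<and> sgn (velocity (gcurve G) s) = sgn (velocity (L ! i) s)"
      proof (cases "\<bar>w s\<bar> \<le> 5")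
        case True
        then have "plane_proj (line (w s)) \<notin> D" using s on_line[of s] by simp
        then have "G (w s) = line (w s) \<and> G' (w s) = vec3 1 0 0"
          using sp True unfolding splits_into_loop_def by blast
        then show ?thesis using True on_line[of s] by (simp add: gv)
      qed (simp add: gv)
      then show ?thesis using oriented_point_outsideI[of "gcurve G" s D] x s by simp
    next
      assume "x \<in> oriented_points_outside D C"
      then obtain t where x: "x = (C t, sgn (C' t))" and t: "plane_proj (C t) \<notin> D"
        by (auto simp: oriented_points_outside_def vC)
      obtain \<tau> where \<tau>: "\<bar>\<tau>\<bar> \<le> 5" "C t = G \<tau>" "sgn (C' t) = sgn (G' \<tau>)"
        using sp t unfolding splits_into_loop_def by blast
      have ww: "w (s0 + \<tau> / V) = \<tau>" using w_eq \<tau> by simp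
      have "x = (gcurve G (s0 + \<tau> / V), sgn (velocity (gcurve G) (s0 + \<tau> / V)))"
        using x \<tau> ww V0 by (simp add: gv sgn_scaleR_pos)
      moreover have "plane_proj (gcurve G (s0 + \<tau> / V)) \<notin> D"
        using t \<tau> ww by (simp add: gv)
      ultimately show ?thesis
        using oriented_point_outsideI[of "gcurve G" "s0 + \<tau> / V" D] by simp
    qed
  qed
qed

lemma outer_points:
  assumes "splits_into_loop D G G' C C'" "C1 C C'"
  shows "(\<Union>\<gamma>\<in>set (graft G). oriented_points_outside D \<gamma>) =
    (\<Union>\<gamma>\<in>set (L @ [C]). oriented_points_outside D \<gamma>)"
proof -
  let ?O = "oriented_points_outside D"
  have "(\<Union>\<gamma>\<in>set (graft G). ?O \<gamma>) = (\<Union>m<length L. ?O (graft G ! m))"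
    by (simp add: UN_set_nth)
  also have "\<dots> = ?O (gcurve G) \<union> (\<Union>m\<in>{..<length L} - {i}. ?O (L ! m))"
    using i by (auto simp: nth_graft split: if_splits)
  also have "\<dots> = (\<Union>m<length L. ?O (L ! m)) \<union> ?O C"
    unfolding outer_points_curves[OF assms] using i by auto
  also have "\<dots> = (\<Union>\<gamma>\<in>set (L @ [C]). ?O \<gamma>)"
    by (auto simp: UN_set_nth[of ?O L, symmetric])
  finally show ?thesis .
qed

text \<open>Outside \<open>D\<close> the grafted component \<open>i\<close> carries the points of
  the old component and of the circle, every other component is unchanged, and different components
  share no point. This incidence relation determines the induced partition in both
  directions.\<close>

lemma overlap_iff:
  assumes sp: "splits_into_loop D G G' C C'" and C: "C1 C C'" and m: "m < length L" and n: "n < Suc (length L)"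
  shows "oriented_points_outside D (graft G ! m) \<inter> oriented_points_outside D ((L @ [C]) ! n) \<noteq> {} \<longleftrightarrow>
    n = m \<or> m = i \<and> n = length L"
proof -
  let ?O = "oriented_points_outside D"
  have D: "D \<subseteq> square" and CS: "\<And>s. plane_proj (C s) \<in> square"
    using sp unfolding splits_into_loop_def by blast+
  \<comment> \<open>The equivalence needs nonempty sets: component \<open>i\<close> has the point
    opposite to the strand, and the other components never come over the square.\<close>
  have far: "?O (L ! m) \<noteq> {}" if "m < length L" for m
  proof -
    have "\<exists>s. plane_proj ((L ! m) s) \<notin> D"
    proof (cases "m = i")
      case True
      have "\<not> \<bar>w (s0 + 1 / 2)\<bar> \<le> 5" using V by (simp add: w_far)
      then show ?thesis using boxD[OF that, of "s0 + 1 / 2"] D plane_proj_square by blast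
    next
      case False
      then show ?thesis using boxD[OF that, of 0] D plane_proj_square by blast
    qed
    then show ?thesis using oriented_point_outsideI by blast
  qed
  have LL: "?O (L ! m) \<inter> ?O (L ! n) = {}" if "m < length L" "n < length L" "m \<noteq> n" for m n
    using embeddedD[OF emb that(1,2)] that(3) by (auto simp: oriented_points_outside_def)
  have LC: "?O (L ! m) \<inter> ?O C = {}" if "m < length L" for m
  proof -
    have "(L ! m) s \<noteq> C t" if C: "plane_proj (C t) \<notin> D" for s t
    proof
      assume e: "(L ! m) s = C t"
      then have "plane_proj ((L ! m) s) \<in> square" using CS by simp
      then have "m = i" "\<bar>w s\<bar> \<le> 5" using boxD[OF \<open>m < length L\<close>] plane_proj_square by blast+
      then have "C t = line (w s)" using e on_line(1)[of s] by simp
      then show False using sp C unfolding splits_into_loop_def by blast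
    qed
    then show ?thesis by (auto simp: oriented_points_outside_def)
  qed
  have Cne: "?O C \<noteq> {}"
    using sp oriented_point_outsideI unfolding splits_into_loop_def by blast
  have Gi: "?O (graft G ! i) = ?O (L ! i) \<union> ?O C"
    using outer_points_curves[OF sp C] i by (simp add: nth_graft)
  show ?thesis
  proof (cases "m = i")
    case True
    then show ?thesis
      using Gi LL[of i n] LC[of n] LC[of i] far[of i] Cne i n
      by (cases "n < length L"; cases "n = i") (auto simp: nth_append less_Suc_eq)
  next
    case False
    then show ?thesis
      using LL[of m n] LC[of m] far[of m] m n
      by (cases "n < length L"; cases "n = m") (auto simp: nth_append nth_graft less_Suc_eq)
  qed
qed

text \<open>The joint block of strand and circle shrinks to the number of the strand, since both
  overlap the single grafted component; the other blocks are kept.\<close>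

lemma induced_partition_loop_to_arc:
  assumes "splits_into_loop D G G' C C'" "C1 C C'"
  shows "induced_partition D (L @ [C]) (graft G) (merge i (length L) (singletons (Suc (length L)))) =
    singletons (length L)"
proof -
  let ?k = "length L"
  define f where "f B = {m. m < length (graft G) \<and> (\<exists>j\<in>B. oriented_points_outside D (graft G ! m) \<inter>
    oriented_points_outside D ((L @ [C]) ! j) \<noteq> {})}" for B
  have fB: "f B = {m. m < ?k \<and> (\<exists>j\<in>B. j = m \<or> m = i \<and> j = ?k)}" if "B \<subseteq> {..<Suc ?k}" for B
    unfolding f_def length_graft using that overlap_iff[OF assms] by (blast)
  have "f {i, ?k} = {i}" using i by (subst fB) auto
  moreover have "f {j} = {j}" if "j \<in> {..<?k} - {i}" for j using that by (subst fB) auto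
  then have "f ` (\<lambda>j. {j}) ` ({..<?k} - {i}) = (\<lambda>j. {j}) ` ({..<?k} - {i})"
    by (simp add: image_image)
  ultimately have "f ` insert {i, ?k} ((\<lambda>j. {j}) ` ({..<?k} - {i})) = singletons ?k"
    using i by (auto simp: singletons_def)
  then show ?thesis
    unfolding induced_partition_def merge_singletons_Suc[OF i] f_def .
qed

text \<open>Conversely, the block of the strand spreads to the circle that splits off. This is how
  an unlinked circle enters the block of the strand.\<close>

lemma induced_partition_arc_to_loop:
  assumes "splits_into_loop D G G' C C'" "C1 C C'"
  shows "induced_partition D (graft G) (L @ [C]) (merge i i (singletons (length L))) =
    merge i (length L) (singletons (Suc (length L)))"
proof -
  let ?k = "length L"
  define f where "f B = {m. m < length (L @ [C]) \<and> (\<exists>j\<in>B. oriented_points_outside D ((L @ [C]) ! m) \<inter>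
    oriented_points_outside D (graft G ! j) \<noteq> {})}" for B
  have fj: "f {j} = {m. m < Suc ?k \<and> (m = j \<or> j = i \<and> m = ?k)}" if "j < ?k" for j
    unfolding f_def using overlap_iff[OF assms that] by (auto simp: Int_commute)
  have "f {i} = {i, ?k}" using i by (subst fj) auto
  moreover have "f {j} = {j}" if "j \<in> {..<?k} - {i}" for j using that by (subst fj) auto
  then have "f ` (\<lambda>j. {j}) ` ({..<?k} - {i}) = (\<lambda>j. {j}) ` ({..<?k} - {i})"
    by (simp add: image_image)
  moreover have "singletons ?k = insert {i} ((\<lambda>j. {j}) ` ({..<?k} - {i}))"
    using i by (auto simp: singletons_def)
  ultimately have "f ` singletons ?k = insert {i, ?k} ((\<lambda>j. {j}) ` ({..<?k} - {i}))"
    by simp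
  then show ?thesis
    unfolding induced_partition_def merge_singletons_Suc[OF i] merge_refl_singletons[OF i] f_def .
qed

end

section \<open>The detour and the curl\<close>

lemma circle_point:
  assumes "(c :: real)\<^sup>2 + d\<^sup>2 = 1"
  obtains s where "cos (2 * pi * s) = c" "sin (2 * pi * s) = d"
proof -
  obtain \<theta> where "c = cos \<theta>" "d = sin \<theta>"
    using sincos_total_2pi[OF assms] by metis
  then show thesis using that[of "\<theta> / (2 * pi)"] by simp
qed

lemma one_plus_square [simp]: "1 + (x :: real)\<^sup>2 \<noteq> 0" "(x :: real)\<^sup>2 + 1 \<noteq> 0" "0 < 1 + x\<^sup>2"
  using zero_le_power2[of x] by linarith+

text \<open>The half-angle parametrization: half circles become pieces over intervals of length 2,
  which join polynomial pieces at integer parameters, and their derivatives stay rational.\<close>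

lemma rational_circle: "((1 - t\<^sup>2) / (1 + t\<^sup>2))\<^sup>2 + (2 * t / (1 + t\<^sup>2))\<^sup>2 = (1 :: real)"
proof -
  have "((1 - t\<^sup>2) / (1 + t\<^sup>2))\<^sup>2 + (2 * t / (1 + t\<^sup>2))\<^sup>2 = ((1 - t\<^sup>2)\<^sup>2 + (2 * t)\<^sup>2) / (1 + t\<^sup>2)\<^sup>2"
    by (simp add: power_divide add_divide_distrib)
  also have "(1 - t\<^sup>2)\<^sup>2 + (2 * t)\<^sup>2 = (1 + t\<^sup>2)\<^sup>2" by algebra
  finally show ?thesis by simp
qed

lemma rational_circle_inv:
  assumes "(c :: real)\<^sup>2 + d\<^sup>2 = 1" "c \<ge> 0"
  obtains t where "\<bar>t\<bar> \<le> 1" "c = (1 - t\<^sup>2) / (1 + t\<^sup>2)" "d = 2 * t / (1 + t\<^sup>2)"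
proof
  \<comment> \<open>The tangent of half the angle of the point (c, d).\<close>
  define t where "t = d / (1 + c)"
  have c: "1 + c \<noteq> 0" using assms by simp
  have d2: "d\<^sup>2 = (1 - c) * (1 + c)" using assms by algebra
  have t2: "t\<^sup>2 = (1 - c) / (1 + c)"
  proof -
    have "t\<^sup>2 = d\<^sup>2 / (1 + c)\<^sup>2" by (simp add: t_def power_divide)
    also have "\<dots> = (1 - c) * (1 + c) / ((1 + c) * (1 + c))" unfolding d2 by (simp add: power2_eq_square)
    also have "\<dots> = (1 - c) / (1 + c)" using c by simp
    finally show ?thesis .
  qed
  have p: "1 + t\<^sup>2 = 2 / (1 + c)" "1 - t\<^sup>2 = 2 * c / (1 + c)"
    unfolding t2 using c by (simp_all add: field_simps)
  show "c = (1 - t\<^sup>2) / (1 + t\<^sup>2)" "d = 2 * t / (1 + t\<^sup>2)"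
    unfolding p using c by (simp_all add: t_def field_simps)
  have "t\<^sup>2 \<le> 1" unfolding t2 using assms by (simp add: field_simps)
  then show "\<bar>t\<bar> \<le> 1" by (simp add: abs_square_le_1)
qed

lemma rational_circle_bounds:
  assumes "c = (1 - t\<^sup>2) / (1 + t\<^sup>2)" "d = 2 * t / (1 + (t :: real)\<^sup>2)"
  shows "\<bar>c\<bar> \<le> 1" "\<bar>d\<bar> \<le> 1" "\<bar>t\<bar> \<le> 1 \<Longrightarrow> c \<ge> 0"
proof -
  have 1: "c\<^sup>2 + d\<^sup>2 = 1" using rational_circle assms by simp
  have "c\<^sup>2 \<le> 1" "d\<^sup>2 \<le> 1" using 1 zero_le_power2[of c] zero_le_power2[of d] by linarith+
  then show "\<bar>c\<bar> \<le> 1" "\<bar>d\<bar> \<le> 1" by (simp_all add: abs_square_le_1)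
  show "c \<ge> 0" if "\<bar>t\<bar> \<le> 1" using that assms by (simp add: abs_square_le_1)
qed

lemma DERIV_rational_circle:
  "((\<lambda>t. (1 - t\<^sup>2) / (1 + t\<^sup>2)) has_real_derivative - (2 / (1 + t\<^sup>2)) * (2 * t / (1 + t\<^sup>2))) (at t)"
  "((\<lambda>t. 2 * t / (1 + t\<^sup>2)) has_real_derivative (2 / (1 + t\<^sup>2)) * ((1 - t\<^sup>2) / (1 + t\<^sup>2))) (at t)"
proof -
  have "((\<lambda>t. (1 - t\<^sup>2) / (1 + t\<^sup>2)) has_real_derivative
      ((- (2 * t)) * (1 + t\<^sup>2) - (1 - t\<^sup>2) * (2 * t)) / ((1 + t\<^sup>2) * (1 + t\<^sup>2))) (at t)"
    by (auto intro!: derivative_eq_intros)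
  moreover have "(- (2 * t)) * (1 + t\<^sup>2) - (1 - t\<^sup>2) * (2 * t) = - (2 * (2 * t))" by algebra
  ultimately show "((\<lambda>t. (1 - t\<^sup>2) / (1 + t\<^sup>2)) has_real_derivative
      - (2 / (1 + t\<^sup>2)) * (2 * t / (1 + t\<^sup>2))) (at t)" by simp
  have "((\<lambda>t. 2 * t / (1 + t\<^sup>2)) has_real_derivative
      (2 * (1 + t\<^sup>2) - (2 * t) * (2 * t)) / ((1 + t\<^sup>2) * (1 + t\<^sup>2))) (at t)"
    by (auto intro!: derivative_eq_intros)
  moreover have "2 * (1 + t\<^sup>2) - (2 * t) * (2 * t) = 2 * (1 - t\<^sup>2)" by algebra
  ultimately show "((\<lambda>t. 2 * t / (1 + t\<^sup>2)) has_real_derivative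
      (2 / (1 + t\<^sup>2)) * ((1 - t\<^sup>2) / (1 + t\<^sup>2))) (at t)" by simp
qed

section \<open>The tilted circle and the detour along it\<close>

lemma strict_mono_on_join:
  fixes f :: "real \<Rightarrow> real"
  assumes "strict_mono_on {a..b} f" "strict_mono_on {b..c} f"
  shows "strict_mono_on {a..c} f"
proof (rule strict_mono_onI)
  fix r s assume *: "r \<in> {a..c}" "s \<in> {a..c}" "r < s"
  consider "s \<le> b" | "b \<le> r" | "r < b" "b < s" by linarith
  then show "f r < f s"
  proof cases
    case 1 then show ?thesis using * by (intro strict_mono_onD[OF assms(1)]) auto
  next
    case 2 then show ?thesis using * by (intro strict_mono_onD[OF assms(2)]) auto
  next
    case 3
    have "f r < f b" using 3 * by (intro strict_mono_onD[OF assms(1)]) auto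
    also have "f b < f s" using 3 * by (intro strict_mono_onD[OF assms(2)]) auto
    finally show ?thesis .
  qed
qed

text \<open>The section of the unit cylinder by the plane z = x + y/2 - 1, which meets the first
  axis only in (1, 0, 0). Over the other crossing (-1, 0) the height is -2, below the strand. On the
  circle x - z = 1 - y/2, which increases from (0, 1) by way of (-1, 0) to (0, -1); the slope in the
  direction of y serves this purpose.\<close>

definition tilted_circle :: curve where
  "tilted_circle s = vec3 (cos (2 * pi * s)) (sin (2 * pi * s)) (sin (2 * pi * s) / 2 + cos (2 * pi * s) - 1)"

definition tilted_circle' :: curve where
  "tilted_circle' s = (2 * pi) *\<^sub>R vec3 (- sin (2 * pi * s)) (cos (2 * pi * s)) (cos (2 * pi * s) / 2 - sin (2 * pi * s))"

lemma vec3_scaleR: "c *\<^sub>R vec3 x y z = vec3 (c * x) (c * y) (c * z)"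
  by (simp add: vec3_eq_iff)

lemma C1_tilted_circle: "C1 tilted_circle tilted_circle'"
  unfolding tilted_circle_def[abs_def] tilted_circle'_def[abs_def] vec3_scaleR
  by (rule C1_vec3) (auto intro!: derivative_eq_intros continuous_intros simp: algebra_simps)

text \<open>The straight strand, with a detour once along the circle. The heights make
  \<open>x - z\<close> increase along the whole arc, so that the arc can be pulled straight.\<close>

definition detour_in :: curve where
  "detour_in \<tau> = vec3 (\<tau> - \<tau>\<^sup>2) (3 * \<tau>\<^sup>2 - 2 * \<tau> ^ 3) (- \<tau>\<^sup>2 / 2)"

definition detour_in' :: curve where
  "detour_in' \<tau> = vec3 (1 - 2 * \<tau>) (6 * \<tau> - 6 * \<tau>\<^sup>2) (- \<tau>)"

text \<open>The left half of the tilted circle, from (0, 1) to (0, -1), in the half-angle parameter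
  \<tau> - 2.\<close>

definition detour_loop :: curve where
  "detour_loop \<tau> = vec3 (- ((1 - (\<tau> - 2)\<^sup>2) / (1 + (\<tau> - 2)\<^sup>2))) (- (2 * (\<tau> - 2) / (1 + (\<tau> - 2)\<^sup>2)))
     (- (2 * (\<tau> - 2) / (1 + (\<tau> - 2)\<^sup>2)) / 2 - (1 - (\<tau> - 2)\<^sup>2) / (1 + (\<tau> - 2)\<^sup>2) - 1)"

definition detour_loop' :: curve where
  "detour_loop' \<tau> = (2 / (1 + (\<tau> - 2)\<^sup>2)) *\<^sub>R vec3 (2 * (\<tau> - 2) / (1 + (\<tau> - 2)\<^sup>2))
     (- ((1 - (\<tau> - 2)\<^sup>2) / (1 + (\<tau> - 2)\<^sup>2)))
     (- ((1 - (\<tau> - 2)\<^sup>2) / (1 + (\<tau> - 2)\<^sup>2)) / 2 + 2 * (\<tau> - 2) / (1 + (\<tau> - 2)\<^sup>2))"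

text \<open>With t = \<tau> - 3 and E = 3t^2 - 2t^3 the projection is (t + 3E, E - 1). As in
  \<open>detour_in\<close>, the polynomials interpolate values and slopes at both ends: here from
  the circle over (0, -1), with tangent (1, 0, 1), to the axis at 4.\<close>

definition detour_out :: curve where
  "detour_out \<tau> = vec3 ((\<tau> - 3) + 9 * (\<tau> - 3)\<^sup>2 - 6 * (\<tau> - 3) ^ 3) (3 * (\<tau> - 3)\<^sup>2 - 2 * (\<tau> - 3) ^ 3 - 1)
     (- 3 / 2 + (\<tau> - 3) + 5 / 2 * (\<tau> - 3)\<^sup>2 - 2 * (\<tau> - 3) ^ 3)"

definition detour_out' :: curve where
  "detour_out' \<tau> = vec3 (1 + 18 * (\<tau> - 3) - 18 * (\<tau> - 3)\<^sup>2) (6 * (\<tau> - 3) - 6 * (\<tau> - 3)\<^sup>2)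
     (1 + 5 * (\<tau> - 3) - 6 * (\<tau> - 3)\<^sup>2)"

definition detour :: curve where
  "detour \<tau> = (if \<tau> \<le> 0 then line \<tau> else if \<tau> \<le> 1 then detour_in \<tau> else if \<tau> \<le> 3 then detour_loop \<tau>
     else if \<tau> \<le> 4 then detour_out \<tau> else line \<tau>)"

definition detour' :: curve where
  "detour' \<tau> = (if \<tau> \<le> 0 then vec3 1 0 0 else if \<tau> \<le> 1 then detour_in' \<tau> else if \<tau> \<le> 3 then detour_loop' \<tau>
     else if \<tau> \<le> 4 then detour_out' \<tau> else vec3 1 0 0)"

lemma C1_detour: "C1 detour detour'"
proof -
  have in': "C1 detour_in detour_in'"
    unfolding detour_in_def[abs_def] detour_in'_def[abs_def]
    by (rule C1_vec3) (auto intro!: derivative_eq_intros continuous_intros simp: power2_eq_square)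
  have out': "C1 detour_out detour_out'"
    unfolding detour_out_def[abs_def] detour_out'_def[abs_def]
    by (rule C1_vec3) (auto intro!: derivative_eq_intros continuous_intros simp: power2_eq_square field_simps)
  have sh: "((\<lambda>\<tau>. f (\<tau> - 2)) has_real_derivative f' (\<tau> - 2)) (at \<tau>)"
    if "\<And>t. (f has_real_derivative f' t) (at t)" for f f' :: "real \<Rightarrow> real" and \<tau>
    using DERIV_shift[of f "f' (\<tau> - 2)" \<tau> "- 2"] that by simp
  have nz: "2 + (x - 2)\<^sup>2 * 2 \<noteq> 0" for x :: real
    using zero_le_power2[of "x - 2"] by linarith
  note d = sh[OF DERIV_rational_circle(1)] sh[OF DERIV_rational_circle(2)]
  have loop': "C1 detour_loop detour_loop'"
    unfolding detour_loop_def[abs_def] detour_loop'_def[abs_def] vec3_scaleR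
  proof (rule C1_vec3)
    fix \<tau> :: real
    show "((\<lambda>\<tau>. - ((1 - (\<tau> - 2)\<^sup>2) / (1 + (\<tau> - 2)\<^sup>2))) has_real_derivative
        2 / (1 + (\<tau> - 2)\<^sup>2) * (2 * (\<tau> - 2) / (1 + (\<tau> - 2)\<^sup>2))) (at \<tau>)"
      by (rule derivative_eq_intros d)+ simp
    show "((\<lambda>\<tau>. - (2 * (\<tau> - 2) / (1 + (\<tau> - 2)\<^sup>2))) has_real_derivative
        2 / (1 + (\<tau> - 2)\<^sup>2) * - ((1 - (\<tau> - 2)\<^sup>2) / (1 + (\<tau> - 2)\<^sup>2))) (at \<tau>)"
      by (rule DERIV_cong[OF DERIV_minus[OF d(2)]]) simp
    show "((\<lambda>\<tau>. - (2 * (\<tau> - 2) / (1 + (\<tau> - 2)\<^sup>2)) / 2 - (1 - (\<tau> - 2)\<^sup>2) / (1 + (\<tau> - 2)\<^sup>2) - 1) has_real_derivative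
        2 / (1 + (\<tau> - 2)\<^sup>2) * (- ((1 - (\<tau> - 2)\<^sup>2) / (1 + (\<tau> - 2)\<^sup>2)) / 2 + 2 * (\<tau> - 2) / (1 + (\<tau> - 2)\<^sup>2))) (at \<tau>)"
      by (rule DERIV_cong[OF DERIV_diff[OF DERIV_diff[OF DERIV_cdivide[OF DERIV_minus[OF d(2)]] d(1)] DERIV_const]])
        (simp add: algebra_simps)
  qed (auto intro!: continuous_intros simp: nz)
  show ?thesis
    unfolding detour_def[abs_def] detour'_def[abs_def]
    by (intro C1_If C1_line in' out' loop')
      (simp_all add: line_def detour_in_def detour_in'_def detour_out_def detour_out'_def
        detour_loop_def detour_loop'_def vec3_eq_iff)
qed

text \<open>Closed intervals are possible because neighbouring pieces agree at the joints together
  with their derivatives; later case distinctions may thus include endpoints.\<close>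

lemma detour_eqs:
  "\<tau> \<le> 0 \<Longrightarrow> detour \<tau> = line \<tau> \<and> detour' \<tau> = vec3 1 0 0"
  "0 \<le> \<tau> \<Longrightarrow> \<tau> \<le> 1 \<Longrightarrow> detour \<tau> = detour_in \<tau> \<and> detour' \<tau> = detour_in' \<tau>"
  "1 \<le> \<tau> \<Longrightarrow> \<tau> \<le> 3 \<Longrightarrow> detour \<tau> = detour_loop \<tau> \<and> detour' \<tau> = detour_loop' \<tau>"
  "3 \<le> \<tau> \<Longrightarrow> \<tau> \<le> 4 \<Longrightarrow> detour \<tau> = detour_out \<tau> \<and> detour' \<tau> = detour_out' \<tau>"
  "4 \<le> \<tau> \<Longrightarrow> detour \<tau> = line \<tau> \<and> detour' \<tau> = vec3 1 0 0"
proof -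
  show "\<tau> \<le> 0 \<Longrightarrow> detour \<tau> = line \<tau> \<and> detour' \<tau> = vec3 1 0 0"
    by (simp add: detour_def detour'_def)
  show "detour \<tau> = detour_in \<tau> \<and> detour' \<tau> = detour_in' \<tau>" if "0 \<le> \<tau>" "\<tau> \<le> 1"
    using that by (cases "\<tau> = 0") (simp_all add: detour_def detour'_def line_def detour_in_def detour_in'_def)
  show "detour \<tau> = detour_loop \<tau> \<and> detour' \<tau> = detour_loop' \<tau>" if "1 \<le> \<tau>" "\<tau> \<le> 3"
    using that by (cases "\<tau> = 1")
      (simp_all add: detour_def detour'_def detour_loop_def detour_in_def detour_in'_def detour_loop'_def vec3_scaleR)
  show "detour \<tau> = detour_out \<tau> \<and> detour' \<tau> = detour_out' \<tau>" if "3 \<le> \<tau>" "\<tau> \<le> 4"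
    using that by (cases "\<tau> = 3")
      (simp_all add: detour_def detour'_def detour_loop_def detour_out_def detour_out'_def detour_loop'_def vec3_scaleR)
  show "detour \<tau> = line \<tau> \<and> detour' \<tau> = vec3 1 0 0" if "4 \<le> \<tau>"
    using that by (cases "\<tau> = 4") (simp_all add: detour_def detour'_def line_def detour_out_def detour_out'_def)
qed

lemma smoothstep_bounds:
  fixes t :: real assumes "0 \<le> t" "t \<le> 1"
  shows "0 \<le> 3 * t\<^sup>2 - 2 * t ^ 3" "3 * t\<^sup>2 - 2 * t ^ 3 \<le> 1"
    "t < 1 \<Longrightarrow> 3 * t\<^sup>2 - 2 * t ^ 3 < 1" "0 < t \<Longrightarrow> 0 < 3 * t\<^sup>2 - 2 * t ^ 3"
proof -
  have e: "3 * t\<^sup>2 - 2 * t ^ 3 = t\<^sup>2 * (3 - 2 * t)" "1 - (3 * t\<^sup>2 - 2 * t ^ 3) = (1 - t)\<^sup>2 * (1 + 2 * t)"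
    by algebra+
  show "0 \<le> 3 * t\<^sup>2 - 2 * t ^ 3" unfolding e(1) using assms by simp
  have "0 \<le> 1 - (3 * t\<^sup>2 - 2 * t ^ 3)" unfolding e(2) using assms by simp
  then show "3 * t\<^sup>2 - 2 * t ^ 3 \<le> 1" by simp
  show "3 * t\<^sup>2 - 2 * t ^ 3 < 1" if "t < 1"
  proof -
    have "0 < 1 - (3 * t\<^sup>2 - 2 * t ^ 3)" unfolding e(2) using assms that by simp
    then show ?thesis by simp
  qed
  show "0 < 3 * t\<^sup>2 - 2 * t ^ 3" if "0 < t" unfolding e(1) using assms that by simp
qed

lemma detour_cases:
  fixes \<tau> :: real
  assumes "\<bar>\<tau>\<bar> \<le> 5"
  obtains "-5 \<le> \<tau>" "\<tau> \<le> 0" | "0 \<le> \<tau>" "\<tau> \<le> 1" | "1 \<le> \<tau>" "\<tau> \<le> 3" | "3 \<le> \<tau>" "\<tau> \<le> 4" | "4 \<le> \<tau>" "\<tau> \<le> 5"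
  using assms by linarith

lemma detour_in_bounds:
  assumes "0 \<le> \<tau>" "\<tau> \<le> 1"
  shows "0 \<le> detour_in \<tau> $ 1" "detour_in \<tau> $ 1 \<le> 1" "0 \<le> detour_in \<tau> $ 2" "detour_in \<tau> $ 2 \<le> 1"
    "0 < \<tau> \<Longrightarrow> \<tau> < 1 \<Longrightarrow> 0 < detour_in \<tau> $ 1"
proof -
  have e: "detour_in \<tau> $ 1 = \<tau> * (1 - \<tau>)" by (simp add: detour_in_def) algebra
  show "0 \<le> detour_in \<tau> $ 1" unfolding e using assms by simp
  show "detour_in \<tau> $ 1 \<le> 1" unfolding e using assms by (intro mult_le_one) auto
  show "0 < detour_in \<tau> $ 1" if "0 < \<tau>" "\<tau> < 1" unfolding e using that by simp
  show "0 \<le> detour_in \<tau> $ 2" "detour_in \<tau> $ 2 \<le> 1"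
    using smoothstep_bounds[OF assms] by (simp_all add: detour_in_def)
qed

lemma detour_out_bounds:
  assumes "3 \<le> \<tau>" "\<tau> \<le> 4"
  shows "0 \<le> detour_out \<tau> $ 1" "detour_out \<tau> $ 1 \<le> 4" "-1 \<le> detour_out \<tau> $ 2" "detour_out \<tau> $ 2 \<le> 0"
    "3 < \<tau> \<Longrightarrow> 0 < detour_out \<tau> $ 1" "\<tau> < 4 \<Longrightarrow> detour_out \<tau> $ 1 < 4" "\<tau> < 4 \<Longrightarrow> detour_out \<tau> $ 2 < 0"
proof -
  define t where "t = \<tau> - 3"
  have t: "0 \<le> t" "t \<le> 1" using assms by (simp_all add: t_def)
  define E where "E = 3 * t\<^sup>2 - 2 * t ^ 3"
  have e: "detour_out \<tau> $ 1 = t + 3 * E" "detour_out \<tau> $ 2 = E - 1"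
    by (simp_all add: detour_out_def t_def E_def)
  note b = smoothstep_bounds[OF t, folded E_def]
  show "0 \<le> detour_out \<tau> $ 1" unfolding e using t b(1) by linarith
  show "detour_out \<tau> $ 1 \<le> 4" unfolding e using t b(2) by linarith
  show "-1 \<le> detour_out \<tau> $ 2" unfolding e using b(1) by linarith
  show "detour_out \<tau> $ 2 \<le> 0" unfolding e using b(2) by linarith
  show "0 < detour_out \<tau> $ 1" if "3 < \<tau>" unfolding e using b(1) that t_def by linarith
  show "detour_out \<tau> $ 1 < 4" if "\<tau> < 4" unfolding e using b(2) that t_def by linarith
  show "detour_out \<tau> $ 2 < 0" if "\<tau> < 4" unfolding e using b(3) that t_def by linarith
qed

lemma detour_loop_circle:
  obtains c d where "c\<^sup>2 + d\<^sup>2 = 1" "\<bar>c\<bar> \<le> 1" "\<bar>d\<bar> \<le> 1"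
    "detour_loop \<tau> = vec3 (- c) (- d) (- d / 2 - c - 1)"
    "detour_loop' \<tau> = (2 / (1 + (\<tau> - 2)\<^sup>2)) *\<^sub>R vec3 d (- c) (- c / 2 + d)"
proof -
  define c d where "c = (1 - (\<tau> - 2)\<^sup>2) / (1 + (\<tau> - 2)\<^sup>2)" and "d = 2 * (\<tau> - 2) / (1 + (\<tau> - 2)\<^sup>2)"
  show thesis
    by (rule that[of c d])
      (use rational_circle[of "\<tau> - 2"] rational_circle_bounds[OF c_def d_def]
        in \<open>simp_all add: c_def d_def detour_loop_def detour_loop'_def\<close>)
qed

text \<open>On the three curved pieces x - z is \<tau> - \<tau>^2/2, then 1 + p/(1 + p^2) with p =
  \<tau> - 2, then 3/2 + 13t^2/2 - 4t^3 with t = \<tau> - 3. The derivative vanishes at 1 and 3, so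
  differences of values are factored instead.\<close>

lemma detour_mono: "strict_mono_on {-5..5} (\<lambda>\<tau>. detour \<tau> $ 1 - detour \<tau> $ 3)"
proof -
  let ?f = "\<lambda>\<tau>. detour \<tau> $ 1 - detour \<tau> $ 3"
  have 1: "strict_mono_on {-5..0} ?f"
    by (rule strict_mono_onI) (simp add: detour_eqs line_def)
  have 2: "strict_mono_on {0..1} ?f"
  proof (rule strict_mono_onI)
    fix a b :: real assume ab: "a \<in> {0..1}" "b \<in> {0..1}" "a < b"
    have "?f b - ?f a = (b - a) * (1 - (a + b) / 2)"
      using ab by (simp add: detour_eqs detour_in_def) algebra
    moreover have "(b - a) * (1 - (a + b) / 2) > 0" using ab by (intro mult_pos_pos) auto
    ultimately show "?f a < ?f b" by linarith
  qed
  have 3: "strict_mono_on {1..3} ?f"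
  proof (rule strict_mono_onI)
    fix a b :: real assume ab: "a \<in> {1..3}" "b \<in> {1..3}" "a < b"
    define p q where "p = a - 2" and "q = b - 2"
    have pq: "\<bar>p\<bar> \<le> 1" "\<bar>q\<bar> \<le> 1" "p < q" using ab by (auto simp: p_def q_def)
    have "\<bar>p\<bar> * \<bar>q\<bar> \<le> 1" using pq by (intro mult_le_one) auto
    then have "p * q \<le> 1" by (metis abs_le_D1 abs_mult)
    moreover have "p * q \<noteq> 1"
    proof
      assume "p * q = 1"
      then have "\<bar>p\<bar> * \<bar>q\<bar> = 1" by (metis abs_mult abs_one)
      moreover have "\<bar>p\<bar> * \<bar>q\<bar> \<le> \<bar>p\<bar>" "\<bar>p\<bar> * \<bar>q\<bar> \<le> \<bar>q\<bar>"
        using pq by (auto intro: mult_left_le mult_left_le_one_le)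
      ultimately have "p = -1" "q = 1" using pq by linarith+
      then show False using \<open>p * q = 1\<close> by simp
    qed
    ultimately have pq1: "p * q < 1" by simp
    have f: "?f \<tau> = 1 + (2 * (\<tau> - 2) / (1 + (\<tau> - 2)\<^sup>2)) / 2" if "\<tau> \<in> {1..3}" for \<tau>
    proof -
      obtain h where h: "h = 2 * (\<tau> - 2) / (1 + (\<tau> - 2)\<^sup>2)" by simp
      have "detour \<tau> = detour_loop \<tau>" using that by (simp add: detour_eqs)
      then show ?thesis unfolding detour_loop_def h[symmetric] by simp
    qed
    have half: "(2 * x / y) / 2 = x / y" for x y :: real by simp
    have "?f b - ?f a = q / (1 + q\<^sup>2) - p / (1 + p\<^sup>2)"
      unfolding f[OF ab(1)] f[OF ab(2)] half p_def q_def by (rule add_diff_cancel_left)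
    also have "\<dots> = (q * (1 + p\<^sup>2) - p * (1 + q\<^sup>2)) / ((1 + q\<^sup>2) * (1 + p\<^sup>2))"
      by (simp add: diff_frac_eq)
    also have "q * (1 + p\<^sup>2) - p * (1 + q\<^sup>2) = (q - p) * (1 - p * q)" by algebra
    also have "(q - p) * (1 - p * q) / ((1 + q\<^sup>2) * (1 + p\<^sup>2)) > 0"
      using pq pq1 by (intro divide_pos_pos mult_pos_pos) auto
    finally show "?f a < ?f b" by simp
  qed
  have 4: "strict_mono_on {3..4} ?f"
  proof (rule strict_mono_onI)
    fix a b :: real assume ab: "a \<in> {3..4}" "b \<in> {3..4}" "a < b"
    define p q where "p = a - 3" and "q = b - 3"
    have pq: "0 \<le> p" "p < q" "q \<le> 1" using ab by (auto simp: p_def q_def)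
    have f: "?f \<tau> = 3 / 2 + 13 / 2 * (\<tau> - 3)\<^sup>2 - 4 * (\<tau> - 3) ^ 3" if "\<tau> \<in> {3..4}" for \<tau>
      using that by (simp add: detour_eqs detour_out_def)
    have "?f b - ?f a = (q - p) * (13 / 2 * (p + q) - 4 * (p\<^sup>2 + p * q + q\<^sup>2))"
      unfolding f[OF ab(1)] f[OF ab(2)] p_def[symmetric] q_def[symmetric] by algebra
    moreover have "13 / 2 * (p + q) - 4 * (p\<^sup>2 + p * q + q\<^sup>2) > 0"
    proof -
      have "p\<^sup>2 \<le> p" "q\<^sup>2 \<le> q" "p * q \<le> p"
        using pq by (auto simp: power2_eq_square intro: mult_left_le)
      moreover define E where "E = p\<^sup>2 + p * q + q\<^sup>2"
      \<comment> \<open>Then 13/2 (p + q) - 4E is at least (5q - 3p)/2, which is positive for 0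
        \<le> p < q.\<close>
      ultimately have "E \<le> 2 * p + q" by linarith
      then show ?thesis unfolding E_def[symmetric] using pq by argo
    qed
    ultimately have "?f b - ?f a > 0" using pq by simp
    then show "?f a < ?f b" by simp
  qed
  have 5: "strict_mono_on {4..5} ?f"
    by (rule strict_mono_onI) (simp add: detour_eqs line_def)
  show ?thesis
    by (rule strict_mono_on_join[OF strict_mono_on_join[OF strict_mono_on_join[OF
      strict_mono_on_join[OF 1 2] 3] 4] 5])
qed

lemma arc_detour: "arc detour detour'"
  unfolding arc_def
proof (intro conjI allI impI C1_detour)
  fix \<tau> :: real assume \<tau>: "\<bar>\<tau>\<bar> \<ge> 5"
  then have "\<tau> \<le> 0 \<or> 4 \<le> \<tau>" by linarith
  then show "detour \<tau> = line \<tau>" "detour' \<tau> = vec3 1 0 0" using detour_eqs by blast+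
next
  fix \<tau> :: real assume \<tau>: "\<bar>\<tau>\<bar> \<le> 5"
  have "\<bar>detour \<tau> $ 1\<bar> \<le> 5 \<and> \<bar>detour \<tau> $ 2\<bar> \<le> 5"
    using \<tau>
  proof (cases rule: detour_cases)
    case 1 then show ?thesis by (simp add: detour_eqs line_def)
  next
    case 2 then show ?thesis using detour_in_bounds[OF 2] by (simp add: detour_eqs)
  next
    case 3
    obtain c d where "\<bar>c\<bar> \<le> 1" "\<bar>d\<bar> \<le> 1" "detour_loop \<tau> = vec3 (- c) (- d) (- d / 2 - c - 1)"
      by (rule detour_loop_circle[of \<tau>])
    then show ?thesis using 3 by (simp add: detour_eqs)
  next
    case 4 then show ?thesis using detour_out_bounds[OF 4] by (simp add: detour_eqs)
  next
    case 5 then show ?thesis by (simp add: detour_eqs line_def)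
  qed
  then show "\<bar>detour \<tau> $ 1\<bar> \<le> 5" "\<bar>detour \<tau> $ 2\<bar> \<le> 5" by auto
qed

lemma regular_arc_detour: "regular_arc detour detour'"
  unfolding regular_arc_def
proof (intro conjI allI impI arc_detour)
  fix \<tau> :: real assume \<tau>: "\<bar>\<tau>\<bar> \<le> 5"
  have nz: "v \<noteq> 0" if "v $ 1 \<noteq> 0 \<or> v $ 2 \<noteq> 0 \<or> v $ 3 \<noteq> 0" for v :: "real^3" using that by auto
  show "detour' \<tau> \<noteq> 0"
    using \<tau>
  proof (cases rule: detour_cases)
    case 1 then show ?thesis by (intro nz) (simp add: detour_eqs)
  next
    case 2 then show ?thesis by (intro nz) (auto simp: detour_eqs detour_in'_def)
  next
    case 3
    obtain c d where cd: "c\<^sup>2 + d\<^sup>2 = 1"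
      "detour_loop' \<tau> = (2 / (1 + (\<tau> - 2)\<^sup>2)) *\<^sub>R vec3 d (- c) (- c / 2 + d)"
      by (rule detour_loop_circle[of \<tau>])
    then have "c \<noteq> 0 \<or> d \<noteq> 0" by auto
    then show ?thesis using 3 cd(2) by (intro nz) (auto simp: detour_eqs)
  next
    case 4
    define t where "t = \<tau> - 3"
    have "t\<^sup>2 \<le> t" using 4 by (auto simp: t_def power2_eq_square intro: mult_left_le)
    then have "1 + 18 * t - 18 * t\<^sup>2 > 0" by linarith
    then show ?thesis using 4 by (intro nz) (simp add: detour_eqs detour_out'_def t_def)
  next
    case 5 then show ?thesis by (intro nz) (simp add: detour_eqs)
  qed
next
  show "inj_on detour {-5..5}"
  proof (rule inj_onI)
    fix a b assume ab: "a \<in> {-5..5}" "b \<in> {-5..5::real}" "detour a = detour b"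
    have "\<not> a < b" "\<not> b < a"
      using strict_mono_onD[OF detour_mono, of a b] strict_mono_onD[OF detour_mono, of b a] ab by auto
    then show "a = b" by simp
  qed
qed

lemma (in straight_strand) isotopic_detour: "isotopic_via id (graft detour) L"
proof (rule isotopic_graft_line[OF regular_arc_detour, of "-1"])
  show "detour \<sigma> $ 1 + - 1 * detour \<sigma> $ 3 < detour \<tau> $ 1 + - 1 * detour \<tau> $ 3"
    if "-5 \<le> \<sigma>" "\<sigma> < \<tau>" "\<tau> \<le> 5" for \<sigma> \<tau>
    using strict_mono_onD[OF detour_mono, of \<sigma> \<tau>] that by simp
  fix \<tau> :: real assume \<tau>: "\<bar>\<tau>\<bar> \<le> 5"
  show "detour' \<tau> $ 1 + - 1 * detour' \<tau> $ 3 \<ge> 0"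
    using \<tau>
  proof (cases rule: detour_cases)
    case 1 then show ?thesis by (simp add: detour_eqs)
  next
    case 2 then show ?thesis by (simp add: detour_eqs detour_in'_def)
  next
    case 3
    then have "\<bar>\<tau> - 2\<bar> \<le> 1" by simp
    then have sq: "(\<tau> - 2)\<^sup>2 \<le> 1" by (simp add: abs_square_le_1)
    define c d k where "c = (1 - (\<tau> - 2)\<^sup>2) / (1 + (\<tau> - 2)\<^sup>2)"
      and "d = 2 * (\<tau> - 2) / (1 + (\<tau> - 2)\<^sup>2)" and "k = 2 / (1 + (\<tau> - 2)\<^sup>2)"
    have "detour_loop' \<tau> = k *\<^sub>R vec3 d (- c) (- c / 2 + d)"
      by (simp add: detour_loop'_def c_def d_def k_def)
    then have "detour' \<tau> $ 1 + - 1 * detour' \<tau> $ 3 = k * (c / 2)"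
      using 3 by (simp add: detour_eqs algebra_simps)
    moreover have "k * (c / 2) \<ge> 0" using sq by (simp add: c_def k_def)
    ultimately show ?thesis by simp
  next
    case 4
    define t where "t = \<tau> - 3"
    have "t\<^sup>2 \<le> t" "0 \<le> t" using 4 by (auto simp: t_def power2_eq_square intro: mult_left_le)
    then have "13 * t - 12 * t\<^sup>2 \<ge> 0" by linarith
    then show ?thesis using 4 by (simp add: detour_eqs detour_out'_def t_def)
  next
    case 5 then show ?thesis by (simp add: detour_eqs)
  qed
qed

text \<open>The disc of the singular crossing (1, 0). Its left edge cuts the circle in (0, 1) and
  (0, -1) and leaves the second crossing (-1, 0) outside; its right edge is where the detour is back
  on the axis.\<close>

definition right_box :: "(real \<times> real) set" where "right_box = {0..4} \<times> {-2..2}"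

lemma plane_proj_right_box:
  "plane_proj v \<in> right_box \<longleftrightarrow> 0 \<le> v $ 1 \<and> v $ 1 \<le> 4 \<and> -2 \<le> v $ 2 \<and> v $ 2 \<le> 2"
  by (auto simp: plane_proj_def right_box_def)

text \<open>Outside the box the detour is either the axis or the left half of the circle; the
  polynomial pieces lie over the box, where a smoothing may differ.\<close>

lemma detour_splits: "splits_into_loop right_box detour detour' tilted_circle tilted_circle'"
  unfolding splits_into_loop_def
proof (intro conjI allI impI)
  show "arc detour detour'" by (rule arc_detour)
  show "right_box \<subseteq> square" by (auto simp: right_box_def square_def)
  have b: "\<bar>cos x\<bar> \<le> 5" "\<bar>sin x\<bar> \<le> 5" for x :: real
    using abs_cos_le_one[of x] abs_sin_le_one[of x] by linarith+
  show "plane_proj (tilted_circle s) \<in> square" for s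
    by (simp add: plane_proj_square tilted_circle_def b)
  show "detour \<tau> = line \<tau> \<and> detour' \<tau> = vec3 1 0 0 \<or>
      (\<exists>s. tilted_circle s = detour \<tau> \<and> sgn (tilted_circle' s) = sgn (detour' \<tau>))"
    if \<tau>: "\<bar>\<tau>\<bar> \<le> 5" and D: "plane_proj (detour \<tau>) \<notin> right_box" for \<tau>
    using \<tau>
  proof (cases rule: detour_cases)
    case 2 then show ?thesis
      using D detour_in_bounds[OF 2] by (simp add: detour_eqs plane_proj_right_box)
  next
    case 3
    obtain c d where cd: "c\<^sup>2 + d\<^sup>2 = 1" "detour_loop \<tau> = vec3 (- c) (- d) (- d / 2 - c - 1)"
      "detour_loop' \<tau> = (2 / (1 + (\<tau> - 2)\<^sup>2)) *\<^sub>R vec3 d (- c) (- c / 2 + d)"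
      by (rule detour_loop_circle[of \<tau>])
    obtain s where "cos (2 * pi * s) = - c" "sin (2 * pi * s) = - d"
      by (rule circle_point[of "- c" "- d"]) (use cd in auto)
    then have "tilted_circle s = detour_loop \<tau>"
      "tilted_circle' s = (2 * pi) *\<^sub>R vec3 d (- c) (- c / 2 + d)"
      by (simp_all add: tilted_circle_def tilted_circle'_def cd)
    then show ?thesis using 3 cd(3) by (auto simp: detour_eqs sgn_scaleR_pos intro!: exI[of _ s])
  next
    case 4 then show ?thesis
      using D detour_out_bounds[OF 4] by (simp add: detour_eqs plane_proj_right_box)
  qed (simp_all add: detour_eqs)
  show "\<exists>\<tau>. \<bar>\<tau>\<bar> \<le> 5 \<and> tilted_circle s = detour \<tau> \<and> sgn (tilted_circle' s) = sgn (detour' \<tau>)"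
    if D: "plane_proj (tilted_circle s) \<notin> right_box" for s
  proof -
    define x where "x = 2 * pi * s"
    have bx: "\<bar>cos x\<bar> \<le> 1" "\<bar>sin x\<bar> \<le> 1" by (rule abs_cos_le_one, rule abs_sin_le_one)
    have "plane_proj (tilted_circle s) \<in> right_box" if "0 \<le> cos x"
      unfolding plane_proj_right_box tilted_circle_def x_def[symmetric] vector_3
      using bx that by (intro conjI; linarith)
    then have "cos x < 0" using D by force
    then obtain t where t: "\<bar>t\<bar> \<le> 1" "- cos x = (1 - t\<^sup>2) / (1 + t\<^sup>2)" "- sin x = 2 * t / (1 + t\<^sup>2)"
      using rational_circle_inv[of "- cos x" "- sin x"] by auto
    have \<tau>: "1 \<le> t + 2" "t + 2 \<le> 3" using t(1) by auto
    have "tilted_circle s = detour_loop (t + 2)"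
      by (simp add: tilted_circle_def detour_loop_def x_def[symmetric] t(2,3)[symmetric])
    moreover have "detour_loop' (t + 2) = (2 / (1 + t\<^sup>2)) *\<^sub>R vec3 (- sin x) (cos x) (cos x / 2 - sin x)"
      by (simp add: detour_loop'_def t(2,3)[symmetric])
    then have "sgn (tilted_circle' s) = sgn (detour_loop' (t + 2))"
      by (simp add: tilted_circle'_def x_def[symmetric] sgn_scaleR_pos)
    ultimately show ?thesis using detour_eqs(3)[OF \<tau>] \<tau> by (intro exI[of _ "t + 2"]) simp
  qed
  show "detour \<tau> = line \<tau>" "detour' \<tau> = vec3 1 0 0"
    if "\<bar>\<tau>\<bar> \<le> 5" "plane_proj (line \<tau>) \<notin> right_box" for \<tau>
  proof -
    have "\<tau> \<le> 0 \<or> 4 \<le> \<tau>" using that by (auto simp: plane_proj_right_box line_def)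
    then show "detour \<tau> = line \<tau>" "detour' \<tau> = vec3 1 0 0" using detour_eqs by blast+
  qed
  show "\<exists>s. plane_proj (tilted_circle s) \<notin> right_box"
    by (rule exI[of _ "1 / 2"]) (simp add: plane_proj_right_box tilted_circle_def)
  show "tilted_circle s \<noteq> line \<tau>" if "plane_proj (tilted_circle s) \<notin> right_box" for s \<tau>
  proof
    assume "tilted_circle s = line \<tau>"
    then have "sin (2 * pi * s) = 0" "sin (2 * pi * s) / 2 + cos (2 * pi * s) - 1 = 0"
      by (simp_all add: tilted_circle_def line_def vec3_eq_iff)
    then show False using that by (simp add: plane_proj_right_box tilted_circle_def)
  qed
qed

section \<open>The curl and its removal\<close>

text \<open>The strand runs once around the circle of radius 1 about \<open>(0, 2)\<close> and thereby crosses itself.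
  The first coordinate is odd, and the second one is even and decreasing on the positive side; hence
  a double point of the projection lies on the second axis.\<close>

definition curl_end :: "real \<Rightarrow> curve" where
  "curl_end \<sigma> \<tau> = vec3 (- 1 + 7 * (\<tau> - 1)\<^sup>2 / 8 - (\<tau> - 1) ^ 3 / 8) ((5 - \<tau>)\<^sup>2 / 8) (\<sigma> * ((\<tau> - 1) * (5 - \<tau>))\<^sup>2)"

definition curl_end' :: "real \<Rightarrow> curve" where
  "curl_end' \<sigma> \<tau> = vec3 (7 * (\<tau> - 1) / 4 - 3 * (\<tau> - 1)\<^sup>2 / 8) (- (5 - \<tau>) / 4)
     (\<sigma> * (2 * ((\<tau> - 1) * (5 - \<tau>)) * (6 - 2 * \<tau>)))"

definition curl_start :: curve where
  "curl_start \<tau> = vec3 (1 - 7 * (- \<tau> - 1)\<^sup>2 / 8 + (- \<tau> - 1) ^ 3 / 8) ((5 + \<tau>)\<^sup>2 / 8) 0"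

definition curl_start' :: curve where
  "curl_start' \<tau> = vec3 (7 * (- \<tau> - 1) / 4 - 3 * (- \<tau> - 1)\<^sup>2 / 8) ((5 + \<tau>) / 4) 0"

text \<open>The upper half of the circle, counterclockwise from (1, 2) to (-1, 2), in the half-angle
  parameter.\<close>

definition curl_loop :: curve where
  "curl_loop \<tau> = vec3 (- (2 * \<tau> / (1 + \<tau>\<^sup>2))) (2 + (1 - \<tau>\<^sup>2) / (1 + \<tau>\<^sup>2)) 0"

definition curl_loop' :: curve where
  "curl_loop' \<tau> = (2 / (1 + \<tau>\<^sup>2)) *\<^sub>R vec3 (- ((1 - \<tau>\<^sup>2) / (1 + \<tau>\<^sup>2))) (- (2 * \<tau> / (1 + \<tau>\<^sup>2))) 0"

text \<open>The outer pieces interpolate values and slopes between the axis at -5 and 5 and the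
  vertical tangents of the circle at (1, 2) and (-1, 2). Only the last one leaves height 0, by a
  bump that vanishes to second order at its ends; the sign \<sigma> decides which passage through
  the node is the upper one.\<close>

definition curl :: "real \<Rightarrow> curve" where
  "curl \<sigma> \<tau> = (if \<tau> \<le> - 5 then line \<tau> else if \<tau> \<le> - 1 then curl_start \<tau> else if \<tau> \<le> 1 then curl_loop \<tau>
     else if \<tau> \<le> 5 then curl_end \<sigma> \<tau> else line \<tau>)"

definition curl' :: "real \<Rightarrow> curve" where
  "curl' \<sigma> \<tau> = (if \<tau> \<le> - 5 then vec3 1 0 0 else if \<tau> \<le> - 1 then curl_start' \<tau> else if \<tau> \<le> 1 then curl_loop' \<tau>
     else if \<tau> \<le> 5 then curl_end' \<sigma> \<tau> else vec3 1 0 0)"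

lemma C1_curl: "C1 (curl \<sigma>) (curl' \<sigma>)"
proof -
  have start': "C1 curl_start curl_start'"
    unfolding curl_start_def[abs_def] curl_start'_def[abs_def]
    by (rule C1_vec3) (auto intro!: derivative_eq_intros continuous_intros simp: power2_eq_square field_simps)
  have d2: "((\<lambda>\<tau>. \<sigma> * ((\<tau> - 1) * (5 - \<tau>))\<^sup>2) has_real_derivative
      \<sigma> * (2 * ((\<tau> - 1) * (5 - \<tau>)) * (6 - 2 * \<tau>))) (at \<tau>)" for \<tau> :: real
    by (auto intro!: derivative_eq_intros)
  have end': "C1 (curl_end \<sigma>) (curl_end' \<sigma>)"
    unfolding curl_end_def[abs_def] curl_end'_def[abs_def]
    by (rule C1_vec3[OF _ _ d2])
      (auto intro!: derivative_eq_intros continuous_intros simp: power2_eq_square field_simps)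
  note d = DERIV_rational_circle
  have loop': "C1 curl_loop curl_loop'"
    unfolding curl_loop_def[abs_def] curl_loop'_def[abs_def] vec3_scaleR
  proof (rule C1_vec3)
    fix \<tau> :: real
    show "((\<lambda>\<tau>. - (2 * \<tau> / (1 + \<tau>\<^sup>2))) has_real_derivative
        2 / (1 + \<tau>\<^sup>2) * - ((1 - \<tau>\<^sup>2) / (1 + \<tau>\<^sup>2))) (at \<tau>)"
      by (rule DERIV_cong[OF DERIV_minus[OF d(2)]]) simp
    show "((\<lambda>\<tau>. 2 + (1 - \<tau>\<^sup>2) / (1 + \<tau>\<^sup>2)) has_real_derivative
        2 / (1 + \<tau>\<^sup>2) * - (2 * \<tau> / (1 + \<tau>\<^sup>2))) (at \<tau>)"
      by (rule DERIV_cong[OF DERIV_add[OF DERIV_const d(1)]]) simp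
    show "((\<lambda>\<tau>. 0) has_real_derivative 2 / (1 + \<tau>\<^sup>2) * 0) (at \<tau>)" by simp
  qed (auto intro!: continuous_intros)
  show ?thesis
    unfolding curl_def[abs_def] curl'_def[abs_def]
    by (intro C1_If C1_line start' end' loop')
      (simp_all add: line_def curl_start_def curl_start'_def curl_end_def curl_end'_def
        curl_loop_def curl_loop'_def vec3_eq_iff)
qed

lemma curl_eqs:
  "\<tau> \<le> -5 \<Longrightarrow> curl \<sigma> \<tau> = line \<tau> \<and> curl' \<sigma> \<tau> = vec3 1 0 0"
  "-5 \<le> \<tau> \<Longrightarrow> \<tau> \<le> -1 \<Longrightarrow> curl \<sigma> \<tau> = curl_start \<tau> \<and> curl' \<sigma> \<tau> = curl_start' \<tau>"
  "-1 \<le> \<tau> \<Longrightarrow> \<tau> \<le> 1 \<Longrightarrow> curl \<sigma> \<tau> = curl_loop \<tau> \<and> curl' \<sigma> \<tau> = curl_loop' \<tau>"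
  "1 \<le> \<tau> \<Longrightarrow> \<tau> \<le> 5 \<Longrightarrow> curl \<sigma> \<tau> = curl_end \<sigma> \<tau> \<and> curl' \<sigma> \<tau> = curl_end' \<sigma> \<tau>"
  "5 \<le> \<tau> \<Longrightarrow> curl \<sigma> \<tau> = line \<tau> \<and> curl' \<sigma> \<tau> = vec3 1 0 0"
proof -
  show "\<tau> \<le> -5 \<Longrightarrow> curl \<sigma> \<tau> = line \<tau> \<and> curl' \<sigma> \<tau> = vec3 1 0 0"
    by (simp add: curl_def curl'_def)
  show "curl \<sigma> \<tau> = curl_start \<tau> \<and> curl' \<sigma> \<tau> = curl_start' \<tau>" if "-5 \<le> \<tau>" "\<tau> \<le> -1"
    using that by (cases "\<tau> = -5") (simp_all add: curl_def curl'_def line_def curl_start_def curl_start'_def)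
  show "curl \<sigma> \<tau> = curl_loop \<tau> \<and> curl' \<sigma> \<tau> = curl_loop' \<tau>" if "-1 \<le> \<tau>" "\<tau> \<le> 1"
    using that by (cases "\<tau> = -1")
      (simp_all add: curl_def curl'_def curl_loop_def curl_start_def curl_start'_def curl_loop'_def vec3_scaleR)
  show "curl \<sigma> \<tau> = curl_end \<sigma> \<tau> \<and> curl' \<sigma> \<tau> = curl_end' \<sigma> \<tau>" if "1 \<le> \<tau>" "\<tau> \<le> 5"
    using that by (cases "\<tau> = 1")
      (simp_all add: curl_def curl'_def curl_loop_def curl_end_def curl_end'_def curl_loop'_def vec3_scaleR)
  show "curl \<sigma> \<tau> = line \<tau> \<and> curl' \<sigma> \<tau> = vec3 1 0 0" if "5 \<le> \<tau>"
    using that by (cases "\<tau> = 5") (simp_all add: curl_def curl'_def line_def curl_end_def curl_end'_def)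
qed

lemma curl_cases:
  fixes \<tau> :: real
  assumes "\<bar>\<tau>\<bar> \<le> 5"
  obtains "-5 \<le> \<tau>" "\<tau> \<le> -1" | "-1 \<le> \<tau>" "\<tau> \<le> 1" | "1 \<le> \<tau>" "\<tau> \<le> 5"
  using assms by linarith

lemma curl_end_bounds:
  assumes "1 \<le> \<tau>" "\<tau> \<le> 5"
  shows "-1 \<le> curl_end \<sigma> \<tau> $ 1" "curl_end \<sigma> \<tau> $ 1 \<le> 5" "\<tau> < 5 \<Longrightarrow> curl_end \<sigma> \<tau> $ 1 < 5"
    "0 \<le> curl_end \<sigma> \<tau> $ 2" "curl_end \<sigma> \<tau> $ 2 \<le> 2" "\<tau> < 5 \<Longrightarrow> 0 < curl_end \<sigma> \<tau> $ 2"
    "1 < \<tau> \<Longrightarrow> curl_end \<sigma> \<tau> $ 2 < 2" "1 < \<tau> \<Longrightarrow> curl_end' \<sigma> \<tau> $ 1 > 0"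
    "\<tau> < 5 \<Longrightarrow> curl_end' \<sigma> \<tau> $ 2 < 0"
proof -
  define t where "t = \<tau> - 1"
  have t: "0 \<le> t" "t \<le> 4" using assms by (simp_all add: t_def)
  have e: "curl_end \<sigma> \<tau> $ 1 + 1 = t\<^sup>2 * (7 - t) / 8" "5 - curl_end \<sigma> \<tau> $ 1 = (4 - t) * (12 + 3 * t - t\<^sup>2) / 8"
    "curl_end \<sigma> \<tau> $ 2 = (4 - t)\<^sup>2 / 8" "2 - curl_end \<sigma> \<tau> $ 2 = t * (8 - t) / 8"
    "curl_end' \<sigma> \<tau> $ 1 = t * (14 - 3 * t) / 8" "curl_end' \<sigma> \<tau> $ 2 = - (4 - t) / 4"
    by (simp_all add: curl_end_def curl_end'_def t_def power2_eq_square power3_eq_cube field_simps)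
  have q: "12 + 3 * t - t\<^sup>2 > 0"
  proof -
    have "t\<^sup>2 \<le> 4 * t" using t unfolding power2_eq_square by (intro mult_right_mono)
    then show ?thesis using t by linarith
  qed
  have "curl_end \<sigma> \<tau> $ 1 + 1 \<ge> 0" unfolding e using t by simp
  then show "-1 \<le> curl_end \<sigma> \<tau> $ 1" by simp
  have "5 - curl_end \<sigma> \<tau> $ 1 \<ge> 0" unfolding e using t q by simp
  then show "curl_end \<sigma> \<tau> $ 1 \<le> 5" by simp
  show "curl_end \<sigma> \<tau> $ 1 < 5" if "\<tau> < 5"
  proof -
    have "5 - curl_end \<sigma> \<tau> $ 1 > 0" unfolding e using that q by (simp add: t_def)
    then show ?thesis by simp
  qed
  show "0 \<le> curl_end \<sigma> \<tau> $ 2" unfolding e by simp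
  have "t * (8 - t) / 8 \<ge> 0" using t by simp
  then have "2 - curl_end \<sigma> \<tau> $ 2 \<ge> 0" by (simp only: e(4))
  then show "curl_end \<sigma> \<tau> $ 2 \<le> 2" by simp
  show "0 < curl_end \<sigma> \<tau> $ 2" if "\<tau> < 5" unfolding e using that by (simp add: t_def)
  show "curl_end \<sigma> \<tau> $ 2 < 2" if "1 < \<tau>"
  proof -
    have "t * (8 - t) / 8 > 0" using t that by (simp add: t_def)
    then have "2 - curl_end \<sigma> \<tau> $ 2 > 0" by (simp only: e(4))
    then show ?thesis by simp
  qed
  show "curl_end' \<sigma> \<tau> $ 1 > 0" if "1 < \<tau>" unfolding e using t that by (simp add: t_def)
  show "curl_end' \<sigma> \<tau> $ 2 < 0" if "\<tau> < 5" unfolding e using that by (simp add: t_def)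
qed

lemma curl_symmetric:
  assumes "\<bar>\<tau>\<bar> \<le> 5"
  shows "curl \<sigma> (- \<tau>) $ 1 = - curl \<sigma> \<tau> $ 1" "curl \<sigma> (- \<tau>) $ 2 = curl \<sigma> \<tau> $ 2"
    "curl' \<sigma> (- \<tau>) $ 1 = curl' \<sigma> \<tau> $ 1" "curl' \<sigma> (- \<tau>) $ 2 = - curl' \<sigma> \<tau> $ 2"
proof -
  have "curl \<sigma> (- \<tau>) $ 1 = - curl \<sigma> \<tau> $ 1 \<and> curl \<sigma> (- \<tau>) $ 2 = curl \<sigma> \<tau> $ 2 \<and>
    curl' \<sigma> (- \<tau>) $ 1 = curl' \<sigma> \<tau> $ 1 \<and> curl' \<sigma> (- \<tau>) $ 2 = - curl' \<sigma> \<tau> $ 2"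
    using assms
  proof (cases rule: curl_cases)
    case 1 then show ?thesis
      by (simp add: curl_eqs curl_start_def curl_end_def curl_start'_def curl_end'_def field_simps)
  next
    case 2 then show ?thesis by (simp add: curl_eqs curl_loop_def curl_loop'_def)
  next
    case 3 then show ?thesis
      by (simp add: curl_eqs curl_start_def curl_end_def curl_start'_def curl_end'_def field_simps)
  qed
  then show "curl \<sigma> (- \<tau>) $ 1 = - curl \<sigma> \<tau> $ 1" "curl \<sigma> (- \<tau>) $ 2 = curl \<sigma> \<tau> $ 2"
    "curl' \<sigma> (- \<tau>) $ 1 = curl' \<sigma> \<tau> $ 1" "curl' \<sigma> (- \<tau>) $ 2 = - curl' \<sigma> \<tau> $ 2" by blast+
qed

lemma curl_start_bounds:
  assumes "-5 \<le> \<tau>" "\<tau> \<le> -1"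
  shows "curl_start \<tau> $ 1 \<le> 1" "-5 \<le> curl_start \<tau> $ 1" "-5 < \<tau> \<Longrightarrow> -5 < curl_start \<tau> $ 1"
    "0 \<le> curl_start \<tau> $ 2" "curl_start \<tau> $ 2 \<le> 2" "-5 < \<tau> \<Longrightarrow> 0 < curl_start \<tau> $ 2"
    "\<tau> < -1 \<Longrightarrow> curl_start \<tau> $ 2 < 2"
proof -
  have t: "1 \<le> - \<tau>" "- \<tau> \<le> 5" using assms by auto
  have "curl_start \<tau> $ 1 = - curl_end 0 (- \<tau>) $ 1" "curl_start \<tau> $ 2 = curl_end 0 (- \<tau>) $ 2"
    by (simp_all add: curl_start_def curl_end_def)
  then show "curl_start \<tau> $ 1 \<le> 1" "-5 \<le> curl_start \<tau> $ 1" "-5 < \<tau> \<Longrightarrow> -5 < curl_start \<tau> $ 1"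
    "0 \<le> curl_start \<tau> $ 2" "curl_start \<tau> $ 2 \<le> 2" "-5 < \<tau> \<Longrightarrow> 0 < curl_start \<tau> $ 2"
    "\<tau> < -1 \<Longrightarrow> curl_start \<tau> $ 2 < 2"
    using curl_end_bounds[OF t, of 0] by simp_all
qed

lemma curl_loop_circle:
  obtains c d where "c\<^sup>2 + d\<^sup>2 = 1" "\<bar>c\<bar> \<le> 1" "\<bar>d\<bar> \<le> 1"
    "curl_loop \<tau> = vec3 (- d) (2 + c) 0"
    "curl_loop' \<tau> = (2 / (1 + \<tau>\<^sup>2)) *\<^sub>R vec3 (- c) (- d) 0"
proof -
  define c d where "c = (1 - \<tau>\<^sup>2) / (1 + \<tau>\<^sup>2)" and "d = 2 * \<tau> / (1 + \<tau>\<^sup>2)"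
  show thesis
    by (rule that[of c d])
      (use rational_circle[of "\<tau>"] rational_circle_bounds[OF c_def d_def]
        in \<open>simp_all add: c_def d_def curl_loop_def curl_loop'_def\<close>)
qed

lemma arc_curl: "arc (curl \<sigma>) (curl' \<sigma>)"
  unfolding arc_def
proof (intro conjI allI impI C1_curl)
  fix \<tau> :: real assume \<tau>: "\<bar>\<tau>\<bar> \<ge> 5"
  then have "\<tau> \<le> -5 \<or> 5 \<le> \<tau>" by linarith
  then show "curl \<sigma> \<tau> = line \<tau>" "curl' \<sigma> \<tau> = vec3 1 0 0" using curl_eqs by blast+
next
  fix \<tau> :: real assume \<tau>: "\<bar>\<tau>\<bar> \<le> 5"
  have "\<bar>curl \<sigma> \<tau> $ 1\<bar> \<le> 5 \<and> \<bar>curl \<sigma> \<tau> $ 2\<bar> \<le> 5"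
    using \<tau>
  proof (cases rule: curl_cases)
    case 1 then show ?thesis using curl_start_bounds[OF 1] by (simp add: curl_eqs)
  next
    case 2
    obtain c d where "\<bar>c\<bar> \<le> 1" "\<bar>d\<bar> \<le> 1" "curl_loop \<tau> = vec3 (- d) (2 + c) 0"
      by (rule curl_loop_circle[of \<tau>])
    then show ?thesis using 2 by (simp add: curl_eqs)
  next
    case 3 then show ?thesis using curl_end_bounds[OF 3, of \<sigma>] by (simp add: curl_eqs)
  qed
  then show "\<bar>curl \<sigma> \<tau> $ 1\<bar> \<le> 5" "\<bar>curl \<sigma> \<tau> $ 2\<bar> \<le> 5" by auto
qed

lemma curl_decreasing:
  assumes "0 \<le> a" "a < b" "b \<le> 5"
  shows "curl \<sigma> b $ 2 < curl \<sigma> a $ 2"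
proof -
  have loop: "curl \<sigma> q $ 2 < curl \<sigma> p $ 2" if "0 \<le> p" "p < q" "q \<le> 1" for p q
  proof -
    have e: "2 + (1 - x\<^sup>2) / (1 + x\<^sup>2) = 1 + 2 / (1 + x\<^sup>2)" for x :: real
      by (simp add: add_divide_distrib[symmetric] field_simps)
    have "p\<^sup>2 < q\<^sup>2" using that by (intro power_strict_mono) auto
    then have "2 / (1 + q\<^sup>2) < 2 / (1 + p\<^sup>2)" by (intro divide_strict_left_mono mult_pos_pos) auto
    then show ?thesis using that by (simp add: curl_eqs curl_loop_def e)
  qed
  have tail: "curl \<sigma> q $ 2 < curl \<sigma> p $ 2" if "1 \<le> p" "p < q" "q \<le> 5" for p q
  proof -
    have "(5 - q)\<^sup>2 < (5 - p)\<^sup>2" using that by (intro power_strict_mono) auto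
    then show ?thesis using that by (simp add: curl_eqs curl_end_def)
  qed
  consider "b \<le> 1" | "1 \<le> a" | "a < 1" "1 < b" by linarith
  then show ?thesis
  proof cases
    case 1 then show ?thesis using loop[of a b] assms by simp
  next
    case 2 then show ?thesis using tail[of a b] assms by simp
  next
    case 3 then show ?thesis using loop[of a 1] tail[of 1 b] assms by simp
  qed
qed

text \<open>Evenness and strict monotonicity of the second coordinate force opposite parameters, and
  oddness of the first coordinate makes it 0. As that coordinate is negative on (0, 1] and equals 5
  at 5, the node lies on the outer pieces.\<close>

lemma curl_node:
  assumes "\<bar>\<rho>\<bar> \<le> 5" "\<bar>\<tau>\<bar> \<le> 5" "\<rho> < \<tau>" "curl \<sigma> \<rho> $ 1 = curl \<sigma> \<tau> $ 1" "curl \<sigma> \<rho> $ 2 = curl \<sigma> \<tau> $ 2"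
  shows "\<rho> = - \<tau>" "1 < \<tau>" "\<tau> < 5" "curl \<sigma> \<tau> $ 1 = 0"
proof -
  have ab: "curl \<sigma> \<bar>x\<bar> $ 2 = curl \<sigma> x $ 2" if "\<bar>x\<bar> \<le> 5" for x
    using curl_symmetric(2)[OF that] by (cases "0 \<le> x") auto
  have "\<bar>\<rho>\<bar> = \<bar>\<tau>\<bar>"
  proof (rule ccontr)
    assume "\<bar>\<rho>\<bar> \<noteq> \<bar>\<tau>\<bar>"
    then have "curl \<sigma> \<bar>\<rho>\<bar> $ 2 \<noteq> curl \<sigma> \<bar>\<tau>\<bar> $ 2"
      using curl_decreasing[of "\<bar>\<rho>\<bar>" "\<bar>\<tau>\<bar>" \<sigma>] curl_decreasing[of "\<bar>\<tau>\<bar>" "\<bar>\<rho>\<bar>" \<sigma>] assms(1,2)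
      by (metis abs_ge_zero less_irrefl linorder_neqE_linordered_idom)
    then show False using ab assms by simp
  qed
  then show r: "\<rho> = - \<tau>" using assms by auto
  then have \<tau>0: "0 < \<tau>" using assms by simp
  show X: "curl \<sigma> \<tau> $ 1 = 0" using curl_symmetric(1)[OF assms(2)] assms(4) r by simp
  show "1 < \<tau>"
  proof (rule ccontr)
    assume "\<not> 1 < \<tau>"
    then have "curl \<sigma> \<tau> $ 1 = - (2 * \<tau> / (1 + \<tau>\<^sup>2))" using \<tau>0 by (simp add: curl_eqs curl_loop_def)
    then show False using X \<tau>0 by simp
  qed
  show "\<tau> < 5"
  proof (rule ccontr)
    assume "\<not> \<tau> < 5"
    then have "\<tau> = 5" using assms by simp
    then have "curl \<sigma> \<tau> = line \<tau>" using curl_eqs(5)[of \<tau> \<sigma>] by simp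
    then have "curl \<sigma> \<tau> $ 1 = \<tau>" by (simp add: line_def)
    then show False using X \<open>\<tau> = 5\<close> by simp
  qed
qed

lemma curl_regular:
  assumes "\<bar>\<tau>\<bar> \<le> 5" shows "curl' \<sigma> \<tau> $ 1 \<noteq> 0 \<or> curl' \<sigma> \<tau> $ 2 \<noteq> 0"
proof -
  have pos: "curl' \<sigma> x $ 1 \<noteq> 0 \<or> curl' \<sigma> x $ 2 \<noteq> 0" if "1 \<le> x" "x \<le> 5" for x
  proof (cases "x = 5")
    case True
    then have "curl' \<sigma> x = vec3 1 0 0" using curl_eqs(5)[of x \<sigma>] by simp
    then show ?thesis by simp
  next
    case False
    then have "curl_end' \<sigma> x $ 2 < 0" using curl_end_bounds(9)[OF that] that by simp
    then show ?thesis using curl_eqs(4)[OF that] by simp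
  qed
  show ?thesis
    using assms
  proof (cases rule: curl_cases)
    case 1 then show ?thesis using pos[of "- \<tau>"] curl_symmetric(3,4)[OF assms, of \<sigma>] by auto
  next
    case 2
    obtain c d where cd: "c\<^sup>2 + d\<^sup>2 = 1"
      "curl_loop' \<tau> = (2 / (1 + \<tau>\<^sup>2)) *\<^sub>R vec3 (- c) (- d) 0"
      by (rule curl_loop_circle[of \<tau>])
    then have "c \<noteq> 0 \<or> d \<noteq> 0" by auto
    then show ?thesis using 2 cd(2) by (auto simp: curl_eqs)
  next
    case 3 then show ?thesis using pos by blast
  qed
qed

lemma curl_height:
  "\<bar>\<tau>\<bar> \<le> 5 \<Longrightarrow> \<tau> \<le> 1 \<Longrightarrow> curl \<sigma> \<tau> $ 3 = 0"
  "1 < \<tau> \<Longrightarrow> \<tau> < 5 \<Longrightarrow> \<sigma>\<^sup>2 = 1 \<Longrightarrow> \<sigma> * curl \<sigma> \<tau> $ 3 > 0"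
proof -
  show "curl \<sigma> \<tau> $ 3 = 0" if "\<bar>\<tau>\<bar> \<le> 5" "\<tau> \<le> 1"
    using that(1) by (cases rule: curl_cases)
      (use that in \<open>simp_all add: curl_eqs curl_start_def curl_loop_def curl_end_def\<close>)
  assume *: "1 < \<tau>" "\<tau> < 5" "\<sigma>\<^sup>2 = 1"
  then have "\<sigma> * curl \<sigma> \<tau> $ 3 = \<sigma>\<^sup>2 * ((\<tau> - 1) * (5 - \<tau>))\<^sup>2"
    by (simp add: curl_eqs curl_end_def power2_eq_square)
  then show "\<sigma> * curl \<sigma> \<tau> $ 3 > 0" using * by simp
qed

text \<open>The same diagram, lifted so that \<open>x + \<sigma> z\<close> is the parameter.\<close>

definition lifted_curl :: "real \<Rightarrow> curve" where
  "lifted_curl \<sigma> \<tau> = vec3 (curl \<sigma> \<tau> $ 1) (curl \<sigma> \<tau> $ 2) (\<sigma> * (\<tau> - curl \<sigma> \<tau> $ 1))"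

definition lifted_curl' :: "real \<Rightarrow> curve" where
  "lifted_curl' \<sigma> \<tau> = vec3 (curl' \<sigma> \<tau> $ 1) (curl' \<sigma> \<tau> $ 2) (\<sigma> * (1 - curl' \<sigma> \<tau> $ 1))"

lemma arc_lifted_curl: "arc (lifted_curl \<sigma>) (lifted_curl' \<sigma>)"
  unfolding arc_def
proof (intro conjI allI impI)
  have d: "((\<lambda>\<tau>. curl \<sigma> \<tau> $ k) has_real_derivative curl' \<sigma> \<tau> $ k) (at \<tau>)" for k \<tau>
    by (rule has_real_derivative_vec_nth[OF C1_D[OF C1_curl]])
  have c: "continuous_on UNIV (curl' \<sigma>)" using C1_curl by (simp add: C1_def)
  show "C1 (lifted_curl \<sigma>) (lifted_curl' \<sigma>)"
    unfolding lifted_curl_def[abs_def] lifted_curl'_def[abs_def]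
    by (rule C1_vec3) (auto intro!: derivative_eq_intros d continuous_intros c)
  note a = arc_curl[of \<sigma>, unfolded arc_def]
  show "lifted_curl \<sigma> \<tau> = line \<tau>" "lifted_curl' \<sigma> \<tau> = vec3 1 0 0" if "\<bar>\<tau>\<bar> \<ge> 5" for \<tau>
    using a that by (simp_all add: lifted_curl_def lifted_curl'_def line_def)
  show "\<bar>lifted_curl \<sigma> \<tau> $ 1\<bar> \<le> 5" "\<bar>lifted_curl \<sigma> \<tau> $ 2\<bar> \<le> 5" if "\<bar>\<tau>\<bar> \<le> 5" for \<tau>
    using a that by (simp_all add: lifted_curl_def)
qed

text \<open>The projection does not change during the interpolation, so only the node could become a
  double point. There the height gap, multiplied by \<sigma>, is (1 - t) times a positive bump plus
  2 t \<tau>, which is never 0.\<close>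

lemma inj_on_lift_curl:
  assumes t: "t \<in> {0..1}" and \<sigma>: "\<sigma>\<^sup>2 = 1"
  shows "inj_on (\<lambda>\<tau>. (1 - t) *\<^sub>R curl \<sigma> \<tau> + t *\<^sub>R lifted_curl \<sigma> \<tau>) {-5..5}"
proof -
  let ?H = "\<lambda>\<tau>. (1 - t) *\<^sub>R curl \<sigma> \<tau> + t *\<^sub>R lifted_curl \<sigma> \<tau>"
  have e: "?H \<tau> $ 1 = curl \<sigma> \<tau> $ 1" "?H \<tau> $ 2 = curl \<sigma> \<tau> $ 2"
    "\<sigma> * ?H \<tau> $ 3 = (1 - t) * (\<sigma> * curl \<sigma> \<tau> $ 3) + t * (\<tau> - curl \<sigma> \<tau> $ 1)" for \<tau>
  proof -
    show "?H \<tau> $ 1 = curl \<sigma> \<tau> $ 1" "?H \<tau> $ 2 = curl \<sigma> \<tau> $ 2"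
      by (simp_all add: lifted_curl_def algebra_simps)
    have "\<sigma> * ?H \<tau> $ 3 = (1 - t) * (\<sigma> * curl \<sigma> \<tau> $ 3) + \<sigma>\<^sup>2 * (t * (\<tau> - curl \<sigma> \<tau> $ 1))"
      by (simp add: lifted_curl_def algebra_simps power2_eq_square)
    then show "\<sigma> * ?H \<tau> $ 3 = (1 - t) * (\<sigma> * curl \<sigma> \<tau> $ 3) + t * (\<tau> - curl \<sigma> \<tau> $ 1)"
      using \<sigma> by simp
  qed
  have "?H \<rho> \<noteq> ?H \<tau>" if "\<rho> \<in> {-5..5}" "\<tau> \<in> {-5..5}" "\<rho> < \<tau>" for \<rho> \<tau>
  proof
    assume eq: "?H \<rho> = ?H \<tau>"
    then have "curl \<sigma> \<rho> $ 1 = curl \<sigma> \<tau> $ 1" "curl \<sigma> \<rho> $ 2 = curl \<sigma> \<tau> $ 2" using e by metis+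
    note n = curl_node[OF _ _ that(3) this]
    have r: "\<rho> = - \<tau>" "1 < \<tau>" "\<tau> < 5" "curl \<sigma> \<tau> $ 1 = 0" using n that by auto
    have z: "curl \<sigma> \<rho> $ 3 = 0" "curl \<sigma> \<rho> $ 1 = 0"
      using curl_height(1)[of \<rho> \<sigma>] r curl_symmetric(1)[of \<tau> \<sigma>] by auto
    have "\<sigma> * ?H \<rho> $ 3 = - (t * \<tau>)" unfolding e using z r(1) by simp
    moreover have "\<sigma> * ?H \<tau> $ 3 = (1 - t) * (\<sigma> * curl \<sigma> \<tau> $ 3) + t * \<tau>" unfolding e r by simp
    moreover have "\<sigma> * ?H \<rho> $ 3 = \<sigma> * ?H \<tau> $ 3" using eq by simp
    ultimately have "(1 - t) * (\<sigma> * curl \<sigma> \<tau> $ 3) + 2 * (t * \<tau>) = 0" by linarith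
    moreover have "(1 - t) * (\<sigma> * curl \<sigma> \<tau> $ 3) \<ge> 0" "t * \<tau> \<ge> 0"
      using curl_height(2)[OF r(2,3) \<sigma>] t r by auto
    ultimately have "(1 - t) * (\<sigma> * curl \<sigma> \<tau> $ 3) = 0" "t * \<tau> = 0" by linarith+
    then show False using curl_height(2)[OF r(2,3) \<sigma>] r by auto
  qed
  then show ?thesis by (intro inj_onI) (metis linorder_neqE_linordered_idom)
qed

lemma regular_lift_curl:
  assumes "\<bar>\<tau>\<bar> \<le> 5"
  shows "(1 - t) *\<^sub>R curl' \<sigma> \<tau> + t *\<^sub>R lifted_curl' \<sigma> \<tau> \<noteq> 0"
proof
  assume a: "(1 - t) *\<^sub>R curl' \<sigma> \<tau> + t *\<^sub>R lifted_curl' \<sigma> \<tau> = 0"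
  have "((1 - t) *\<^sub>R curl' \<sigma> \<tau> + t *\<^sub>R lifted_curl' \<sigma> \<tau>) $ 1 = curl' \<sigma> \<tau> $ 1"
    "((1 - t) *\<^sub>R curl' \<sigma> \<tau> + t *\<^sub>R lifted_curl' \<sigma> \<tau>) $ 2 = curl' \<sigma> \<tau> $ 2"
    by (simp_all add: lifted_curl'_def algebra_simps)
  then show False using curl_regular[OF assms, of \<sigma>] unfolding a by simp
qed

lemma regular_arc_curl: "\<sigma>\<^sup>2 = 1 \<Longrightarrow> regular_arc (curl \<sigma>) (curl' \<sigma>)"
  using inj_on_lift_curl[of 0 \<sigma>] regular_lift_curl[of _ 0 \<sigma>] arc_curl[of \<sigma>]
  by (simp add: regular_arc_def)

lemma regular_arc_lifted_curl: "\<sigma>\<^sup>2 = 1 \<Longrightarrow> regular_arc (lifted_curl \<sigma>) (lifted_curl' \<sigma>)"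
  using inj_on_lift_curl[of 1 \<sigma>] regular_lift_curl[of _ 1 \<sigma>] arc_lifted_curl[of \<sigma>]
  by (simp add: regular_arc_def)

text \<open>The first Reidemeister move in two steps: the heights are changed over a fixed diagram,
  and then the arc is pulled straight along the functional x + \<sigma> z.\<close>

lemma (in straight_strand) isotopic_curl:
  assumes \<sigma>: "\<sigma>\<^sup>2 = 1"
  shows "isotopic_via id (graft (curl \<sigma>)) (graft (lifted_curl \<sigma>))"
    and "isotopic_via id (graft (lifted_curl \<sigma>)) L"
proof -
  show "isotopic_via id (graft (curl \<sigma>)) (graft (lifted_curl \<sigma>))"
    by (rule isotopic_grafts[OF arc_curl arc_lifted_curl])
      (use \<sigma> inj_on_lift_curl regular_lift_curl in blast)+
  have ss: "\<sigma> * (\<sigma> * x) = x" for x using \<sigma> by (simp add: power2_eq_square mult.assoc[symmetric])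
  show "isotopic_via id (graft (lifted_curl \<sigma>)) L"
    by (intro isotopic_graft_line[OF regular_arc_lifted_curl[OF \<sigma>], of \<sigma>])
      (simp_all add: lifted_curl_def lifted_curl'_def ss)
qed

text \<open>The upper edge passes through the centre of the circle and cuts the curl at the joints
  -1 and 1, so that the loop stays outside. The full width makes the smoothed strand the whole
  segment from -5 to 5; the lower edge just has to lie below the axis.\<close>

definition lower_box :: "(real \<times> real) set" where "lower_box = {-5..5} \<times> {-1..2}"

lemma plane_proj_lower_box:
  "plane_proj v \<in> lower_box \<longleftrightarrow> -5 \<le> v $ 1 \<and> v $ 1 \<le> 5 \<and> -1 \<le> v $ 2 \<and> v $ 2 \<le> 2"
  by (auto simp: plane_proj_def lower_box_def)

text \<open>Rule II speaks of round circles that bound a flat disc off the link. The unlinked circle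
  is brought to this form, centred at distance 2 from the strand.\<close>

definition flat_circle :: curve where
  "flat_circle = round_circle (vec3 0 2 0) (vec3 1 0 0) (vec3 0 1 0)"

definition flat_circle' :: curve where
  "flat_circle' s = (2 * pi) *\<^sub>R vec3 (- sin (2 * pi * s)) (cos (2 * pi * s)) 0"

lemma flat_circle_eq: "flat_circle s = vec3 (cos (2 * pi * s)) (2 + sin (2 * pi * s)) 0"
  by (simp add: flat_circle_def round_circle_def vec3_eq_iff)

lemma C1_flat_circle: "C1 flat_circle flat_circle'"
  unfolding flat_circle_eq[abs_def] flat_circle'_def[abs_def] vec3_scaleR
  by (rule C1_vec3) (auto intro!: derivative_eq_intros continuous_intros simp: algebra_simps)

lemma curl_splits: "splits_into_loop lower_box (curl \<sigma>) (curl' \<sigma>) flat_circle flat_circle'"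
  unfolding splits_into_loop_def
proof (intro conjI allI impI)
  show "arc (curl \<sigma>) (curl' \<sigma>)" by (rule arc_curl)
  show "lower_box \<subseteq> square" by (auto simp: lower_box_def square_def)
  have b: "\<bar>cos x\<bar> \<le> 5" "\<bar>2 + sin x\<bar> \<le> 5" for x :: real
    using abs_cos_le_one[of x] abs_sin_le_one[of x] by linarith+
  show "plane_proj (flat_circle s) \<in> square" for s
    by (simp add: plane_proj_square flat_circle_eq b)
  show "curl \<sigma> \<tau> = line \<tau> \<and> curl' \<sigma> \<tau> = vec3 1 0 0 \<or>
      (\<exists>s. flat_circle s = curl \<sigma> \<tau> \<and> sgn (flat_circle' s) = sgn (curl' \<sigma> \<tau>))"
    if \<tau>: "\<bar>\<tau>\<bar> \<le> 5" and D: "plane_proj (curl \<sigma> \<tau>) \<notin> lower_box" for \<tau>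
    using \<tau>
  proof (cases rule: curl_cases)
    case 1 then show ?thesis
      using D curl_start_bounds[OF 1] by (simp add: curl_eqs plane_proj_lower_box)
  next
    case 2
    obtain c d where cd: "c\<^sup>2 + d\<^sup>2 = 1" "curl_loop \<tau> = vec3 (- d) (2 + c) 0"
      "curl_loop' \<tau> = (2 / (1 + \<tau>\<^sup>2)) *\<^sub>R vec3 (- c) (- d) 0"
      by (rule curl_loop_circle[of \<tau>])
    obtain s where "cos (2 * pi * s) = - d" "sin (2 * pi * s) = c"
      by (rule circle_point[of "- d" c]) (use cd in auto)
    then have "flat_circle s = curl_loop \<tau>" "flat_circle' s = (2 * pi) *\<^sub>R vec3 (- c) (- d) 0"
      by (simp_all add: flat_circle_eq flat_circle'_def cd)
    then show ?thesis using 2 cd(3) by (auto simp: curl_eqs sgn_scaleR_pos intro!: exI[of _ s])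
  next
    case 3 then show ?thesis
      using D curl_end_bounds[OF 3, of \<sigma>] by (simp add: curl_eqs plane_proj_lower_box)
  qed
  show "\<exists>\<tau>. \<bar>\<tau>\<bar> \<le> 5 \<and> flat_circle s = curl \<sigma> \<tau> \<and> sgn (flat_circle' s) = sgn (curl' \<sigma> \<tau>)"
    if D: "plane_proj (flat_circle s) \<notin> lower_box" for s
  proof -
    define x where "x = 2 * pi * s"
    have bx: "\<bar>cos x\<bar> \<le> 1" "\<bar>sin x\<bar> \<le> 1" by (rule abs_cos_le_one, rule abs_sin_le_one)
    have "plane_proj (flat_circle s) \<in> lower_box" if "sin x \<le> 0"
      unfolding plane_proj_lower_box flat_circle_eq x_def[symmetric] vector_3
      using bx that by (intro conjI; linarith)
    then have "0 < sin x" using D by force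
    then obtain t where t: "\<bar>t\<bar> \<le> 1" "sin x = (1 - t\<^sup>2) / (1 + t\<^sup>2)" "- cos x = 2 * t / (1 + t\<^sup>2)"
      using rational_circle_inv[of "sin x" "- cos x"] by auto
    have \<tau>: "-1 \<le> t" "t \<le> 1" using t(1) by auto
    have "flat_circle s = curl_loop t"
      by (simp add: flat_circle_eq curl_loop_def x_def[symmetric] t(2,3)[symmetric])
    moreover have "curl_loop' t = (2 / (1 + t\<^sup>2)) *\<^sub>R vec3 (- sin x) (cos x) 0"
      by (simp add: curl_loop'_def t(2,3)[symmetric])
    then have "sgn (flat_circle' s) = sgn (curl_loop' t)"
      by (simp add: flat_circle'_def x_def[symmetric] sgn_scaleR_pos)
    ultimately show ?thesis using curl_eqs(3)[OF \<tau>] \<tau> by (intro exI[of _ t]) simp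
  qed
  show "curl \<sigma> \<tau> = line \<tau>" "curl' \<sigma> \<tau> = vec3 1 0 0"
    if "\<bar>\<tau>\<bar> \<le> 5" "plane_proj (line \<tau>) \<notin> lower_box" for \<tau>
    using that by (auto simp: plane_proj_lower_box line_def abs_le_iff)
  show "\<exists>s. plane_proj (flat_circle s) \<notin> lower_box"
    by (rule exI[of _ "1 / 4"]) (simp add: plane_proj_lower_box flat_circle_eq)
  show "flat_circle s \<noteq> line \<tau>" for s \<tau>
  proof
    assume "flat_circle s = line \<tau>"
    then have "2 + sin (2 * pi * s) = 0" by (simp add: flat_circle_eq line_def vec3_eq_iff)
    then show False using sin_ge_minus_one[of "2 * pi * s"] by linarith
  qed
qed

section \<open>The skein triples\<close>

lemma cos_sin_eq_Ints:
  assumes "cos (2 * pi * s) = cos (2 * pi * t)" "sin (2 * pi * s) = sin (2 * pi * t)"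
  shows "s - t \<in> \<int>"
proof -
  obtain n :: int where "2 * pi * s = 2 * pi * t + 2 * pi * n"
    using assms sin_cos_eq_iff[of "2 * pi * s" "2 * pi * t"] by auto
  then have "2 * pi * s = 2 * pi * (t + n)" by (simp add: algebra_simps)
  then have "s = t + n" by simp
  then show ?thesis by simp
qed

lemma cos_sin_periodic:
  "cos (2 * pi * (s + 1)) = cos (2 * pi * s)" "sin (2 * pi * (s + 1)) = sin (2 * pi * s)"
  by (simp_all add: distrib_left)

lemma cos_sin_nonzero: "cos x \<noteq> 0 \<or> sin (x :: real) \<noteq> 0"
  by (metis sin_zero_abs_cos_one abs_zero zero_neq_one)

lemma box_topology:
  fixes a b c d :: real
  defines "D \<equiv> {a..b} \<times> {c..d}"
  shows "interior D = {a<..<b} \<times> {c<..<d}" "a < b \<Longrightarrow> c < d \<Longrightarrow> disc D"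
    "frontier D = D - {a<..<b} \<times> {c<..<d}"
proof -
  show i: "interior D = {a<..<b} \<times> {c<..<d}" by (simp add: D_def interior_Times)
  show "disc D" if "a < b" "c < d"
  proof -
    have "((a + b) / 2, (c + d) / 2) \<in> interior D" unfolding i using that by simp
    then have "interior D \<noteq> {}" by blast
    then show ?thesis
      by (simp add: disc_def D_def compact_Times convex_Times)
  qed
  have "closed D" by (simp add: D_def closed_Times)
  then show "frontier D = D - {a<..<b} \<times> {c<..<d}" by (simp add: frontier_def i)
qed

text \<open>The tilted circle pushed down over its right half. The squared positive part of the
  cosine keeps the curve continuously differentiable and leaves the left half untouched. Over (1, 0)
  the height becomes -1, so the strand is on top and the crossing is positive.\<close>

definition lowered_circle :: curve where
  "lowered_circle s = vec3 (cos (2 * pi * s)) (sin (2 * pi * s))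
     (sin (2 * pi * s) / 2 + cos (2 * pi * s) - 1 - (max 0 (cos (2 * pi * s)))\<^sup>2)"

definition lowered_circle' :: curve where
  "lowered_circle' s = (2 * pi) *\<^sub>R vec3 (- sin (2 * pi * s)) (cos (2 * pi * s))
     (cos (2 * pi * s) / 2 - sin (2 * pi * s) + 2 * max 0 (cos (2 * pi * s)) * sin (2 * pi * s))"

lemma DERIV_max_square: "((\<lambda>x. (max 0 x)\<^sup>2) has_real_derivative 2 * max 0 x) (at x)"
proof -
  \<comment> \<open>The gluing lemma is about curves in space, so the function is taken as the first
    coordinate of one.\<close>
  have "C1 (\<lambda>x. if x \<le> 0 then vec3 0 0 0 else vec3 (x\<^sup>2) 0 0)
      (\<lambda>x. if x \<le> 0 then vec3 0 0 0 else vec3 (2 * x) 0 0)"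
    by (intro C1_If C1_vec3) (auto intro!: derivative_eq_intros continuous_intros)
  from has_real_derivative_vec_nth[OF C1_D[OF this, of x], of 1]
  have "((\<lambda>x. (if x \<le> 0 then vec3 0 0 0 else vec3 (x\<^sup>2) 0 0) $ 1) has_real_derivative
      (if x \<le> 0 then vec3 0 0 0 else vec3 (2 * x) 0 0) $ 1) (at x)" .
  moreover have "(\<lambda>x. (if x \<le> 0 then vec3 0 0 0 else vec3 (x\<^sup>2) 0 0) $ 1) = (\<lambda>x. (max 0 x)\<^sup>2)"
    by (auto simp: fun_eq_iff max_def)
  moreover have "(if x \<le> 0 then vec3 0 0 0 else vec3 (2 * x) 0 0) $ 1 = 2 * max 0 x"
    by (simp add: max_def)
  ultimately show ?thesis by simp
qed

lemma C1_lowered_circle: "C1 lowered_circle lowered_circle'"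
  unfolding lowered_circle_def[abs_def] lowered_circle'_def[abs_def] vec3_scaleR
proof (rule C1_vec3)
  fix s :: real
  show c: "((\<lambda>s. cos (2 * pi * s)) has_real_derivative 2 * pi * - sin (2 * pi * s)) (at s)"
    by (auto intro!: derivative_eq_intros)
  show d: "((\<lambda>s. sin (2 * pi * s)) has_real_derivative 2 * pi * cos (2 * pi * s)) (at s)"
    by (auto intro!: derivative_eq_intros)
  have m: "((\<lambda>s. (max 0 (cos (2 * pi * s)))\<^sup>2) has_real_derivative
      2 * max 0 (cos (2 * pi * s)) * (2 * pi * - sin (2 * pi * s))) (at s)"
    by (rule DERIV_chain2[OF DERIV_max_square c])
  show "((\<lambda>s. sin (2 * pi * s) / 2 + cos (2 * pi * s) - 1 - (max 0 (cos (2 * pi * s)))\<^sup>2) has_real_derivative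
      2 * pi * (cos (2 * pi * s) / 2 - sin (2 * pi * s) + 2 * max 0 (cos (2 * pi * s)) * sin (2 * pi * s))) (at s)"
    by (rule DERIV_cong[OF DERIV_diff[OF DERIV_diff[OF DERIV_add[OF DERIV_cdivide[OF d] c] DERIV_const] m]])
      (simp add: algebra_simps)
qed (auto intro!: continuous_intros)

lemma tilted_circle_touching: "touching_loop square (vec3 1 0 0) tilted_circle"
  unfolding touching_loop_def simple_loop_def
proof (intro conjI allI impI)
  show "closed_curve tilted_circle"
  proof (rule closed_curveI[OF _ C1_tilted_circle])
    show "tilted_circle (s + 1) = tilted_circle s" for s
      by (simp only: tilted_circle_def cos_sin_periodic)
    show "tilted_circle' s \<noteq> 0" for s
      using cos_sin_nonzero[of "2 * pi * s"] by (auto simp: tilted_circle'_def vec3_eq_iff)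
  qed
  show "s - t \<in> \<int>" if "tilted_circle s = tilted_circle t" for s t
    using that by (intro cos_sin_eq_Ints) (simp_all add: tilted_circle_def vec3_eq_iff)
  show "plane_proj (tilted_circle s) \<in> square" for s
    using detour_splits unfolding splits_into_loop_def by blast
  show "tilted_circle 0 = vec3 1 0 0" by (simp add: tilted_circle_def)
  show "s \<in> \<int>" if "tilted_circle s $ 2 = 0 \<and> tilted_circle s $ 3 = 0" for s
    using that cos_sin_eq_Ints[of s 0] by (simp add: tilted_circle_def)
  show "velocity tilted_circle 0 $ 2 \<noteq> 0 \<or> velocity tilted_circle 0 $ 3 \<noteq> 0"
    by (simp add: C1_velocity[OF C1_tilted_circle] tilted_circle'_def)
qed

text \<open>On the right half cos x - (cos x)^2 is at most 1/4 and sin x / 2 at most 1/2, so their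
  sum stays below the subtracted 1.\<close>

lemma lowered_circle_neg: "sin x / 2 + cos x - 1 - (max 0 (cos x))\<^sup>2 < 0" for x :: real
proof (cases "cos x \<le> 0")
  case True
  then have m: "max 0 (cos x) = 0" by simp
  have "sin x / 2 + cos x - 1 < 0" using True sin_le_one[of x] by linarith
  then show ?thesis unfolding m by simp
next
  case False
  then have m: "max 0 (cos x) = cos x" by simp
  have "(cos x - 1 / 2)\<^sup>2 \<ge> 0" by simp
  then have "cos x - (cos x)\<^sup>2 \<le> 1 / 4" by (simp add: power2_eq_square algebra_simps)
  then show ?thesis unfolding m using sin_le_one[of x] by linarith
qed

text \<open>The interpolation moves the projection of the circle sideways by 2t. Until t = 1 the
  circle is strictly below the strand, and at t = 1 its projection has left the axis.\<close>

lemma unlinked_loops: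
  assumes t: "t \<in> {0..1}"
  shows "free_loop square (\<lambda>s. (1 - t) *\<^sub>R lowered_circle s + t *\<^sub>R flat_circle s)"
proof -
  let ?C = "\<lambda>s. (1 - t) *\<^sub>R lowered_circle s + t *\<^sub>R flat_circle s"
  let ?C' = "\<lambda>s. (1 - t) *\<^sub>R lowered_circle' s + t *\<^sub>R flat_circle' s"
  let ?z = "\<lambda>x. sin x / 2 + cos x - 1 - (max 0 (cos x))\<^sup>2 :: real"
  have "?C s $ 1 = cos (2 * pi * s)" "?C s $ 2 = 2 * t + sin (2 * pi * s)" for s
    by (simp_all add: lowered_circle_def flat_circle_eq algebra_simps)
  moreover have "?C s $ 3 = (1 - t) * ?z (2 * pi * s)" for s
    by (simp add: lowered_circle_def flat_circle_eq)
  ultimately have e: "?C s $ 1 = cos (2 * pi * s)" "?C s $ 2 = 2 * t + sin (2 * pi * s)"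
    "?C s $ 3 = (1 - t) * ?z (2 * pi * s)" for s by blast+
  have e': "?C' s $ 1 = - (2 * pi * sin (2 * pi * s))" "?C' s $ 2 = 2 * pi * cos (2 * pi * s)" for s
    by (simp_all add: lowered_circle'_def flat_circle'_def algebra_simps)
  have nz: "?C' s \<noteq> 0" for s
  proof
    assume "?C' s = 0"
    then have "?C' s $ 1 = 0" "?C' s $ 2 = 0" by simp_all
    then show False unfolding e' using cos_sin_nonzero[of "2 * pi * s"] by simp
  qed
  show ?thesis
    unfolding free_loop_def simple_loop_def
  proof (intro conjI allI impI)
    show "closed_curve ?C"
    proof (rule closed_curveI[OF _ C1_lerp[OF C1_lowered_circle C1_flat_circle]])
      show "?C (s + 1) = ?C s" for s
        by (simp only: lowered_circle_def flat_circle_eq cos_sin_periodic)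
    qed (rule nz)
    show "s - s' \<in> \<int>" if "?C s = ?C s'" for s s'
    proof (rule cos_sin_eq_Ints)
      have "?C s $ 1 = ?C s' $ 1" "?C s $ 2 = ?C s' $ 2" using that by simp_all
      then show "cos (2 * pi * s) = cos (2 * pi * s')" "sin (2 * pi * s) = sin (2 * pi * s')"
        unfolding e by simp_all
    qed
    show "plane_proj (?C s) \<in> square" for s
      unfolding plane_proj_square e
      using t abs_cos_le_one[of "2 * pi * s"] abs_sin_le_one[of "2 * pi * s"]
      by (simp only: atLeastAtMost_iff) linarith
    show "?C s $ 2 \<noteq> 0 \<or> ?C s $ 3 \<noteq> 0" for s
    proof (cases "t = 1")
      case True
      have "2 + sin (2 * pi * s) \<noteq> 0" using sin_ge_minus_one[of "2 * pi * s"] by linarith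
      then show ?thesis unfolding e using True by simp
    next
      case False
      then have "?C s $ 3 \<noteq> 0" unfolding e using t lowered_circle_neg[of "2 * pi * s"] by auto
      then show ?thesis by blast
    qed
  qed
qed

context straight_strand
begin

lemma param_eqs:
  assumes "-5 \<le> p" "q \<le> 5" "s \<in> {s0 + p / V..s0 + q / V}"
  shows "w s = V * (s - s0)" "V * (s - s0) \<in> {p..q}" "\<bar>w s\<bar> \<le> 5"
proof -
  have V0: "V > 0" using V by simp
  have "p / V \<le> s - s0" "s - s0 \<le> q / V" using assms by auto
  then show r: "V * (s - s0) \<in> {p..q}" using V0 by (simp add: field_simps)
  have "\<bar>V * (s - s0)\<bar> \<le> 6" using r assms by auto
  from w_eq[OF this] show ww: "w s = V * (s - s0)" using V0 by simp
  show "\<bar>w s\<bar> \<le> 5" unfolding ww using r assms by auto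
qed

text \<open>Transports the conditions on a strand from the parameter of the component to the
  parameter V (s - s0) of the arcs, in which the pieces are known.\<close>

lemma proper_strand_arc:
  assumes p: "-5 \<le> p" "p < q" "q \<le> 5" and iX: "i < length X"
    and X: "\<And>s. \<bar>w s\<bar> \<le> 5 \<Longrightarrow> (X ! i) s = G (w s)"
    and inj: "inj_on (\<lambda>\<tau>. plane_proj (G \<tau>)) {p..q}"
    and int: "\<And>\<tau>. p < \<tau> \<Longrightarrow> \<tau> < q \<Longrightarrow> plane_proj (G \<tau>) \<in> interior D"
    and fr: "plane_proj (G p) \<in> frontier D" "plane_proj (G q) \<in> frontier D"
  shows "proper_strand D X (i, s0 + p / V, s0 + q / V)"
proof -
  have V0: "V > 0" using V by simp
  have Xs: "(X ! i) s = G (V * (s - s0))" if "s \<in> {s0 + p / V..s0 + q / V}" for s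
    using param_eqs[OF p(1,3) that] X by simp
  have "p / V < q / V" using p V0 by (simp add: divide_strict_right_mono)
  moreover have "inj_on (\<lambda>s. plane_proj ((X ! i) s)) {s0 + p / V..s0 + q / V}"
  proof (rule inj_onI)
    fix s t assume st: "s \<in> {s0 + p / V..s0 + q / V}" "t \<in> {s0 + p / V..s0 + q / V}"
      "plane_proj ((X ! i) s) = plane_proj ((X ! i) t)"
    then have "plane_proj (G (V * (s - s0))) = plane_proj (G (V * (t - s0)))" using Xs by simp
    then have "V * (s - s0) = V * (t - s0)"
      by (rule inj_onD[OF inj]) (use param_eqs(2)[OF p(1,3)] st in blast)+
    then show "s = t" using V0 by simp
  qed
  moreover have "plane_proj ((X ! i) s) \<in> interior D" if s: "s \<in> {s0 + p / V<..<s0 + q / V}" for s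
  proof -
    have "p < V * (s - s0)" "V * (s - s0) < q" using s V0 by (simp_all add: field_simps)
    then show ?thesis using Xs[of s] s int by simp
  qed
  moreover have "(X ! i) (s0 + p / V) = G p" "(X ! i) (s0 + q / V) = G q"
    using Xs[of "s0 + p / V"] Xs[of "s0 + q / V"] V0 \<open>p / V < q / V\<close> by simp_all
  ultimately show ?thesis using fr iX by (simp add: proper_strand_def)
qed

lemma on_strand_arc:
  assumes "p \<le> w s" "w s \<le> q"
  shows "on_strand (i, s0 + p / V, s0 + q / V) i s"
proof -
  have V0: "V > 0" using V by simp
  have "s + of_int (- \<lfloor>s - s0 + 1 / 2\<rfloor>) \<in> {s0 + p / V..s0 + q / V}"
    using assms V0 by (simp add: w_def field_simps)
  then show ?thesis unfolding on_strand_def case_prod_conv by blast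
qed

lemma arc_values:
  assumes "arc G G'" "\<bar>p\<bar> \<le> 5"
  shows "(graft G ! i) (s0 + p / V) = G p" "velocity (graft G ! i) (s0 + p / V) = V *\<^sub>R G' p"
proof -
  have "w (s0 + p / V) = p" by (rule w_eq) (use assms in simp)
  then show "(graft G ! i) (s0 + p / V) = G p" "velocity (graft G ! i) (s0 + p / V) = V *\<^sub>R G' p"
    using assms i by (simp_all add: nth_graft gcurve_eq[OF assms(1)] velocity_gcurve[OF assms(1)])
qed

lemma line_values:
  assumes "\<bar>p\<bar> \<le> 5"
  shows "(L ! i) (s0 + p / V) = line p" "velocity (L ! i) (s0 + p / V) = V *\<^sub>R vec3 1 0 0"
proof -
  have "w (s0 + p / V) = p" by (rule w_eq) (use assms in simp)
  then show "(L ! i) (s0 + p / V) = line p" "velocity (L ! i) (s0 + p / V) = V *\<^sub>R vec3 1 0 0"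
    using on_line[of "s0 + p / V"] assms by simp_all
qed

lemma graft_over:
  assumes a: "arc G G'" and D: "D \<subseteq> square" and m: "m < length L"
    and s: "plane_proj ((graft G ! m) s) \<in> D"
  shows "m = i" "\<bar>w s\<bar> \<le> 5" "(graft G ! m) s = G (w s)"
proof -
  have sq: "plane_proj ((graft G ! m) s) \<in> square" using D s by blast
  show mi: "m = i"
  proof (rule ccontr)
    assume "m \<noteq> i"
    then have "plane_proj ((L ! m) s) \<in> square" using sq m by (simp add: nth_graft)
    then show False using boxD[OF m] \<open>m \<noteq> i\<close> plane_proj_square by blast
  qed
  then have g: "(graft G ! m) s = gcurve G s" using i by (simp add: nth_graft)
  then show ww: "\<bar>w s\<bar> \<le> 5" using sq gcurve_box[OF a, of s] plane_proj_square by simp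
  show "(graft G ! m) s = G (w s)" using g ww gcurve_eq[OF a, of s] by simp
qed

lemma line_over:
  assumes D: "D \<subseteq> square" and m: "m < length L" and s: "plane_proj ((L ! m) s) \<in> D"
  shows "m = i" "\<bar>w s\<bar> \<le> 5" "(L ! m) s = line (w s)"
  using graft_over[OF arc_line D m, unfolded graft_line, OF s] by blast+

lemma singular_tilted: "singular_link (L @ [tilted_circle])"
proof -
  have "singular_link (L @ [tilted_circle]) \<and> double_pairs (L @ [tilted_circle]) =
      {((i, frac (s0 + 1 / V)), (length L, 0)), ((length L, 0), (i, frac (s0 + 1 / V)))}"
    by (rule singular_touching_loop[OF classical near_axis_square i _ _ _ tilted_circle_touching])
      (simp_all add: line_values line_def)
  then show ?thesis by blast
qed

lemma classical_lowered: "classical_link (L @ [lowered_circle])"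
  using classical_free_loop[OF classical near_axis_square unlinked_loops[of 0]] by simp

lemma classical_flat: "classical_link (L @ [flat_circle])"
  using classical_free_loop[OF classical near_axis_square unlinked_loops[of 1]] by simp

lemma isotopic_lowered_flat: "isotopic_via id (L @ [lowered_circle]) (L @ [flat_circle])"
  by (rule isotopic_free_loops[OF classical near_axis_square unlinked_loops])

lemma right_box_topology:
  "right_box \<subseteq> square" "disc right_box"
  "plane_proj v \<in> interior right_box \<longleftrightarrow> 0 < v $ 1 \<and> v $ 1 < 4 \<and> -2 < v $ 2 \<and> v $ 2 < 2"
  "plane_proj v \<in> frontier right_box \<longleftrightarrow> plane_proj v \<in> right_box \<and>
    \<not> (0 < v $ 1 \<and> v $ 1 < 4 \<and> -2 < v $ 2 \<and> v $ 2 < 2)"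
  using box_topology[of 0 4 "-2" 2]
  by (auto simp: right_box_def square_def plane_proj_def)

end

section \<open>The skein triple at the singular crossing\<close>

context straight_strand
begin

text \<open>Covers the tilted and the lowered circle at once: they share their projection, and the
  crossing sees only the height at time 0. The determinant is positive and the strand has height 0,
  so the sign is opposite to that of this height. The times from -1/4 to 1/4 are those of the right
  half of the circle.\<close>

lemma singular_crossing:
  assumes C: "\<And>s. C s $ 1 = cos (2 * pi * s)" "\<And>s. C s $ 2 = sin (2 * pi * s)"
    "velocity C 0 $ 1 = 0" "velocity C 0 $ 2 = 2 * pi"
  shows "single_crossing right_box (i, s0 + 0 / V, s0 + 4 / V) (length L, -1 / 4, 1 / 4)
    (sgn (- (C 0 $ 3))) (L @ [C])"
proof -
  have V0: "V > 0" using V by simp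
  have Ci: "(L @ [C]) ! i = L ! i" "(L @ [C]) ! length L = C" using i by (simp_all add: nth_append)
  have line_s: "proper_strand right_box (L @ [C]) (i, s0 + 0 / V, s0 + 4 / V)"
  proof (rule proper_strand_arc[where G = line])
    show "((L @ [C]) ! i) s = line (w s)" if "\<bar>w s\<bar> \<le> 5" for s
      using on_line(1)[of s] that Ci by simp
    show "inj_on (\<lambda>\<tau>. plane_proj (line \<tau>)) {0..4}" by (auto simp: inj_on_def plane_proj_def line_def)
  qed (use i in \<open>auto simp: right_box_topology plane_proj_right_box line_def\<close>)
  have angle: "2 * pi * s \<in> {- (pi / 2)..pi / 2}" if "s \<in> {-1/4..1/4}" for s
    using that mult_left_mono[of s "1/4" "2 * pi"] mult_left_mono[of "-1/4" s "2 * pi"] by auto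
  have loop_s: "proper_strand right_box (L @ [C]) (length L, -1 / 4, 1 / 4)"
    unfolding proper_strand_def case_prod_conv Ci
  proof (intro conjI ballI)
    show "inj_on (\<lambda>s. plane_proj (C s)) {-1 / 4..1 / 4}"
    proof (rule inj_onI)
      fix s t :: real assume st: "s \<in> {-1 / 4..1 / 4}" "t \<in> {-1 / 4..1 / 4}" "plane_proj (C s) = plane_proj (C t)"
      then have eq: "sin (2 * pi * s) = sin (2 * pi * t)" by (simp add: plane_proj_def C)
      have "2 * pi * s = 2 * pi * t"
        by (rule sin_inj_pi[OF _ _ _ _ eq]) (use angle[OF st(1)] angle[OF st(2)] in auto)
      then show "s = t" by simp
    qed
    show "plane_proj (C s) \<in> interior right_box" if s: "s \<in> {-1 / 4<..<1 / 4}" for s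
    proof -
      have "- (pi / 2) < 2 * pi * s" "2 * pi * s < pi / 2"
        using s mult_strict_left_mono[of s "1/4" "2 * pi"] mult_strict_left_mono[of "-1/4" s "2 * pi"] by auto
      then have "cos (2 * pi * s) > 0" by (rule cos_gt_zero_pi)
      then show ?thesis
        using cos_le_one[of "2 * pi * s"] sin_le_one[of "2 * pi * s"] sin_ge_minus_one[of "2 * pi * s"]
        unfolding right_box_topology C by (intro conjI; linarith)
    qed
    have "2 * pi * (- 1 / 4) = - (pi / 2)" "2 * pi * (1 / 4) = pi / 2" by simp_all
    then show "plane_proj (C (-1 / 4)) \<in> frontier right_box" "plane_proj (C (1 / 4)) \<in> frontier right_box"
      by (simp_all only: right_box_topology plane_proj_right_box C cos_minus sin_minus cos_pi_half sin_pi_half) simp_all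
  qed simp_all
  have two: "two_strands right_box (L @ [C]) (i, s0 + 0 / V, s0 + 4 / V) (length L, -1 / 4, 1 / 4)"
    unfolding two_strands_def
  proof (intro conjI allI impI right_box_topology(2) line_s loop_s)
    fix m s assume m: "m < length (L @ [C])" and s: "plane_proj (((L @ [C]) ! m) s) \<in> right_box"
    show "on_strand (i, s0 + 0 / V, s0 + 4 / V) m s \<or> on_strand (length L, -1 / 4, 1 / 4) m s"
    proof (cases "m < length L")
      case True
      then have "plane_proj ((L ! m) s) \<in> right_box" using s by (simp add: nth_append)
      note o = line_over[OF right_box_topology(1) True this]
      then have "plane_proj (line (w s)) \<in> right_box" using s True by (simp add: nth_append)
      then have "0 \<le> w s" "w s \<le> 4" by (simp_all add: plane_proj_right_box line_def)
      from on_strand_arc[OF this] show ?thesis using o(1) by simp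
    next
      case False
      then have mk: "m = length L" using m by simp
      then have c: "cos (2 * pi * s) \<ge> 0" using s by (simp add: plane_proj_right_box C)
      \<comment> \<open>Moves the time to [-1/2, 1/2], where a nonnegative cosine means a time of at
        most 1/4 in absolute value.\<close>
      define n where "n = - round s"
      define s' where "s' = s + of_int n"
      have "\<bar>s'\<bar> \<le> 1 / 2" using of_int_round_abs_le[of s] by (simp add: s'_def n_def abs_minus_commute)
      then have "\<bar>2 * pi * s'\<bar> \<le> pi" by (simp add: abs_mult)
      moreover have "2 * pi * s' = 2 * pi * s + 2 * pi * n" by (simp add: s'_def algebra_simps)
      then have "sin (2 * pi * s') = sin (2 * pi * s) \<and> cos (2 * pi * s') = cos (2 * pi * s)"
        by (intro sin_cos_eq_iff[THEN iffD2] exI[of _ n])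
      then have "cos \<bar>2 * pi * s'\<bar> \<ge> 0" using c by simp
      ultimately have "\<not> pi / 2 < \<bar>2 * pi * s'\<bar>"
        using cos_monotone_0_pi[of "pi / 2" "\<bar>2 * pi * s'\<bar>"] by auto
      then have "\<bar>s'\<bar> \<le> 1 / 4" by (simp add: abs_mult)
      then have "s' \<in> {-1 / 4..1 / 4}" by (auto simp only: abs_le_iff atLeastAtMost_iff)
      then have "s + of_int n \<in> {-1 / 4..1 / 4}" by (simp only: s'_def)
      then show ?thesis unfolding on_strand_def case_prod_conv mk by blast
    qed
  qed
  have "\<exists>s\<in>{s0 + 0 / V<..<s0 + 4 / V}. \<exists>t\<in>{-1 / 4<..<1 / 4}.
      (\<forall>s'\<in>{s0 + 0 / V..s0 + 4 / V}. \<forall>t'\<in>{-1 / 4..1 / 4}.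
        plane_proj ((L ! i) s') = plane_proj (C t') \<longleftrightarrow> s' = s \<and> t' = t) \<and>
      det2 (plane_proj (vel (L @ [C]) (i, s))) (plane_proj (vel (L @ [C]) (length L, t))) \<noteq> 0 \<and>
      crossing_sign (L @ [C]) (i, s) (length L, t) = sgn (- (C 0 $ 3))"
  proof (rule bexI[of _ "s0 + 1 / V"], rule bexI[of _ "0 :: real"], intro conjI ballI)
    fix s' t' :: real assume s': "s' \<in> {s0 + 0 / V..s0 + 4 / V}" and t': "t' \<in> {-1 / 4..1 / 4}"
    have Ls: "(L ! i) s' = line (V * (s' - s0))"
      using param_eqs[of 0 4 s'] s' on_line(1)[of s'] by simp
    show "plane_proj ((L ! i) s') = plane_proj (C t') \<longleftrightarrow> s' = s0 + 1 / V \<and> t' = 0"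
    proof
      assume "plane_proj ((L ! i) s') = plane_proj (C t')"
      then have h: "V * (s' - s0) = cos (2 * pi * t')" "sin (2 * pi * t') = 0"
        unfolding Ls by (simp_all add: plane_proj_def line_def C)
      have eq: "sin (2 * pi * t') = sin 0" using h by simp
      have "2 * pi * t' = 0" by (rule sin_inj_pi[OF _ _ _ _ eq]) (use angle[OF t'] in auto)
      then have t0: "t' = 0" by simp
      then have "V * (s' - s0) = 1" using h by simp
      then have "s' = s0 + 1 / V" using V0 by (simp add: field_simps)
      then show "s' = s0 + 1 / V \<and> t' = 0" using t0 by simp
    next
      assume "s' = s0 + 1 / V \<and> t' = 0"
      then show "plane_proj ((L ! i) s') = plane_proj (C t')"
        using V0 unfolding Ls by (simp add: plane_proj_def line_def C)
    qed
  next
    have v: "vel (L @ [C]) (i, s0 + 1 / V) = V *\<^sub>R vec3 1 0 0" "vel (L @ [C]) (length L, 0) = velocity C 0"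
      and p: "pt (L @ [C]) (i, s0 + 1 / V) = line 1" "pt (L @ [C]) (length L, 0) = C 0"
      using line_values[of 1] by (simp_all add: vel_def pt_def Ci)
    have d: "det2 (plane_proj (vel (L @ [C]) (i, s0 + 1 / V))) (plane_proj (vel (L @ [C]) (length L, 0))) = V * (2 * pi)"
      unfolding v by (simp add: det2_def plane_proj_def C)
    then show "det2 (plane_proj (vel (L @ [C]) (i, s0 + 1 / V))) (plane_proj (vel (L @ [C]) (length L, 0))) \<noteq> 0"
      using V0 by simp
    show "crossing_sign (L @ [C]) (i, s0 + 1 / V) (length L, 0) = sgn (- (C 0 $ 3))"
      unfolding crossing_sign_def d p using V0 by (simp add: sgn_mult line_def)
  qed (use V0 in \<open>simp_all add: divide_strict_right_mono\<close>)
  then show ?thesis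
    unfolding single_crossing_def case_prod_conv Ci by (rule conjI[OF two])
qed

text \<open>The pieces [0, 1] and [3, 4] of the detour turn from the strand into the circle and from
  the circle back into the strand. Both belong to component \<open>i\<close>, as smoothing a
  crossing of two components fuses them.\<close>

lemma detour_smoothing:
  "smoothing right_box (i, s0 + 0 / V, s0 + 4 / V) (length L, -1 / 4, 1 / 4) (L @ [tilted_circle]) (graft detour)"
proof -
  have "proper_strand right_box (graft detour) (i, s0 + 0 / V, s0 + 1 / V)"
  proof (rule proper_strand_arc[where G = detour])
    show "(graft detour ! i) s = detour (w s)" if "\<bar>w s\<bar> \<le> 5" for s
      using that i by (simp add: nth_graft gcurve_eq[OF arc_detour])
    show "inj_on (\<lambda>\<tau>. plane_proj (detour \<tau>)) {0..1}"
    proof (rule inj_onI)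
      fix a b :: real assume ab: "a \<in> {0..1}" "b \<in> {0..1}" "plane_proj (detour a) = plane_proj (detour b)"
      have eq: "a - a\<^sup>2 = b - b\<^sup>2" "3 * a\<^sup>2 - 2 * a ^ 3 = 3 * b\<^sup>2 - 2 * b ^ 3"
        using ab by (simp_all add: plane_proj_def detour_eqs detour_in_def)
      have "(b - a) * (1 - (a + b)) = 0" using eq(1) by algebra
      then have "a = b \<or> b = 1 - a" by auto
      then show "a = b"
      proof
        assume b: "b = 1 - a"
        \<comment> \<open>Replacing a by 1 - a turns the smoothstep into 1 minus itself, so its
          value here is 1/2. The quadratic factor has no root in the unit interval.\<close>
        have "(2 * a - 1) * (2 * a\<^sup>2 - 2 * a - 1) = 0" using eq(2) unfolding b by algebra
        moreover have "2 * a\<^sup>2 - 2 * a - 1 < 0"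
        proof -
          have "a\<^sup>2 \<le> a" using ab by (auto simp: power2_eq_square intro: mult_left_le)
          then show ?thesis by linarith
        qed
        ultimately have "2 * a - 1 = 0" by simp
        then show ?thesis using b by linarith
      qed
    qed
    show "plane_proj (detour \<tau>) \<in> interior right_box" if "0 < \<tau>" "\<tau> < 1" for \<tau>
      using that detour_in_bounds[of \<tau>] by (simp add: right_box_topology detour_eqs)
    show "plane_proj (detour 0) \<in> frontier right_box" "plane_proj (detour 1) \<in> frontier right_box"
      by (simp_all add: right_box_topology plane_proj_right_box detour_eqs(2) detour_in_def)
  qed (use i in simp_all)
  moreover have "proper_strand right_box (graft detour) (i, s0 + 3 / V, s0 + 4 / V)"
  proof (rule proper_strand_arc[where G = detour])
    show "(graft detour ! i) s = detour (w s)" if "\<bar>w s\<bar> \<le> 5" for s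
      using that i by (simp add: nth_graft gcurve_eq[OF arc_detour])
    show "inj_on (\<lambda>\<tau>. plane_proj (detour \<tau>)) {3..4}"
    proof (rule inj_onI)
      fix a b :: real assume ab: "a \<in> {3..4}" "b \<in> {3..4}" "plane_proj (detour a) = plane_proj (detour b)"
      \<comment> \<open>x - 3y eliminates the smoothstep and leaves an affine function of the
        parameter.\<close>
      have h: "(t + 9 * t\<^sup>2 - 6 * t ^ 3) - 3 * (3 * t\<^sup>2 - 2 * t ^ 3 - 1) = t + 3" for t :: real
        by (simp add: algebra_simps)
      have e: "detour_out x $ 1 - 3 * detour_out x $ 2 = (x - 3) + 3" for x
        unfolding detour_out_def vector_3 by (rule h)
      have "detour_out a $ 1 = detour_out b $ 1" "detour_out a $ 2 = detour_out b $ 2"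
        using ab by (simp_all add: plane_proj_def detour_eqs)
      then show "a = b" using e[of a] e[of b] by linarith
    qed
    show "plane_proj (detour \<tau>) \<in> interior right_box" if "3 < \<tau>" "\<tau> < 4" for \<tau>
      using that detour_out_bounds[of \<tau>] by (simp add: right_box_topology detour_eqs)
    show "plane_proj (detour 3) \<in> frontier right_box" "plane_proj (detour 4) \<in> frontier right_box"
      by (simp_all add: right_box_topology plane_proj_right_box detour_eqs(4) detour_out_def)
  qed (use i in simp_all)
  moreover have "on_strand (i, s0 + 0 / V, s0 + 1 / V) m s \<or> on_strand (i, s0 + 3 / V, s0 + 4 / V) m s"
    if m: "m < length (graft detour)" and s: "plane_proj ((graft detour ! m) s) \<in> right_box" for m s
  proof -
    have o: "m = i" "\<bar>w s\<bar> \<le> 5" "(graft detour ! m) s = detour (w s)"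
      using graft_over[OF arc_detour right_box_topology(1) _ s] m by simp_all
    have D: "plane_proj (detour (w s)) \<in> right_box" using o s by simp
    have "0 \<le> w s \<and> w s \<le> 1 \<or> 3 \<le> w s \<and> w s \<le> 4"
      using o(2)
    proof (cases rule: detour_cases)
      case 1 then show ?thesis using D by (simp add: detour_eqs(1) plane_proj_right_box line_def)
    next
      case 3
      show ?thesis
      proof (rule ccontr)
        assume "\<not> ?thesis"
        then have "\<bar>w s - 2\<bar> < 1" using 3 by (simp add: abs_less_iff)
        then have "(w s - 2)\<^sup>2 < 1" by (simp add: abs_square_less_1)
        then have "(1 - (w s - 2)\<^sup>2) / (1 + (w s - 2)\<^sup>2) > 0" by (intro divide_pos_pos) simp_all
        moreover have "detour (w s) = detour_loop (w s)" using 3 by (simp add: detour_eqs(3))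
        ultimately have "detour (w s) $ 1 < 0" by (simp add: detour_loop_def)
        then show False using D unfolding plane_proj_right_box by linarith
      qed
    next
      case 5
      have "detour (w s) = line (w s)" using detour_eqs(5)[OF 5(1)] by simp
      then show ?thesis using D 5 by (simp add: plane_proj_right_box line_def)
    qed auto
    then show ?thesis using on_strand_arc[of 0 s 1] on_strand_arc[of 3 s 4] o(1) by blast
  qed
  ultimately have two: "two_strands right_box (graft detour) (i, s0 + 0 / V, s0 + 1 / V) (i, s0 + 3 / V, s0 + 4 / V)"
    unfolding two_strands_def by (intro conjI right_box_topology(2) allI impI)
  have disj: "plane_proj ((graft detour ! i) s) \<noteq> plane_proj ((graft detour ! i) t)"
    if "s \<in> {s0 + 0 / V..s0 + 1 / V}" "t \<in> {s0 + 3 / V..s0 + 4 / V}" for s t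
  proof
    assume e: "plane_proj ((graft detour ! i) s) = plane_proj ((graft detour ! i) t)"
    define p q where "p = w s" and "q = w t"
    have p: "0 \<le> p" "p \<le> 1" and q: "3 \<le> q" "q \<le> 4"
      using param_eqs[of 0 1 s] param_eqs[of 3 4 t] that by (simp_all add: p_def q_def)
    have "(graft detour ! i) s = detour p" "(graft detour ! i) t = detour q"
      using p q i by (simp_all add: nth_graft gcurve_eq[OF arc_detour] p_def q_def)
    then have "plane_proj (detour_in p) = plane_proj (detour_out q)"
      using e p q by (simp add: detour_eqs)
    then have xy: "detour_in p $ 1 = detour_out q $ 1" "detour_in p $ 2 = detour_out q $ 2"
      by (simp_all add: plane_proj_def)
    \<comment> \<open>The outgoing piece has a negative second coordinate until its end (4, 0); the
      ingoing piece has a nonnegative second and a first coordinate of at most 1.\<close>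
    show False
    proof (cases "q < 4")
      case True then show ?thesis
        using detour_out_bounds(7)[OF q True] detour_in_bounds(3)[OF p] xy by linarith
    next
      case False
      then have "q = 4" using q by simp
      then have "detour_out q $ 1 = 4" by (simp add: detour_out_def)
      then show ?thesis using detour_in_bounds(2)[OF p] xy by linarith
    qed
  qed
  have ends: "(graft detour ! i) (s0 + 0 / V) = (L ! i) (s0 + 0 / V)"
    "(graft detour ! i) (s0 + 1 / V) = tilted_circle (1 / 4)"
    "(graft detour ! i) (s0 + 3 / V) = tilted_circle (-1 / 4)"
    "(graft detour ! i) (s0 + 4 / V) = (L ! i) (s0 + 4 / V)"
  proof -
    have q: "2 * pi * (- 1 / 4) = - (pi / 2)" "2 * pi * (1 / 4) = pi / 2" by simp_all
    show "(graft detour ! i) (s0 + 0 / V) = (L ! i) (s0 + 0 / V)"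
      using arc_values(1)[OF arc_detour, of 0] line_values(1)[of 0] by (simp add: detour_eqs(1))
    show "(graft detour ! i) (s0 + 1 / V) = tilted_circle (1 / 4)"
      using arc_values(1)[OF arc_detour, of 1]
      by (simp add: detour_eqs(2) detour_in_def tilted_circle_def q)
    show "(graft detour ! i) (s0 + 3 / V) = tilted_circle (-1 / 4)"
      using arc_values(1)[OF arc_detour, of 3]
      unfolding tilted_circle_def q by (simp add: detour_eqs(4) detour_out_def)
    show "(graft detour ! i) (s0 + 4 / V) = (L ! i) (s0 + 4 / V)"
      using arc_values(1)[OF arc_detour, of 4] line_values(1)[of 4] by (simp add: detour_eqs(5))
  qed
  have Mi: "(L @ [tilted_circle]) ! i = L ! i" "(L @ [tilted_circle]) ! length L = tilted_circle"
    using i by (simp_all add: nth_append)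
  have "\<exists>i0 a0 b0 j0 c0 d0.
        two_strands right_box (graft detour) (i0, a0, b0) (j0, c0, d0) \<and>
        (\<forall>s\<in>{a0..b0}. \<forall>t\<in>{c0..d0}. plane_proj ((graft detour ! i0) s) \<noteq> plane_proj ((graft detour ! j0) t)) \<and>
        (graft detour ! i0) a0 = (L ! i) (s0 + 0 / V) \<and> (graft detour ! i0) b0 = tilted_circle (1 / 4) \<and>
        (graft detour ! j0) c0 = tilted_circle (-1 / 4) \<and> (graft detour ! j0) d0 = (L ! i) (s0 + 4 / V)"
    by (rule exI[of _ i], rule exI[of _ "s0 + 0 / V"], rule exI[of _ "s0 + 1 / V"], rule exI[of _ i],
        rule exI[of _ "s0 + 3 / V"], rule exI[of _ "s0 + 4 / V"])
      (intro conjI ballI two ends; rule disj; assumption)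
  then show ?thesis
    unfolding smoothing_def case_prod_conv Mi
    by (rule conjI[OF outer_points[OF detour_splits C1_tilted_circle]])
qed

lemma skein_triple_singular:
  "skein_triple right_box i (length L) 0 1 (L @ [tilted_circle]) (L @ [lowered_circle]) (graft detour)"
proof -
  have 0: "sgn (- (tilted_circle 0 $ 3)) = 0" by (simp add: tilted_circle_def)
  have 1: "sgn (- (lowered_circle 0 $ 3)) = 1" by (simp add: lowered_circle_def)
  have "single_crossing right_box (i, s0 + 0 / V, s0 + 4 / V) (length L, -1 / 4, 1 / 4)
      (sgn (- (tilted_circle 0 $ 3))) (L @ [tilted_circle])"
  proof (rule singular_crossing)
    show "velocity tilted_circle 0 $ 1 = 0" "velocity tilted_circle 0 $ 2 = 2 * pi"
      unfolding C1_velocity[OF C1_tilted_circle] by (simp_all add: tilted_circle'_def)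
  qed (simp_all add: tilted_circle_def)
  moreover have "single_crossing right_box (i, s0 + 0 / V, s0 + 4 / V) (length L, -1 / 4, 1 / 4)
      (sgn (- (lowered_circle 0 $ 3))) (L @ [lowered_circle])"
  proof (rule singular_crossing)
    show "velocity lowered_circle 0 $ 1 = 0" "velocity lowered_circle 0 $ 2 = 2 * pi"
      unfolding C1_velocity[OF C1_lowered_circle] by (simp_all add: lowered_circle'_def)
  qed (simp_all add: lowered_circle_def)
  moreover have "same_diagram_outside right_box (L @ [tilted_circle]) (L @ [lowered_circle])"
    unfolding same_diagram_outside_def
  proof (intro conjI allI impI)
    fix m s assume m: "m < length (L @ [tilted_circle])"
    show "plane_proj (((L @ [tilted_circle]) ! m) s) = plane_proj (((L @ [lowered_circle]) ! m) s)"
      using m by (cases "m < length L")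
        (auto simp: nth_append less_Suc_eq plane_proj_def tilted_circle_def lowered_circle_def)
    assume D: "plane_proj (((L @ [tilted_circle]) ! m) s) \<notin> right_box"
    show "((L @ [tilted_circle]) ! m) s = ((L @ [lowered_circle]) ! m) s"
    proof (cases "m < length L")
      case True then show ?thesis by (simp add: nth_append)
    next
      case False
      define x where "x = 2 * pi * s"
      have mk: "m = length L" using False m by simp
      then have D': "plane_proj (tilted_circle s) \<notin> right_box" using D by simp
      have bx: "\<bar>cos x\<bar> \<le> 1" "\<bar>sin x\<bar> \<le> 1" by (rule abs_cos_le_one, rule abs_sin_le_one)
      have "plane_proj (tilted_circle s) \<in> right_box" if "0 \<le> cos x"
        unfolding plane_proj_right_box tilted_circle_def x_def[symmetric] vector_3
        using bx that by (intro conjI; linarith)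
      then have "cos x < 0" using D' by force
      then show ?thesis using mk by (simp add: tilted_circle_def lowered_circle_def x_def[symmetric])
    qed
  qed simp
  ultimately show ?thesis
    unfolding skein_triple_def 0 1 using detour_smoothing by blast
qed

end

section \<open>The skein triple at the node of the curl\<close>

lemma curl_plane: "curl \<sigma> \<tau> $ 1 = curl \<rho> \<tau> $ 1" "curl \<sigma> \<tau> $ 2 = curl \<rho> \<tau> $ 2"
  by (simp_all add: curl_def curl_end_def)

text \<open>On the last piece the first coordinate runs from -1 to 5 with positive derivative
  inside; its unique zero is the later parameter of the node.\<close>

lemma curl_zero:
  obtains \<tau>0 where "1 < \<tau>0" "\<tau>0 < 5" "curl \<sigma> \<tau>0 $ 1 = 0"
    "\<And>\<tau>. 1 < \<tau> \<Longrightarrow> \<tau> < 5 \<Longrightarrow> curl \<sigma> \<tau> $ 1 = 0 \<Longrightarrow> \<tau> = \<tau>0"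
proof -
  let ?f = "\<lambda>\<tau>. curl \<sigma> \<tau> $ 1"
  have d: "(?f has_real_derivative curl' \<sigma> \<tau> $ 1) (at \<tau>)" for \<tau>
    by (rule has_real_derivative_vec_nth[OF C1_D[OF C1_curl]])
  have cont: "continuous_on S ?f" for S
    using d by (meson DERIV_isCont continuous_at_imp_continuous_on)
  have mono: "?f a < ?f b" if ab: "1 < a" "a < b" "b < 5" for a b
  proof (rule DERIV_pos_imp_increasing_open[OF ab(2) _ cont])
    fix x assume x: "a < x" "x < b"
    then have "curl' \<sigma> x $ 1 > 0"
      using curl_end_bounds(8)[of x \<sigma>] curl_eqs(4)[of x \<sigma>] ab by simp
    then show "\<exists>y. (?f has_real_derivative y) (at x) \<and> y > 0" using d by blast
  qed
  have f1: "?f 1 = - 1" by (simp add: curl_eqs(3) curl_loop_def)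
  have f5: "?f 5 = 5" using curl_eqs(5)[of 5 \<sigma>] by (simp add: line_def)
  obtain \<tau>0 where t: "1 \<le> \<tau>0" "\<tau>0 \<le> 5" "?f \<tau>0 = 0"
    using IVT'[of ?f 1 0 5, OF _ _ _ cont] f1 f5 by auto
  have "\<tau>0 \<noteq> 1" "\<tau>0 \<noteq> 5" using t(3) f1 f5 by auto
  then have b: "1 < \<tau>0" "\<tau>0 < 5" using t by auto
  have "\<tau> = \<tau>0" if "1 < \<tau>" "\<tau> < 5" "?f \<tau> = 0" for \<tau>
    using mono[of \<tau> \<tau>0] mono[of \<tau>0 \<tau>] that t(3) b by (cases \<tau> \<tau>0 rule: linorder_cases) simp_all
  then show thesis using that b t(3) by blast
qed

lemma lower_box_topology:
  "lower_box \<subseteq> square" "disc lower_box"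
  "plane_proj v \<in> interior lower_box \<longleftrightarrow> -5 < v $ 1 \<and> v $ 1 < 5 \<and> -1 < v $ 2 \<and> v $ 2 < 2"
  "plane_proj v \<in> frontier lower_box \<longleftrightarrow> plane_proj v \<in> lower_box \<and>
    \<not> (-5 < v $ 1 \<and> v $ 1 < 5 \<and> -1 < v $ 2 \<and> v $ 2 < 2)"
  using box_topology[of "-5" 5 "-1" 2]
  by (auto simp: lower_box_def square_def plane_proj_def)

lemma curl_over_lower_box:
  assumes "\<bar>\<tau>\<bar> \<le> 5" "plane_proj (curl \<sigma> \<tau>) \<in> lower_box"
  shows "\<tau> \<in> {-5..-1} \<or> \<tau> \<in> {1..5}"
proof (rule ccontr)
  assume n: "\<not> ?thesis"
  then have r: "-1 < \<tau>" "\<tau> < 1" using assms(1) by auto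
  then have "\<tau>\<^sup>2 < 1" by (simp add: abs_square_less_1 abs_less_iff)
  then have "(1 - \<tau>\<^sup>2) / (1 + \<tau>\<^sup>2) > 0" by (intro divide_pos_pos) simp_all
  moreover have "curl \<sigma> \<tau> $ 2 = 2 + (1 - \<tau>\<^sup>2) / (1 + \<tau>\<^sup>2)"
    using curl_eqs(3)[of \<tau> \<sigma>] r by (simp add: curl_loop_def)
  ultimately show False using assms(2) unfolding plane_proj_lower_box by linarith
qed

lemma inj_on_curl_end: "inj_on (\<lambda>\<tau>. plane_proj (curl \<sigma> \<tau>)) {1..5}"
proof (rule inj_onI)
  fix a b assume ab: "a \<in> {1..5}" "b \<in> {1..5::real}" "plane_proj (curl \<sigma> a) = plane_proj (curl \<sigma> b)"
  then have "curl \<sigma> a $ 2 = curl \<sigma> b $ 2" by (simp add: plane_proj_def)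
  then show "a = b"
    using curl_decreasing[of a b \<sigma>] curl_decreasing[of b a \<sigma>] ab(1,2)
    by (cases a b rule: linorder_cases) auto
qed

lemma inj_on_curl_start: "inj_on (\<lambda>\<tau>. plane_proj (curl \<sigma> \<tau>)) {-5..-1}"
proof (rule inj_onI)
  fix a b assume ab: "a \<in> {-5..-1}" "b \<in> {-5..-1::real}" "plane_proj (curl \<sigma> a) = plane_proj (curl \<sigma> b)"
  have "\<bar>a\<bar> \<le> 5" "\<bar>b\<bar> \<le> 5" using ab(1,2) by auto
  then have "plane_proj (curl \<sigma> (- a)) = plane_proj (curl \<sigma> (- b))"
    using ab(3) curl_symmetric(1,2)[of a \<sigma>] curl_symmetric(1,2)[of b \<sigma>] by (simp add: plane_proj_def)
  then have "- a = - b" by (rule inj_onD[OF inj_on_curl_end]) (use ab in auto)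
  then show "a = b" by simp
qed

context straight_strand
begin

lemma graft_eq: "arc G G' \<Longrightarrow> \<bar>w s\<bar> \<le> 5 \<Longrightarrow> (graft G ! i) s = G (w s)"
  using i by (simp add: nth_graft gcurve_eq)

text \<open>By symmetry the velocities at the node project to \<open>V\<close> times (X', -Y') and
  (X', Y') with X' > 0 > Y', so the determinant is negative. The first passage has height 0 and the
  height of the second one has the sign \<sigma>; together this gives the sign \<sigma>.\<close>

lemma curl_crossing:
  assumes \<sigma>: "\<sigma> = 1 \<or> \<sigma> = -1"
  shows "single_crossing lower_box (i, s0 + (-5) / V, s0 + (-1) / V) (i, s0 + 1 / V, s0 + 5 / V)
    \<sigma> (graft (curl \<sigma>))"
proof -
  have V0: "V > 0" using V by simp
  have \<sigma>2: "\<sigma>\<^sup>2 = 1" using \<sigma> by auto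
  note a = arc_curl[of \<sigma>]
  have s1: "proper_strand lower_box (graft (curl \<sigma>)) (i, s0 + (-5) / V, s0 + (-1) / V)"
  proof (rule proper_strand_arc[where G = "curl \<sigma>"])
    show "(graft (curl \<sigma>) ! i) s = curl \<sigma> (w s)" if "\<bar>w s\<bar> \<le> 5" for s by (rule graft_eq[OF a that])
    show "inj_on (\<lambda>\<tau>. plane_proj (curl \<sigma> \<tau>)) {-5..-1}" by (rule inj_on_curl_start)
    show "plane_proj (curl \<sigma> \<tau>) \<in> interior lower_box" if t: "-5 < \<tau>" "\<tau> < -1" for \<tau>
    proof -
      have e: "curl \<sigma> \<tau> = curl_start \<tau>" using curl_eqs(2)[of \<tau> \<sigma>] t by simp
      show ?thesis
        using t curl_start_bounds[of \<tau>] unfolding lower_box_topology e by auto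
    qed
    have "curl \<sigma> (-5) = vec3 (-5) 0 0" using curl_eqs(1)[of "-5" \<sigma>] by (simp add: line_def)
    then show "plane_proj (curl \<sigma> (-5)) \<in> frontier lower_box"
      by (simp add: lower_box_topology plane_proj_lower_box)
    have "curl \<sigma> (-1) = vec3 1 2 0" using curl_eqs(3)[of "-1" \<sigma>] by (simp add: curl_loop_def)
    then show "plane_proj (curl \<sigma> (-1)) \<in> frontier lower_box"
      by (simp add: lower_box_topology plane_proj_lower_box)
  qed (use i in simp_all)
  have s2: "proper_strand lower_box (graft (curl \<sigma>)) (i, s0 + 1 / V, s0 + 5 / V)"
  proof (rule proper_strand_arc[where G = "curl \<sigma>"])
    show "(graft (curl \<sigma>) ! i) s = curl \<sigma> (w s)" if "\<bar>w s\<bar> \<le> 5" for s by (rule graft_eq[OF a that])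
    show "inj_on (\<lambda>\<tau>. plane_proj (curl \<sigma> \<tau>)) {1..5}" by (rule inj_on_curl_end)
    show "plane_proj (curl \<sigma> \<tau>) \<in> interior lower_box" if t: "1 < \<tau>" "\<tau> < 5" for \<tau>
    proof -
      have e: "curl \<sigma> \<tau> = curl_end \<sigma> \<tau>" using curl_eqs(4)[of \<tau> \<sigma>] t by simp
      show ?thesis
        using t curl_end_bounds[of \<tau> \<sigma>] unfolding lower_box_topology e by auto
    qed
    have "curl \<sigma> 5 = vec3 5 0 0" using curl_eqs(5)[of "5" \<sigma>] by (simp add: line_def)
    then show "plane_proj (curl \<sigma> 5) \<in> frontier lower_box"
      by (simp add: lower_box_topology plane_proj_lower_box)
    have "curl \<sigma> 1 = vec3 (-1) 2 0" using curl_eqs(3)[of "1" \<sigma>] by (simp add: curl_loop_def)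
    then show "plane_proj (curl \<sigma> 1) \<in> frontier lower_box"
      by (simp add: lower_box_topology plane_proj_lower_box)
  qed (use i in simp_all)
  have cover: "on_strand (i, s0 + (-5) / V, s0 + (-1) / V) m s \<or> on_strand (i, s0 + 1 / V, s0 + 5 / V) m s"
    if m: "m < length (graft (curl \<sigma>))" and s: "plane_proj ((graft (curl \<sigma>) ! m) s) \<in> lower_box" for m s
  proof -
    have m': "m < length L" using m by simp
    note o = graft_over[OF a lower_box_topology(1) m' s]
    have "plane_proj (curl \<sigma> (w s)) \<in> lower_box" using s o(3) by simp
    then have "w s \<in> {-5..-1} \<or> w s \<in> {1..5}" by (rule curl_over_lower_box[OF o(2)])
    then show ?thesis
    proof
      assume "w s \<in> {-5..-1}"
      then have "-5 \<le> w s" "w s \<le> -1" by auto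
      from on_strand_arc[OF this] show ?thesis using o(1) by simp
    next
      assume "w s \<in> {1..5}"
      then have "1 \<le> w s" "w s \<le> 5" by auto
      from on_strand_arc[OF this] show ?thesis using o(1) by simp
    qed
  qed
  have two: "two_strands lower_box (graft (curl \<sigma>)) (i, s0 + (-5) / V, s0 + (-1) / V) (i, s0 + 1 / V, s0 + 5 / V)"
    unfolding two_strands_def by (intro conjI allI impI lower_box_topology(2) s1 s2 cover)
  obtain \<tau>0 where \<tau>0: "1 < \<tau>0" "\<tau>0 < 5" "curl \<sigma> \<tau>0 $ 1 = 0"
    and uniq: "\<And>\<tau>. 1 < \<tau> \<Longrightarrow> \<tau> < 5 \<Longrightarrow> curl \<sigma> \<tau> $ 1 = 0 \<Longrightarrow> \<tau> = \<tau>0"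
    by (rule curl_zero[of \<sigma>]) blast
  have b0: "\<bar>\<tau>0\<bar> \<le> 5" "\<bar>- \<tau>0\<bar> \<le> 5" using \<tau>0 by auto
  note sym = curl_symmetric[OF b0(1), of \<sigma>]
  note v1 = arc_values[OF a b0(2)] and v2 = arc_values[OF a b0(1)]
  have "\<exists>s\<in>{s0 + (-5) / V<..<s0 + (-1) / V}. \<exists>t\<in>{s0 + 1 / V<..<s0 + 5 / V}.
      (\<forall>s'\<in>{s0 + (-5) / V..s0 + (-1) / V}. \<forall>t'\<in>{s0 + 1 / V..s0 + 5 / V}.
        plane_proj ((graft (curl \<sigma>) ! i) s') = plane_proj ((graft (curl \<sigma>) ! i) t') \<longleftrightarrow> s' = s \<and> t' = t) \<and>
      det2 (plane_proj (vel (graft (curl \<sigma>)) (i, s))) (plane_proj (vel (graft (curl \<sigma>)) (i, t))) \<noteq> 0 \<and>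
      crossing_sign (graft (curl \<sigma>)) (i, s) (i, t) = \<sigma>"
  proof (rule bexI[of _ "s0 + (- \<tau>0) / V"], rule bexI[of _ "s0 + \<tau>0 / V"], intro conjI ballI)
    show "s0 + (- \<tau>0) / V \<in> {s0 + (-5) / V<..<s0 + (-1) / V}" "s0 + \<tau>0 / V \<in> {s0 + 1 / V<..<s0 + 5 / V}"
      using \<tau>0 V0 by (auto simp: divide_strict_right_mono simp del: divide_minus_left)
  next
    fix s' t' assume s': "s' \<in> {s0 + (-5) / V..s0 + (-1) / V}" and t': "t' \<in> {s0 + 1 / V..s0 + 5 / V}"
    have p: "w s' = V * (s' - s0)" "V * (s' - s0) \<in> {-5..-1}" "\<bar>w s'\<bar> \<le> 5"
      by (rule param_eqs[OF _ _ s']; simp)+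
    have q: "w t' = V * (t' - s0)" "V * (t' - s0) \<in> {1..5}" "\<bar>w t'\<bar> \<le> 5"
      by (rule param_eqs[OF _ _ t']; simp)+
    show "plane_proj ((graft (curl \<sigma>) ! i) s') = plane_proj ((graft (curl \<sigma>) ! i) t') \<longleftrightarrow>
        s' = s0 + (- \<tau>0) / V \<and> t' = s0 + \<tau>0 / V"
    proof
      assume "plane_proj ((graft (curl \<sigma>) ! i) s') = plane_proj ((graft (curl \<sigma>) ! i) t')"
      then have eq: "curl \<sigma> (w s') $ 1 = curl \<sigma> (w t') $ 1" "curl \<sigma> (w s') $ 2 = curl \<sigma> (w t') $ 2"
        by (simp_all add: graft_eq[OF a p(3)] graft_eq[OF a q(3)] plane_proj_def)
      have "w s' < w t'" using p q by auto
      note n = curl_node[OF p(3) q(3) this eq]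
      have "w t' = \<tau>0" using uniq[OF n(2,3,4)] .
      then have "V * (t' - s0) = \<tau>0" "V * (s' - s0) = - \<tau>0" using n(1) p(1) q(1) by simp_all
      then show "s' = s0 + (- \<tau>0) / V \<and> t' = s0 + \<tau>0 / V" using V0 by (auto simp: field_simps)
    next
      assume "s' = s0 + (- \<tau>0) / V \<and> t' = s0 + \<tau>0 / V"
      then have "(graft (curl \<sigma>) ! i) s' = curl \<sigma> (- \<tau>0)" "(graft (curl \<sigma>) ! i) t' = curl \<sigma> \<tau>0"
        using v1(1) v2(1) by simp_all
      then show "plane_proj ((graft (curl \<sigma>) ! i) s') = plane_proj ((graft (curl \<sigma>) ! i) t')"
        using sym(1,2) \<tau>0(3) by (simp add: plane_proj_def)
    qed
  next
    define X' Y' where "X' = curl' \<sigma> \<tau>0 $ 1" and "Y' = curl' \<sigma> \<tau>0 $ 2"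
    have XY: "X' > 0" "Y' < 0"
      using curl_end_bounds(8,9)[of \<tau>0 \<sigma>] \<tau>0 curl_eqs(4)[of \<tau>0 \<sigma>] by (simp_all add: X'_def Y'_def)
    have vel: "vel (graft (curl \<sigma>)) (i, s0 + (- \<tau>0) / V) = V *\<^sub>R curl' \<sigma> (- \<tau>0)"
      "vel (graft (curl \<sigma>)) (i, s0 + \<tau>0 / V) = V *\<^sub>R curl' \<sigma> \<tau>0"
      unfolding vel_def using v1(2) v2(2) by simp_all
    have pt: "pt (graft (curl \<sigma>)) (i, s0 + (- \<tau>0) / V) = curl \<sigma> (- \<tau>0)"
      "pt (graft (curl \<sigma>)) (i, s0 + \<tau>0 / V) = curl \<sigma> \<tau>0"
      unfolding pt_def using v1(1) v2(1) by simp_all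
    define d where "d = det2 (plane_proj (vel (graft (curl \<sigma>)) (i, s0 + (- \<tau>0) / V)))
      (plane_proj (vel (graft (curl \<sigma>)) (i, s0 + \<tau>0 / V)))"
    have "d = 2 * V * V * (X' * Y')"
      unfolding d_def vel by (simp add: det2_def plane_proj_def sym(3,4) X'_def Y'_def)
    moreover have "2 * V * V * (X' * Y') < 0"
      using XY V0 by (intro mult_pos_neg) (simp_all add: mult_pos_neg)
    ultimately have d: "d < 0" by simp
    then show "det2 (plane_proj (vel (graft (curl \<sigma>)) (i, s0 + (- \<tau>0) / V)))
      (plane_proj (vel (graft (curl \<sigma>)) (i, s0 + \<tau>0 / V))) \<noteq> 0" by (simp add: d_def)
    have z: "curl \<sigma> (- \<tau>0) $ 3 = 0" "\<sigma> * curl \<sigma> \<tau>0 $ 3 > 0"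
      using curl_height(1)[OF b0(2), of \<sigma>] curl_height(2)[OF \<tau>0(1,2) \<sigma>2] \<tau>0 by simp_all
    show "crossing_sign (graft (curl \<sigma>)) (i, s0 + (- \<tau>0) / V) (i, s0 + \<tau>0 / V) = \<sigma>"
      unfolding crossing_sign_def d_def[symmetric] pt z(1)
      using d z(2) \<sigma> by (auto simp: sgn_mult)
  qed
  then show ?thesis
    unfolding single_crossing_def case_prod_conv by (rule conjI[OF two])
qed

lemma same_diagram_curls: "same_diagram_outside lower_box (graft (curl 1)) (graft (curl (-1)))"
  unfolding same_diagram_outside_def
proof (intro conjI allI impI)
  fix m s assume "m < length (graft (curl 1))"
  then have m: "m < length L" by simp
  show "plane_proj ((graft (curl 1) ! m) s) = plane_proj ((graft (curl (-1)) ! m) s)"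
    using m curl_plane[of 1 "w s" "-1"]
    by (simp add: nth_graft gcurve_eq[OF arc_curl] plane_proj_def)
  assume D: "plane_proj ((graft (curl 1) ! m) s) \<notin> lower_box"
  show "(graft (curl 1) ! m) s = (graft (curl (-1)) ! m) s"
  proof (cases "m = i \<and> \<bar>w s\<bar> \<le> 5")
    case False
    then show ?thesis using m by (auto simp: nth_graft gcurve_eq[OF arc_curl])
  next
    case True
    then have D': "plane_proj (curl 1 (w s)) \<notin> lower_box" using D graft_eq[OF arc_curl] by simp
    have "curl 1 (w s) = curl (-1) (w s)"
      using True[THEN conjunct2]
    proof (cases rule: curl_cases)
      case 3
      then show ?thesis
        using D' curl_end_bounds[OF 3, of 1] by (simp add: curl_eqs(4) plane_proj_lower_box)
    qed (simp_all add: curl_eqs)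
    then show ?thesis using True graft_eq[OF arc_curl] by simp
  qed
qed simp

text \<open>The incoming end at -5 is joined to the outgoing end at 5 by the straight segment; the
  ends at (-1, 2) and (1, 2) are joined by the lower half of the circle, traversed at times from 1/2
  to 1.\<close>

lemma curl_smoothing:
  "smoothing lower_box (i, s0 + (-5) / V, s0 + (-1) / V) (i, s0 + 1 / V, s0 + 5 / V)
    (graft (curl \<sigma>)) (L @ [flat_circle])"
proof -
  let ?U = "L @ [flat_circle]"
  have V0: "V > 0" using V by simp
  have Ui: "?U ! i = L ! i" "?U ! length L = flat_circle" using i by (simp_all add: nth_append)
  have line_s: "proper_strand lower_box ?U (i, s0 + (-5) / V, s0 + 5 / V)"
  proof (rule proper_strand_arc[where G = line])
    show "(?U ! i) s = line (w s)" if "\<bar>w s\<bar> \<le> 5" for s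
      using on_line(1)[of s] that Ui by simp
    show "inj_on (\<lambda>\<tau>. plane_proj (line \<tau>)) {-5..5}" by (auto simp: inj_on_def plane_proj_def line_def)
  qed (use i in \<open>auto simp: lower_box_topology plane_proj_lower_box line_def\<close>)
  \<comment> \<open>A shift by half a turn moves the lower half circle to angles in [0, pi], where
    injectivity of the cosine and positivity of the sine apply.\<close>
  have cs: "cos (2 * pi * s) = - cos (2 * pi * s - pi)" "sin (2 * pi * s) = - sin (2 * pi * s - pi)" for s :: real
    by (simp_all add: cos_diff sin_diff)
  have loop_s: "proper_strand lower_box ?U (length L, 1 / 2, 1)"
    unfolding proper_strand_def case_prod_conv Ui
  proof (intro conjI ballI)
    show "inj_on (\<lambda>s. plane_proj (flat_circle s)) {1 / 2..1}"
    proof (rule inj_onI)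
      fix s t :: real assume st: "s \<in> {1 / 2..1}" "t \<in> {1 / 2..1}" "plane_proj (flat_circle s) = plane_proj (flat_circle t)"
      then have "cos (2 * pi * s) = cos (2 * pi * t)" by (simp add: plane_proj_def flat_circle_eq)
      then have eq: "cos (2 * pi * s - pi) = cos (2 * pi * t - pi)"
        using cs(1)[of s] cs(1)[of t] by linarith
      have "2 * pi * s - pi = 2 * pi * t - pi"
        by (rule cos_inj_pi[OF _ _ _ _ eq]) (use st(1,2) in auto)
      then show "s = t" by simp
    qed
    show "plane_proj (flat_circle s) \<in> interior lower_box" if s: "s \<in> {1 / 2<..<1}" for s
    proof -
      have "0 < 2 * pi * s - pi" "2 * pi * s - pi < pi" using s by auto
      then have "sin (2 * pi * s - pi) > 0" by (rule sin_gt_zero)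
      then have "sin (2 * pi * s) < 0" using cs(2)[of s] by linarith
      then show ?thesis
        using cos_le_one[of "2 * pi * s"] cos_ge_minus_one[of "2 * pi * s"] sin_ge_minus_one[of "2 * pi * s"]
        unfolding lower_box_topology flat_circle_eq vector_3 by (intro conjI; linarith)
    qed
    have "flat_circle (1 / 2) = vec3 (-1) 2 0" "flat_circle 1 = vec3 1 2 0" by (simp_all add: flat_circle_eq)
    then show "plane_proj (flat_circle (1 / 2)) \<in> frontier lower_box" "plane_proj (flat_circle 1) \<in> frontier lower_box"
      by (simp_all add: lower_box_topology plane_proj_lower_box)
  qed simp_all
  have cover: "on_strand (i, s0 + (-5) / V, s0 + 5 / V) m s \<or> on_strand (length L, 1 / 2, 1) m s"
    if m: "m < length ?U" and s: "plane_proj ((?U ! m) s) \<in> lower_box" for m s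
  proof (cases "m < length L")
    case True
    then have "plane_proj ((L ! m) s) \<in> lower_box" using s by (simp add: nth_append)
    note o = line_over[OF lower_box_topology(1) True this]
    have "-5 \<le> w s" "w s \<le> 5" using o(2) by auto
    from on_strand_arc[OF this] show ?thesis using o(1) by simp
  next
    case False
    then have mk: "m = length L" using m by simp
    then have c: "sin (2 * pi * s) \<le> 0" using s by (simp add: plane_proj_lower_box flat_circle_eq)
    define n where "n = - \<lfloor>s\<rfloor>"
    have fr: "s + of_int n = frac s" by (simp add: n_def frac_def)
    have "2 * pi * frac s = 2 * pi * s + 2 * pi * n" using fr by (simp add: algebra_simps flip: fr)
    then have "sin (2 * pi * frac s) = sin (2 * pi * s) \<and> cos (2 * pi * frac s) = cos (2 * pi * s)"
      by (intro sin_cos_eq_iff[THEN iffD2] exI[of _ n])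
    then have sf: "sin (2 * pi * frac s) \<le> 0" using c by simp
    have "frac s = 0 \<or> 1 / 2 \<le> frac s"
    proof (rule ccontr)
      assume "\<not> ?thesis"
      then have "0 < frac s" "frac s < 1 / 2" using frac_ge_0[of s] by linarith+
      then have "sin (2 * pi * frac s) > 0" by (intro sin_gt_zero) auto
      then show False using sf by simp
    qed
    \<comment> \<open>An integer time reduces to 0, outside [1/2, 1]; one more period takes it to
      the end 1.\<close>
    then have "s + of_int (n + 1) \<in> {1 / 2..1} \<or> s + of_int n \<in> {1 / 2..1}"
    proof
      assume "frac s = 0"
      then have "s + of_int (n + 1) = 1" using fr by simp
      then show ?thesis by simp
    next
      assume "1 / 2 \<le> frac s"
      then have "s + of_int n \<in> {1 / 2..1}" using fr frac_lt_1[of s] by simp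
      then show ?thesis by blast
    qed
    then show ?thesis unfolding on_strand_def case_prod_conv mk by blast
  qed
  have two: "two_strands lower_box ?U (i, s0 + (-5) / V, s0 + 5 / V) (length L, 1 / 2, 1)"
    unfolding two_strands_def by (intro conjI allI impI lower_box_topology(2) line_s loop_s cover)
  have disj: "plane_proj ((?U ! i) s) \<noteq> plane_proj ((?U ! length L) t)"
    if s: "s \<in> {s0 + (-5) / V..s0 + 5 / V}" and t: "t \<in> {1 / 2..1}" for s t
  proof
    assume "plane_proj ((?U ! i) s) = plane_proj ((?U ! length L) t)"
    moreover have "\<bar>w s\<bar> \<le> 5" by (rule param_eqs(3)[OF _ _ s]) simp_all
    then have "(L ! i) s = line (w s)" using on_line(1)[of s] by simp
    ultimately have "2 + sin (2 * pi * t) = 0" by (simp add: Ui plane_proj_def flat_circle_eq line_def)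
    then show False using sin_ge_minus_one[of "2 * pi * t"] by linarith
  qed
  have ends: "(?U ! i) (s0 + (-5) / V) = (graft (curl \<sigma>) ! i) (s0 + (-5) / V)"
    "(?U ! i) (s0 + 5 / V) = (graft (curl \<sigma>) ! i) (s0 + 5 / V)"
    "(?U ! length L) (1 / 2) = (graft (curl \<sigma>) ! i) (s0 + 1 / V)"
    "(?U ! length L) 1 = (graft (curl \<sigma>) ! i) (s0 + (-1) / V)"
    unfolding Ui
    using line_values(1)[of "-5"] line_values(1)[of 5] arc_values(1)[OF arc_curl, of "-5" \<sigma>]
      arc_values(1)[OF arc_curl, of 5 \<sigma>] arc_values(1)[OF arc_curl, of 1 \<sigma>] arc_values(1)[OF arc_curl, of "-1" \<sigma>]
      curl_eqs(1)[of "-5" \<sigma>] curl_eqs(5)[of 5 \<sigma>] curl_eqs(3)[of 1 \<sigma>] curl_eqs(3)[of "-1" \<sigma>]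
    by (simp_all add: flat_circle_eq curl_loop_def)
  have "\<exists>i0 a0 b0 j0 c0 d0.
        two_strands lower_box ?U (i0, a0, b0) (j0, c0, d0) \<and>
        (\<forall>s\<in>{a0..b0}. \<forall>t\<in>{c0..d0}. plane_proj ((?U ! i0) s) \<noteq> plane_proj ((?U ! j0) t)) \<and>
        (?U ! i0) a0 = (graft (curl \<sigma>) ! i) (s0 + (-5) / V) \<and> (?U ! i0) b0 = (graft (curl \<sigma>) ! i) (s0 + 5 / V) \<and>
        (?U ! j0) c0 = (graft (curl \<sigma>) ! i) (s0 + 1 / V) \<and> (?U ! j0) d0 = (graft (curl \<sigma>) ! i) (s0 + (-1) / V)"
    by (rule exI[of _ i], rule exI[of _ "s0 + (-5) / V"], rule exI[of _ "s0 + 5 / V"], rule exI[of _ "length L"],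
        rule exI[of _ "1 / 2"], rule exI[of _ 1])
      (intro conjI ballI two ends; rule disj; assumption)
  then show ?thesis
    unfolding smoothing_def case_prod_conv
    by (rule conjI[OF outer_points[OF curl_splits C1_flat_circle, symmetric]])
qed

lemma skein_triple_curl:
  "skein_triple lower_box i i 1 (-1) (graft (curl 1)) (graft (curl (-1))) (L @ [flat_circle])"
  unfolding skein_triple_def
  by (intro exI conjI; rule curl_crossing curl_smoothing same_diagram_curls; simp)

lemma add_unknot_flat: "add_unknot L (L @ [flat_circle])"
  unfolding add_unknot_def
proof (intro exI conjI ballI)
  show "radii (vec3 1 0 0) (vec3 0 1 0)"
    by (auto simp: radii_def norm_vec_def L2_set_def sum_3 inner_vec_def vec3_eq_iff)
  show "L @ [flat_circle] = L @ [round_circle (vec3 0 2 0) (vec3 1 0 0) (vec3 0 1 0)]"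
    by (simp add: flat_circle_def)
  fix \<gamma> assume "\<gamma> \<in> set L"
  then obtain m where m: "m < length L" "\<gamma> = L ! m" by (auto simp: in_set_conv_nth)
  show "range \<gamma> \<inter> flat_disc (vec3 0 2 0) (vec3 1 0 0) (vec3 0 1 0) = {}"
  proof (rule ccontr)
    assume "\<not> ?thesis"
    then obtain s \<alpha> \<beta> where e: "(L ! m) s = vec3 0 2 0 + \<alpha> *\<^sub>R vec3 1 0 0 + \<beta> *\<^sub>R vec3 0 1 0"
      and ab: "\<alpha>\<^sup>2 + \<beta>\<^sup>2 \<le> 1"
      using m by (auto simp: flat_disc_def)
    have "\<alpha>\<^sup>2 \<le> 1" "\<beta>\<^sup>2 \<le> 1" using ab zero_le_power2[of \<alpha>] zero_le_power2[of \<beta>] by linarith+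
    then have b: "\<bar>\<alpha>\<bar> \<le> 1" "\<bar>\<beta>\<bar> \<le> 1" by (simp_all add: abs_square_le_1)
    have c: "(L ! m) s $ 1 = \<alpha>" "(L ! m) s $ 2 = 2 + \<beta>" unfolding e by simp_all
    \<comment> \<open>The disc lies over the square at second coordinate at least 1, whereas the
      link has second coordinate 0 there.\<close>
    have "plane_proj ((L ! m) s) \<in> square" unfolding plane_proj_square c using b by auto
    then have "(L ! m) s $ 2 = 0" using near_axis_square m unfolding near_axis_def by blast
    then show False using b c by auto
  qed
qed

end

section \<open>Normal form of an added circle\<close>

lemma touching_loopI:
  assumes "C1 C C'" "\<And>s. C (s + 1) = C s" "\<And>s. C' s \<noteq> 0" "\<And>s t. C s = C t \<Longrightarrow> s - t \<in> \<int>"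
    "\<And>s. plane_proj (C s) \<in> \<Omega>" "C 0 = p" "\<And>s. C s $ 2 = 0 \<Longrightarrow> C s $ 3 = 0 \<Longrightarrow> s \<in> \<int>"
    "C' 0 $ 2 \<noteq> 0 \<or> C' 0 $ 3 \<noteq> 0"
  shows "touching_loop \<Omega> p C"
  unfolding touching_loop_def simple_loop_def C1_velocity[OF assms(1)]
  using assms closed_curveI[OF assms(2,1,3)] by blast

text \<open>The second and third coordinates are the matrix with rows (\<alpha>, \<beta>) and
  (\<gamma>, \<delta>) applied to (sin, cos - 1). Interpolation acts on the coefficients, so an
  isotopy of such circles amounts to a path of invertible matrices.\<close>

definition sheared_circle :: "real \<Rightarrow> real \<Rightarrow> real \<Rightarrow> real \<Rightarrow> real \<Rightarrow> real \<Rightarrow> curve" where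
  "sheared_circle \<eta> \<xi> \<alpha> \<beta> \<gamma> \<delta> s = vec3 (\<eta> + \<xi> * (cos (2 * pi * s) - 1))
     (\<alpha> * sin (2 * pi * s) + \<beta> * (cos (2 * pi * s) - 1))
     (\<gamma> * sin (2 * pi * s) + \<delta> * (cos (2 * pi * s) - 1))"

definition sheared_circle' :: "real \<Rightarrow> real \<Rightarrow> real \<Rightarrow> real \<Rightarrow> real \<Rightarrow> curve" where
  "sheared_circle' \<xi> \<alpha> \<beta> \<gamma> \<delta> s = vec3 (- \<xi> * (2 * pi * sin (2 * pi * s)))
     (2 * pi * (\<alpha> * cos (2 * pi * s) - \<beta> * sin (2 * pi * s)))
     (2 * pi * (\<gamma> * cos (2 * pi * s) - \<delta> * sin (2 * pi * s)))"

lemma C1_sheared_circle: "C1 (sheared_circle \<eta> \<xi> \<alpha> \<beta> \<gamma> \<delta>) (sheared_circle' \<xi> \<alpha> \<beta> \<gamma> \<delta>)"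
  unfolding sheared_circle_def[abs_def] sheared_circle'_def[abs_def]
  by (rule C1_vec3) (auto intro!: derivative_eq_intros continuous_intros simp: algebra_simps)

lemma lerp_sheared_circle:
  "(1 - t) *\<^sub>R sheared_circle \<eta> \<xi> \<alpha> \<beta> \<gamma> \<delta> s + t *\<^sub>R sheared_circle \<eta> \<xi>' \<alpha>' \<beta>' \<gamma>' \<delta>' s =
    sheared_circle \<eta> ((1 - t) * \<xi> + t * \<xi>') ((1 - t) * \<alpha> + t * \<alpha>') ((1 - t) * \<beta> + t * \<beta>')
      ((1 - t) * \<gamma> + t * \<gamma>') ((1 - t) * \<delta> + t * \<delta>') s"
  by (simp add: sheared_circle_def vec3_eq_iff algebra_simps)

lemma linear_system_2:
  fixes p q :: real
  assumes "\<alpha> * p + \<beta> * q = 0" "\<gamma> * p + \<delta> * q = 0" "\<alpha> * \<delta> - \<beta> * \<gamma> \<noteq> 0"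
  shows "p = 0" "q = 0"
proof -
  have "(\<alpha> * \<delta> - \<beta> * \<gamma>) * p = 0" "(\<alpha> * \<delta> - \<beta> * \<gamma>) * q = 0"
    using assms(1,2) by algebra+
  then show "p = 0" "q = 0" using assms(3) by auto
qed

text \<open>An invertible matrix annihilates (sin, cos - 1) only for sin = 0 and cos = 1, that is at
  integer times. The same cancellation yields regularity and injectivity.\<close>

lemma touching_sheared_circle:
  assumes det: "\<alpha> * \<delta> - \<beta> * \<gamma> \<noteq> 0"
    and \<Omega>: "\<And>s. plane_proj (sheared_circle \<eta> \<xi> \<alpha> \<beta> \<gamma> \<delta> s) \<in> \<Omega>"
  shows "touching_loop \<Omega> (vec3 \<eta> 0 0) (sheared_circle \<eta> \<xi> \<alpha> \<beta> \<gamma> \<delta>)"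
proof (rule touching_loopI[OF C1_sheared_circle])
  let ?E = "sheared_circle \<eta> \<xi> \<alpha> \<beta> \<gamma> \<delta>" and ?E' = "sheared_circle' \<xi> \<alpha> \<beta> \<gamma> \<delta>"
  show "?E (s + 1) = ?E s" for s by (simp only: sheared_circle_def cos_sin_periodic)
  show "?E' s \<noteq> 0" for s
  proof
    assume "?E' s = 0"
    then have "?E' s $ 2 = 0" "?E' s $ 3 = 0" by simp_all
    then have "\<alpha> * cos (2 * pi * s) + \<beta> * (- sin (2 * pi * s)) = 0"
      "\<gamma> * cos (2 * pi * s) + \<delta> * (- sin (2 * pi * s)) = 0"
      by (simp_all add: sheared_circle'_def)
    from linear_system_2[OF this det] show False using cos_sin_nonzero[of "2 * pi * s"] by simp
  qed
  show "s - t \<in> \<int>" if "?E s = ?E t" for s t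
  proof -
    have "?E s $ 2 = ?E t $ 2" "?E s $ 3 = ?E t $ 3" using that by simp_all
    then have "\<alpha> * (sin (2 * pi * s) - sin (2 * pi * t)) + \<beta> * (cos (2 * pi * s) - cos (2 * pi * t)) = 0"
      "\<gamma> * (sin (2 * pi * s) - sin (2 * pi * t)) + \<delta> * (cos (2 * pi * s) - cos (2 * pi * t)) = 0"
      by (simp_all add: sheared_circle_def algebra_simps)
    from linear_system_2[OF this det] show ?thesis by (intro cos_sin_eq_Ints) simp_all
  qed
  show "plane_proj (?E s) \<in> \<Omega>" for s by (rule \<Omega>)
  show "?E 0 = vec3 \<eta> 0 0" by (simp add: sheared_circle_def)
  show "s \<in> \<int>" if "?E s $ 2 = 0" "?E s $ 3 = 0" for s
  proof -
    have "\<alpha> * sin (2 * pi * s) + \<beta> * (cos (2 * pi * s) - 1) = 0"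
      "\<gamma> * sin (2 * pi * s) + \<delta> * (cos (2 * pi * s) - 1) = 0"
      using that by (simp_all add: sheared_circle_def)
    from linear_system_2[OF this det] have "s - 0 \<in> \<int>" by (intro cos_sin_eq_Ints) simp_all
    then show ?thesis by simp
  qed
  show "?E' 0 $ 2 \<noteq> 0 \<or> ?E' 0 $ 3 \<noteq> 0" using det by (auto simp: sheared_circle'_def)
qed

lemma plane_proj_lerp:
  "plane_proj ((1 - t) *\<^sub>R v + t *\<^sub>R w) = (1 - t) *\<^sub>R plane_proj v + t *\<^sub>R plane_proj w"
  by (simp add: plane_proj_def)

lemma isotopic_sheared_circles:
  assumes L: "classical_link L" "near_axis \<Omega> L" "i < length L" "(L ! i) sp = vec3 \<eta> 0 0"
      "velocity (L ! i) sp $ 2 = 0" "velocity (L ! i) sp $ 3 = 0"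
    and \<Omega>: "convex \<Omega>" "\<And>s. plane_proj (sheared_circle \<eta> \<xi> \<alpha> \<beta> \<gamma> \<delta> s) \<in> \<Omega>"
      "\<And>s. plane_proj (sheared_circle \<eta> \<xi>' \<alpha>' \<beta>' \<gamma>' \<delta>' s) \<in> \<Omega>"
    and det: "\<And>t. t \<in> {0..1} \<Longrightarrow> ((1 - t) * \<alpha> + t * \<alpha>') * ((1 - t) * \<delta> + t * \<delta>') -
      ((1 - t) * \<beta> + t * \<beta>') * ((1 - t) * \<gamma> + t * \<gamma>') \<noteq> 0"
  shows "isotopic_via id (L @ [sheared_circle \<eta> \<xi> \<alpha> \<beta> \<gamma> \<delta>]) (L @ [sheared_circle \<eta> \<xi>' \<alpha>' \<beta>' \<gamma>' \<delta>'])"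
proof (rule isotopic_touching_loops[OF L])
  fix t :: real assume t: "t \<in> {0..1}"
  have "plane_proj ((1 - t) *\<^sub>R sheared_circle \<eta> \<xi> \<alpha> \<beta> \<gamma> \<delta> s + t *\<^sub>R sheared_circle \<eta> \<xi>' \<alpha>' \<beta>' \<gamma>' \<delta>' s) \<in> \<Omega>" for s
    unfolding plane_proj_lerp by (rule convexD[OF \<Omega>(1) \<Omega>(2) \<Omega>(3)]) (use t in auto)
  then show "touching_loop \<Omega> (vec3 \<eta> 0 0)
      (\<lambda>s. (1 - t) *\<^sub>R sheared_circle \<eta> \<xi> \<alpha> \<beta> \<gamma> \<delta> s + t *\<^sub>R sheared_circle \<eta> \<xi>' \<alpha>' \<beta>' \<gamma>' \<delta>' s)"
    unfolding lerp_sheared_circle using touching_sheared_circle[OF det[OF t]] by simp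
qed

lemma plane_proj_cball: "plane_proj v \<in> cball (0, 0) 2 \<longleftrightarrow> (v $ 1)\<^sup>2 + (v $ 2)\<^sup>2 \<le> 4"
proof -
  have "plane_proj v \<in> cball (0, 0) 2 \<longleftrightarrow> sqrt ((v $ 1)\<^sup>2 + (v $ 2)\<^sup>2) \<le> sqrt 4"
    by (simp add: plane_proj_def dist_Pair_Pair dist_real_def)
  then show ?thesis by (simp only: real_sqrt_le_iff)
qed

text \<open>Transitivity of the isotopy relation is not needed, since an invariant is constant along a
  chain of isotopies.\<close>

definition isotopy_chain :: "link \<Rightarrow> link \<Rightarrow> bool" where
  "isotopy_chain = (\<lambda>L L'. isotopic L L' \<or> isotopic L' L)\<^sup>*\<^sup>*"

lemma isotopy_chainI:
  "isotopic_via \<sigma> L L' \<Longrightarrow> isotopy_chain L L'" "isotopic_via \<sigma> L L' \<Longrightarrow> isotopy_chain L' L"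
  unfolding isotopy_chain_def isotopic_def by (rule r_into_rtranclp; blast)+

lemma isotopy_chain_trans: "isotopy_chain A B \<Longrightarrow> isotopy_chain B C \<Longrightarrow> isotopy_chain A C"
  unfolding isotopy_chain_def by (rule rtranclp_trans)

text \<open>The unknown heights of \<open>C\<close> are removed first, by an interpolation with
  fixed projection, to a circle whose matrix is \<epsilon> times the identity. Then \<epsilon> is
  removed by a path of invertible matrices; the coefficient of the first coordinate may meanwhile
  pass from \<eta> to 1/10, since contact with the axis is decided by the matrix. The target is the
  tilted circle at a tenth of its size, touching at (\<eta>, 0, 0).\<close>

lemma isotopy_chain_touching_circle:
  assumes L: "classical_link L" and add: "add_touching_circle L i M"
  obtains a b \<eta> where "a < b" "\<eta> \<in> {-1, 1}" "i < length L"
    "\<And>s. s \<in> {a..b} \<Longrightarrow> (L ! i) s = vec3 (4 * (s - a) / (b - a) - 2) 0 0"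
    "\<And>m s. m < length L \<Longrightarrow> plane_proj ((L ! m) s) \<in> cball (0, 0) 2 \<Longrightarrow> on_strand (i, a, b) m s"
    "isotopy_chain M (L @ [sheared_circle \<eta> (1 / 10) (1 / 10) 0 (1 / 20) (1 / 10)])"
    "singular_link (L @ [sheared_circle \<eta> (1 / 10) (1 / 10) 0 (1 / 20) (1 / 10)])"
proof -
  let ?\<Omega> = "cball (0, 0) 2 :: (real \<times> real) set"
  from add have M0: "singular_link M" and i: "i < length L"
    unfolding add_touching_circle_def by blast+
  obtain a b C \<eta> \<epsilon> where *: "a < b \<and> M = L @ [C] \<and> \<eta> \<in> {-1, 1} \<and> \<epsilon> \<in> {-1, 1} \<and>
        (\<forall>s\<in>{a..b}. (L ! i) s = vector [4 * (s - a) / (b - a) - 2, 0, 0]) \<and>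
        (\<forall>m<length L. \<forall>s. plane_proj ((L ! m) s) \<in> cball (0, 0) 2 \<longrightarrow> on_strand (i, a, b) m s) \<and>
        (\<forall>s. plane_proj (C s) = (\<eta> * cos (2 * pi * s), \<epsilon> * sin (2 * pi * s))) \<and>
        C 0 $ 3 = 0 \<and>
        crossing_sign M (i, a + (2 - \<eta>) * (b - a) / 4) (length L, 1 / 2) = -1"
    using add[unfolded add_touching_circle_def, THEN conjunct2, THEN conjunct2, THEN conjunct2]
    by (elim exE) (rule that)
  have M: "singular_link M" "M = L @ [C]" and ab: "a < b"
    and \<eta>: "\<eta> \<in> {-1, 1}" and \<epsilon>: "\<epsilon> \<in> {-1, 1}"
    and sgn: "crossing_sign M (i, a + (2 - \<eta>) * (b - a) / 4) (length L, 1 / 2) = -1"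
    using M0 * by blast+
  have strand: "(L ! i) s = vec3 (4 * (s - a) / (b - a) - 2) 0 0" if "s \<in> {a..b}" for s
    using * that by blast
  have over: "on_strand (i, a, b) m s" if "m < length L" "plane_proj ((L ! m) s) \<in> ?\<Omega>" for m s
    using * that by blast
  have C: "plane_proj (C s) = (\<eta> * cos (2 * pi * s), \<epsilon> * sin (2 * pi * s))" "C 0 $ 3 = 0" for s
    using * by blast+
  have cc: "closed_curve (L ! i)" and cC: "closed_curve C"
    using L i M by (simp_all add: classical_iff singular_link_def)
  have \<eta>2: "\<eta>\<^sup>2 = 1" and \<epsilon>2: "\<epsilon>\<^sup>2 = 1" using \<eta> \<epsilon> by auto
  have C12: "C s $ 1 = \<eta> * cos (2 * pi * s)" "C s $ 2 = \<epsilon> * sin (2 * pi * s)" for s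
    using C(1)[of s] by (simp_all add: plane_proj_def)
  note dC = C1_D[OF closed_curve_C1[OF cC], THEN has_real_derivative_vec_nth]
  have vC: "velocity C s $ 1 = - \<eta> * (2 * pi * sin (2 * pi * s))"
    "velocity C s $ 2 = \<epsilon> * (2 * pi * cos (2 * pi * s))" for s
  proof -
    have "((\<lambda>s. \<eta> * cos (2 * pi * s)) has_real_derivative - \<eta> * (2 * pi * sin (2 * pi * s))) (at s)"
      by (auto intro!: derivative_eq_intros)
    then show "velocity C s $ 1 = - \<eta> * (2 * pi * sin (2 * pi * s))"
      using dC[of 1 s] unfolding C12 by (rule DERIV_unique[symmetric])
    have "((\<lambda>s. \<epsilon> * sin (2 * pi * s)) has_real_derivative \<epsilon> * (2 * pi * cos (2 * pi * s))) (at s)"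
      by (auto intro!: derivative_eq_intros)
    then show "velocity C s $ 2 = \<epsilon> * (2 * pi * cos (2 * pi * s))"
      using dC[of 2 s] unfolding C12 by (rule DERIV_unique[symmetric])
  qed
  define v where "v = 4 / (b - a)"
  have v0: "v > 0" using ab by (simp add: v_def)
  have line': "(L ! i) s = line (v * (s - (a + b) / 2))" if "s \<in> {a..b}" for s
  proof -
    have "v * (s - (a + b) / 2) = 4 * (s - a) / (b - a) - 2"
      using ab by (simp add: v_def field_simps)
    then show ?thesis using strand[OF that] by (simp add: line_def)
  qed
  have vL: "velocity (L ! i) s = v *\<^sub>R vec3 1 0 0" if s: "s \<in> {a<..<b}" for s
  proof -
    have "((\<lambda>s. line (v * (s - (a + b) / 2))) has_vector_derivative v *\<^sub>R vec3 1 0 0) (at s)"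
      by (rule C1_D[OF C1_affine_param[OF C1_line]])
    then have "((L ! i) has_vector_derivative v *\<^sub>R vec3 1 0 0) (at s)"
      by (rule has_vector_derivative_transform_within_open[where S = "{a<..<b}"]) (use s line' in auto)
    then show ?thesis unfolding velocity_def by (rule vector_derivative_at)
  qed
  have pos: "a + (2 + \<theta>) * (b - a) / 4 \<in> {a<..<b}" "(L ! i) (a + (2 + \<theta>) * (b - a) / 4) = vec3 \<theta> 0 0"
    if "\<theta> \<in> {-1, 1}" for \<theta>
  proof -
    show *: "a + (2 + \<theta>) * (b - a) / 4 \<in> {a<..<b}" using that ab by (auto simp: field_simps)
    have "4 * (a + (2 + \<theta>) * (b - a) / 4 - a) / (b - a) - 2 = \<theta>" using ab by simp
    then show "(L ! i) (a + (2 + \<theta>) * (b - a) / 4) = vec3 \<theta> 0 0"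
      using strand[of "a + (2 + \<theta>) * (b - a) / 4"] * by simp
  qed
  define sp where "sp = a + (2 + \<eta>) * (b - a) / 4"
  have near: "near_axis ?\<Omega> L"
    unfolding near_axis_def
  proof (intro allI impI)
    fix m s assume m: "m < length L" and s: "plane_proj ((L ! m) s) \<in> ?\<Omega>"
    obtain n :: int where n: "m = i" "s + of_int n \<in> {a..b}"
      using over[OF m s] by (auto simp: on_strand_def)
    have "(L ! i) s = (L ! i) (s + of_int n)" using closed_curve_shift_int[OF cc] by simp
    then show "(L ! m) s $ 2 = 0 \<and> (L ! m) s $ 3 = 0" using strand[OF n(2)] n(1) by simp
  qed
  have spL: "(L ! i) sp = vec3 \<eta> 0 0" "velocity (L ! i) sp $ 2 = 0" "velocity (L ! i) sp $ 3 = 0"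
    using pos[OF \<eta>] vL[of sp] by (simp_all add: sp_def)
  note Lp = L near i spL
  \<comment> \<open>The negative crossing at time 1/2, read as a condition on the height there. It
    gives \<open>C\<close> and \<open>?E\<close> heights of the same sign at this time, so the
    interpolation between them stays off the strand.\<close>
  have neg: "\<epsilon> * C (1 / 2) $ 3 < 0"
  proof -
    let ?s = "a + (2 - \<eta>) * (b - a) / 4"
    have m\<eta>: "- \<eta> \<in> {-1, 1}" using \<eta> by auto
    have s: "?s \<in> {a<..<b}" "(L ! i) ?s = vec3 (- \<eta>) 0 0" using pos[OF m\<eta>] by simp_all
    have e: "vel M (i, ?s) = v *\<^sub>R vec3 1 0 0" "vel M (length L, 1 / 2) = velocity C (1 / 2)"
      "pt M (i, ?s) = vec3 (- \<eta>) 0 0" "pt M (length L, 1 / 2) = C (1 / 2)"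
      using i s vL[OF s(1)] by (simp_all add: M(2) vel_def pt_def nth_append)
    have sg: "sgn (v * (- (\<epsilon> * (2 * pi))) * (0 - C (1 / 2) $ 3)) = -1"
      using sgn unfolding crossing_sign_def e by (simp add: det2_def plane_proj_def vC)
    have re: "v * (- (\<epsilon> * (2 * pi))) * (0 - C (1 / 2) $ 3) = v * (2 * pi) * (\<epsilon> * C (1 / 2) $ 3)"
      by (simp add: algebra_simps)
    have "sgn (v * (2 * pi) * (\<epsilon> * C (1 / 2) $ 3)) = -1" using sg unfolding re .
    then have "v * (2 * pi) * (\<epsilon> * C (1 / 2) $ 3) < 0" by (simp only: sgn_1_neg)
    moreover have "v * (2 * pi) \<ge> 0" using v0 by simp
    ultimately show ?thesis by (meson mult_nonneg_nonneg not_le)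
  qed
  let ?E = "sheared_circle \<eta> \<eta> \<epsilon> 0 0 \<epsilon>"
  have iso1: "isotopic_via id M (L @ [?E])"
    unfolding M(2)
  proof (rule isotopic_touching_loops[OF Lp])
    fix t :: real assume t: "t \<in> {0..1}"
    let ?D = "\<lambda>s. (1 - t) *\<^sub>R C s + t *\<^sub>R ?E s"
    let ?D' = "\<lambda>s. (1 - t) *\<^sub>R velocity C s + t *\<^sub>R sheared_circle' \<eta> \<epsilon> 0 0 \<epsilon> s"
    have D12: "?D s $ 1 = \<eta> * cos (2 * pi * s)" "?D s $ 2 = \<epsilon> * sin (2 * pi * s)" for s
      by (simp_all add: C12 sheared_circle_def algebra_simps)
    have D'12: "?D' s $ 1 = - \<eta> * (2 * pi * sin (2 * pi * s))" "?D' s $ 2 = \<epsilon> * (2 * pi * cos (2 * pi * s))" for s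
      by (simp_all add: vC sheared_circle'_def algebra_simps)
    have n0: "\<eta> \<noteq> 0" "\<epsilon> \<noteq> 0" using \<eta> \<epsilon> by auto
    show "touching_loop ?\<Omega> (vec3 \<eta> 0 0) ?D"
    proof (rule touching_loopI[OF C1_lerp[OF closed_curve_C1[OF cC] C1_sheared_circle]])
      show "?D (s + 1) = ?D s" for s
        using cC by (simp only: sheared_circle_def cos_sin_periodic closed_curve_def)
      show "?D' s \<noteq> 0" for s
      proof
        assume "?D' s = 0"
        then have "?D' s $ 1 = 0" "?D' s $ 2 = 0" by simp_all
        then show False unfolding D'12 using cos_sin_nonzero[of "2 * pi * s"] n0 by simp
      qed
      show "s - s' \<in> \<int>" if "?D s = ?D s'" for s s'
      proof (rule cos_sin_eq_Ints)
        have "?D s $ 1 = ?D s' $ 1" "?D s $ 2 = ?D s' $ 2" using that by simp_all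
        then show "cos (2 * pi * s) = cos (2 * pi * s')" "sin (2 * pi * s) = sin (2 * pi * s')"
          unfolding D12 using n0 by simp_all
      qed
      show "plane_proj (?D s) \<in> ?\<Omega>" for s
        unfolding plane_proj_cball D12 by (simp add: power_mult_distrib \<eta>2 \<epsilon>2)
      show "?D 0 = vec3 \<eta> 0 0"
        using C12[of 0] C(2) by (simp add: vec3_eq_iff sheared_circle_def algebra_simps)
      show "?D' 0 $ 2 \<noteq> 0 \<or> ?D' 0 $ 3 \<noteq> 0" unfolding D'12 using n0 by simp
      show "s \<in> \<int>" if "?D s $ 2 = 0" "?D s $ 3 = 0" for s
      proof -
        have s0: "sin (2 * pi * s) = 0" using that(1) n0 unfolding D12 by simp
        then have "(cos (2 * pi * s))\<^sup>2 = 1" using sin_cos_squared_add[of "2 * pi * s"] by simp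
        then have "cos (2 * pi * s) = 1 \<or> cos (2 * pi * s) = -1" by (simp add: power2_eq_1_iff)
        then show "s \<in> \<int>"
        proof
          assume "cos (2 * pi * s) = 1"
          then have "s - 0 \<in> \<int>" using s0 by (intro cos_sin_eq_Ints) simp_all
          then show ?thesis by simp
        next
          assume c: "cos (2 * pi * s) = -1"
          have "s - 1 / 2 \<in> \<int>" using s0 c by (intro cos_sin_eq_Ints) simp_all
          then have "C s = C (1 / 2)" by (rule closed_curve_Ints[OF cC])
          then have d3: "?D s $ 3 = (1 - t) * C (1 / 2) $ 3 - 2 * (t * \<epsilon>)"
            using s0 c by (simp add: sheared_circle_def)
          have "\<epsilon> * ?D s $ 3 = \<epsilon> * ((1 - t) * C (1 / 2) $ 3 - 2 * (t * \<epsilon>))"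
            by (simp only: d3)
          also have "\<dots> = (1 - t) * (\<epsilon> * C (1 / 2) $ 3) - 2 * t * \<epsilon>\<^sup>2"
            by (simp add: algebra_simps power2_eq_square)
          finally have "(1 - t) * (\<epsilon> * C (1 / 2) $ 3) - 2 * t = 0" using that(2) \<epsilon>2 by simp
          moreover have "(1 - t) * (\<epsilon> * C (1 / 2) $ 3) - 2 * t < 0"
          proof (cases "t = 0")
            case True then show ?thesis using neg by simp
          next
            case False
            have "(1 - t) * (\<epsilon> * C (1 / 2) $ 3) \<le> 0" using mult_nonneg_nonpos[OF _ less_imp_le[OF neg], of "1 - t"] t by simp
            then show ?thesis using False t by simp
          qed
          ultimately show ?thesis by simp
        qed
      qed
    qed
  qed
  have conv: "convex ?\<Omega>" by (rule convex_cball)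
  have \<Omega>1: "plane_proj (?E s) \<in> ?\<Omega>" for s
  proof -
    have "?E s $ 1 = \<eta> * cos (2 * pi * s)" "?E s $ 2 = \<epsilon> * sin (2 * pi * s)"
      by (simp_all add: sheared_circle_def algebra_simps)
    then show ?thesis unfolding plane_proj_cball by (simp add: power_mult_distrib \<eta>2 \<epsilon>2)
  qed
  have \<Omega>2: "plane_proj (sheared_circle \<eta> (1 / 10) \<alpha> \<beta> \<gamma> \<delta> s) \<in> ?\<Omega>"
    if "\<bar>\<alpha>\<bar> \<le> 1 / 10" "\<bar>\<beta>\<bar> \<le> 1 / 10" for \<alpha> \<beta> \<gamma> \<delta> s
  proof -
    define c d where "c = cos (2 * pi * s)" and "d = sin (2 * pi * s)"
    have cd: "\<bar>c\<bar> \<le> 1" "\<bar>d\<bar> \<le> 1" unfolding c_def d_def by (rule abs_cos_le_one, rule abs_sin_le_one)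
    have c1: "- 1 \<le> c" "c \<le> 1" using cd(1) by (simp_all add: abs_le_iff)
    have e: "1 / 10 * (c - 1) = c / 10 - 1 / 10" by (simp add: diff_divide_distrib)
    have \<eta>1: "-1 \<le> \<eta>" "\<eta> \<le> 1" using \<eta> by auto
    have "\<eta> + (c / 10 - 1 / 10) \<le> 6 / 5" using \<eta>1 c1 by linarith
    moreover have "- (\<eta> + (c / 10 - 1 / 10)) \<le> 6 / 5" using \<eta>1 c1 by linarith
    ultimately have x: "\<bar>\<eta> + 1 / 10 * (c - 1)\<bar> \<le> 6 / 5" unfolding e by (rule abs_leI)
    have c2: "\<bar>c - 1\<bar> \<le> 2" using c1 by (simp add: abs_le_iff)
    have "\<bar>\<alpha> * d\<bar> \<le> 1 / 10 * 1" "\<bar>\<beta> * (c - 1)\<bar> \<le> 1 / 10 * 2"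
      unfolding abs_mult by (rule mult_mono[OF that(1) cd(2)]; simp) (rule mult_mono[OF that(2) c2]; simp)
    then have y: "\<bar>\<alpha> * d + \<beta> * (c - 1)\<bar> \<le> 3 / 10"
      using abs_triangle_ineq[of "\<alpha> * d" "\<beta> * (c - 1)"] by linarith
    have "(\<eta> + 1 / 10 * (c - 1))\<^sup>2 \<le> (6 / 5)\<^sup>2" "(\<alpha> * d + \<beta> * (c - 1))\<^sup>2 \<le> (3 / 10)\<^sup>2"
      using x y by (simp_all only: abs_le_square_iff[symmetric])
    then have "(\<eta> + 1 / 10 * (c - 1))\<^sup>2 + (\<alpha> * d + \<beta> * (c - 1))\<^sup>2 \<le> 4"
      by (simp add: power2_eq_square)
    then show ?thesis unfolding plane_proj_cball sheared_circle_def vector_3 c_def d_def .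
  qed
  let ?S = "sheared_circle \<eta> (1 / 10) (1 / 10) 0 (1 / 20) (1 / 10)"
  let ?R = "sheared_circle \<eta> (1 / 10) 0 (-1 / 10) (1 / 10) 0"
  \<comment> \<open>For \<epsilon> = 1 both matrices are lower triangular with positive diagonal,
    and so are their mixtures. For \<epsilon> = -1 the segment to \<open>?S\<close> contains a
    singular matrix; the path is therefore broken at the quarter turn \<open>?R\<close>.\<close>
  have chain: "isotopy_chain (L @ [?E]) (L @ [?S])"
  proof (cases "\<epsilon> = 1")
    case True
    have "isotopic_via id (L @ [?E]) (L @ [?S])"
    proof (rule isotopic_sheared_circles[OF Lp conv \<Omega>1 \<Omega>2])
      fix t :: real assume t: "t \<in> {0..1}"
      have "(1 - t) + t / 10 > 0" using t by auto
      then show "((1 - t) * \<epsilon> + t * (1 / 10)) * ((1 - t) * \<epsilon> + t * (1 / 10)) -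
          ((1 - t) * 0 + t * 0) * ((1 - t) * 0 + t * (1 / 20)) \<noteq> 0"
        using True by simp
    qed simp_all
    then show ?thesis by (rule isotopy_chainI)
  next
    case False
    then have \<epsilon>: "\<epsilon> = -1" using \<epsilon> by simp
    have sq: "p\<^sup>2 + q\<^sup>2 \<noteq> 0" if "p \<noteq> 0 \<or> q \<noteq> 0" for p q :: real
      using that by (simp add: sum_power2_eq_zero_iff)
    have "isotopic_via id (L @ [?E]) (L @ [?R])"
    proof (rule isotopic_sheared_circles[OF Lp conv \<Omega>1 \<Omega>2])
      fix t :: real assume t: "t \<in> {0..1}"
      have "(t - 1)\<^sup>2 + (t / 10)\<^sup>2 \<noteq> 0" by (rule sq) auto
      then show "((1 - t) * \<epsilon> + t * 0) * ((1 - t) * \<epsilon> + t * 0) -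
          ((1 - t) * 0 + t * (- 1 / 10)) * ((1 - t) * 0 + t * (1 / 10)) \<noteq> 0"
        using \<epsilon> by (simp add: power2_eq_square)
    qed simp_all
    moreover have "isotopic_via id (L @ [?R]) (L @ [?S])"
    proof (rule isotopic_sheared_circles[OF Lp conv \<Omega>2 \<Omega>2])
      fix t :: real assume t: "t \<in> {0..1}"
      have "t\<^sup>2 + (1 - t)\<^sup>2 \<noteq> 0" by (rule sq) auto
      then have "t\<^sup>2 + (1 - t)\<^sup>2 > 0" using sum_power2_ge_zero[of t "1 - t"] by linarith
      moreover have "t * (1 - t) \<ge> 0" using t by simp
      \<comment> \<open>This is 100 times the determinant along the second segment.\<close>
      ultimately have "t\<^sup>2 + (1 - t)\<^sup>2 + t * (1 - t) / 2 > 0" by linarith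
      moreover have "((1 - t) * 0 + t * (1 / 10)) * ((1 - t) * 0 + t * (1 / 10)) -
          ((1 - t) * (- 1 / 10) + t * 0) * ((1 - t) * (1 / 10) + t * (1 / 20)) =
          (t\<^sup>2 + (1 - t)\<^sup>2 + t * (1 - t) / 2) / 100"
        by (simp add: field_simps power2_eq_square)
      ultimately show "((1 - t) * 0 + t * (1 / 10)) * ((1 - t) * 0 + t * (1 / 10)) -
          ((1 - t) * (- 1 / 10) + t * 0) * ((1 - t) * (1 / 10) + t * (1 / 20)) \<noteq> 0" by simp
    qed simp_all
    ultimately show ?thesis by (blast intro: isotopy_chainI isotopy_chain_trans)
  qed
  have "touching_loop ?\<Omega> (vec3 \<eta> 0 0) ?S"
    by (rule touching_sheared_circle[OF _ \<Omega>2]) simp_all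
  then have "singular_link (L @ [?S])" using singular_touching_loop[OF Lp] by blast
  moreover have "isotopy_chain M (L @ [?S])"
    by (rule isotopy_chain_trans[OF isotopy_chainI(1)[OF iso1] chain])
  ultimately show thesis using that[OF ab \<eta> i strand over] by blast
qed

text \<open>The factor 10 restores the size of the circle, and the translation moves the touching
  point to (1, 0, 0). The square of radius 5 then comes from the square of radius 1/2 about (\<eta>
  - 1/10, 0), which lies in the disc of radius 2; the parameter of its centre is the new
  \<open>s0\<close>.\<close>

lemma straight_strand_similar:
  assumes L: "classical_link L" and i: "i < length L" and ab: "a < b" and \<eta>: "\<eta> \<in> {-1, 1}"
    and strand: "\<And>s. s \<in> {a..b} \<Longrightarrow> (L ! i) s = vec3 (4 * (s - a) / (b - a) - 2) 0 0"
    and over: "\<And>m s. m < length L \<Longrightarrow> plane_proj ((L ! m) s) \<in> cball (0, 0) 2 \<Longrightarrow> on_strand (i, a, b) m s"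
  shows "straight_strand (similar 10 (vec3 (1 - 10 * \<eta>) 0 0) L) i
    (a + (19 / 10 + \<eta>) * (b - a) / 4) (40 / (b - a))"
proof
  let ?X = "similar 10 (vec3 (1 - 10 * \<eta>) 0 0) L"
  define s0 V where "s0 = a + (19 / 10 + \<eta>) * (b - a) / 4" and "V = 40 / (b - a)"
  have s0V: "a + (19 / 10 + \<eta>) * (b - a) / 4 = s0" "40 / (b - a) = V" by (simp_all add: s0_def V_def)
  have cc: "closed_curve (L ! i)" using L i by (simp add: classical_iff)
  have e: "V * (s - s0) = 10 * (4 * (s - a) / (b - a) - 2) + (1 - 10 * \<eta>)" for s
    using ab by (simp add: V_def s0_def field_simps)
  show "classical_link ?X"
  proof -
    have "singular_link ?X \<and> double_pairs ?X = double_pairs L"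
      by (rule singular_similar) (use L in \<open>simp_all add: classical_link_def\<close>)
    then show ?thesis using L by (simp add: classical_link_def)
  qed
  show "i < length ?X" using i by simp
  \<comment> \<open>A straight strand as long as a period would take different values at
    \<open>a\<close> and \<open>a + 1\<close>.\<close>
  have ba: "b - a < 1"
  proof (rule ccontr)
    assume n: "\<not> b - a < 1"
    have "(L ! i) (a + 1) = (L ! i) a" using cc by (simp add: closed_curve_def)
    then have "vec3 (4 * (a + 1 - a) / (b - a) - 2) 0 0 = vec3 (4 * (a - a) / (b - a) - 2) 0 0"
      using strand[of "a + 1"] strand[of a] n ab by simp
    then show False using ab by (simp add: vec3_eq_iff)
  qed
  then have V40: "V > 40" using ab by (simp add: V_def field_simps)
  then show "40 / (b - a) > 12" using s0V by simp
  have Xi: "(?X ! i) s = line (V * (s - s0))" if "s \<in> {a..b}" for s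
    unfolding e using i strand[OF that] by (simp add: nth_similar line_def vec3_eq_iff)
  show "(?X ! i) s = line (40 / (b - a) * (s - (a + (19 / 10 + \<eta>) * (b - a) / 4)))"
    if "\<bar>40 / (b - a) * (s - (a + (19 / 10 + \<eta>) * (b - a) / 4))\<bar> < 6" for s
  proof -
    have "\<bar>V * (s - s0)\<bar> < 6" using that s0V by simp
    then have *: "\<bar>10 * (4 * (s - a) / (b - a) - 2) + (1 - 10 * \<eta>)\<bar> < 6" unfolding e .
    define q where "q = (s - a) / (b - a)"
    have q: "4 * (s - a) / (b - a) = 4 * q" by (simp only: q_def times_divide_eq_right)
    have "\<bar>10 * (4 * q - 2) + (1 - 10 * \<eta>)\<bar> < 6" using * unfolding q .
    then have "0 \<le> q" "q \<le> 1" using \<eta> by auto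
    then have "0 \<le> (s - a) / (b - a)" "(s - a) / (b - a) \<le> 1" by (simp_all only: q_def)
    then have "s \<in> {a..b}" using ab by (simp add: zero_le_divide_iff divide_le_eq_1)
    then show ?thesis unfolding s0V by (rule Xi)
  qed
  show "m = i \<and> \<bar>40 / (b - a) * (s - of_int \<lfloor>s - (a + (19 / 10 + \<eta>) * (b - a) / 4) + 1 / 2\<rfloor> -
      (a + (19 / 10 + \<eta>) * (b - a) / 4))\<bar> \<le> 5"
    if m: "m < length ?X" and b: "\<bar>(?X ! m) s $ 1\<bar> \<le> 5" "\<bar>(?X ! m) s $ 2\<bar> \<le> 5" for m s
  proof -
    have m': "m < length L" using m by simp
    define x y where "x = (L ! m) s $ 1" and "y = (L ! m) s $ 2"
    have "\<bar>10 * x + (1 - 10 * \<eta>)\<bar> \<le> 5" "\<bar>10 * y\<bar> \<le> 5"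
      using b m' by (simp_all add: nth_similar x_def y_def)
    \<comment> \<open>x lies between \<eta> - 3/5 and \<eta> + 2/5, whence the bound 8/5.\<close>
    then have xy: "\<bar>x\<bar> \<le> 8 / 5" "\<bar>y\<bar> \<le> 1 / 2" using \<eta> by (auto simp: abs_le_iff)
    have "x\<^sup>2 \<le> (8 / 5)\<^sup>2" "y\<^sup>2 \<le> (1 / 2)\<^sup>2"
      using xy by (simp_all only: abs_le_square_iff[symmetric])
    then have "x\<^sup>2 + y\<^sup>2 \<le> 4" by (simp add: power2_eq_square)
    then have "plane_proj ((L ! m) s) \<in> cball (0, 0) 2" unfolding plane_proj_cball x_def y_def .
    from over[OF m' this] obtain n :: int where n: "m = i" "s + of_int n \<in> {a..b}"
      by (auto simp: on_strand_def)
    have "(?X ! i) s = (?X ! i) (s + of_int n)"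
      using closed_curve_shift_int[OF cc, of s n] i by (simp add: nth_similar)
    then have "\<bar>V * (s + of_int n - s0)\<bar> \<le> 5" using Xi[OF n(2)] b(1) n(1) by (simp add: line_def)
    then have small: "V * \<bar>s + of_int n - s0\<bar> \<le> 5" using V40 by (simp add: abs_mult)
    define d where "d = \<bar>s + of_int n - s0\<bar>"
    \<comment> \<open>The speed bound puts the shifted parameter within half a period of
      \<open>s0\<close>, so \<open>- n\<close> is the integer that the floor removes.\<close>
    have "40 * d \<le> V * d" using V40 by (intro mult_right_mono) (auto simp: d_def)
    then have "d < 1 / 2" using small unfolding d_def[symmetric] by linarith
    then have "\<bar>s + of_int n - s0\<bar> < 1 / 2" by (simp only: d_def)
    then have lo: "- (1 / 2) < s + of_int n - s0" and hi: "s + of_int n - s0 < 1 / 2"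
      by (simp_all only: abs_less_iff) linarith
    have "\<lfloor>s - s0 + 1 / 2\<rfloor> = - n"
    proof (rule floor_unique)
      show "of_int (- n) \<le> s - s0 + 1 / 2" unfolding of_int_minus using lo by linarith
      show "s - s0 + 1 / 2 < of_int (- n) + 1" unfolding of_int_minus using hi by linarith
    qed
    then show ?thesis unfolding s0V using \<open>\<bar>V * (s + of_int n - s0)\<bar> \<le> 5\<close> n(1) by simp
  qed
qed

lemma obtained_by_adding_normal_form:
  assumes L: "classical_link L" and M: "obtained_by_adding L i M"
  obtains L' i' s0 V where "straight_strand L' i' s0 V" "isotopy_chain L L'"
    "isotopy_chain M (L' @ [tilted_circle])"
proof -
  from M obtain \<sigma> L1 M1 where 1: "isotopic_via \<sigma> L L1" "add_touching_circle L1 (\<sigma> i) M1" "isotopic M1 M"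
    unfolding obtained_by_adding_def by blast
  have cl: "classical_link L1" by (rule isotopic_via_classical[OF 1(1) L])
  obtain a b \<eta> where 2: "a < b" "\<eta> \<in> {-1, 1}" "\<sigma> i < length L1"
    "\<And>s. s \<in> {a..b} \<Longrightarrow> (L1 ! \<sigma> i) s = vec3 (4 * (s - a) / (b - a) - 2) 0 0"
    "\<And>m s. m < length L1 \<Longrightarrow> plane_proj ((L1 ! m) s) \<in> cball (0, 0) 2 \<Longrightarrow> on_strand (\<sigma> i, a, b) m s"
    "isotopy_chain M1 (L1 @ [sheared_circle \<eta> (1 / 10) (1 / 10) 0 (1 / 20) (1 / 10)])"
    "singular_link (L1 @ [sheared_circle \<eta> (1 / 10) (1 / 10) 0 (1 / 20) (1 / 10)])"
    by (rule isotopy_chain_touching_circle[OF cl 1(2)]) blast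
  let ?v = "vec3 (1 - 10 * \<eta>) 0 0"
  \<comment> \<open>Under this similarity \<eta> disappears and the reduced circle becomes exactly
    \<open>tilted_circle\<close>.\<close>
  have app: "similar 10 ?v (L1 @ [sheared_circle \<eta> (1 / 10) (1 / 10) 0 (1 / 20) (1 / 10)]) =
      similar 10 ?v L1 @ [tilted_circle]"
    by (simp add: similar_def fun_eq_iff sheared_circle_def tilted_circle_def vec3_eq_iff diff_divide_distrib)
  have ten: "(10 :: real) > 0" by simp
  show thesis
  proof (rule that[OF straight_strand_similar[OF cl 2(3,1,2,4,5)]])
    show "isotopy_chain L (similar 10 ?v L1)"
      by (rule isotopy_chain_trans[OF isotopy_chainI(1)[OF 1(1)]
            isotopy_chainI(1)[OF isotopic_similar[OF classical_singular[OF cl] ten]]])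
    have "isotopy_chain M M1" using 1(3) isotopy_chainI(2) unfolding isotopic_def by blast
    moreover have "isotopy_chain (L1 @ [sheared_circle \<eta> (1 / 10) (1 / 10) 0 (1 / 20) (1 / 10)])
        (similar 10 ?v L1 @ [tilted_circle])"
      unfolding app[symmetric] by (rule isotopy_chainI(1)[OF isotopic_similar[OF 2(7) ten]])
    ultimately show "isotopy_chain M (similar 10 ?v L1 @ [tilted_circle])"
      using 2(6) isotopy_chain_trans by blast
  qed
qed

section \<open>The values of the invariants\<close>

text \<open>The partition into singletons survives every renumbering, so values at it may be
  compared along arbitrary isotopies.\<close>

lemma induced_by_permutation_singletons:
  assumes "\<sigma> permutes {..<k}" shows "(\<lambda>B. \<sigma> ` B) ` singletons k = singletons k"
proof -
  have "(\<lambda>B. \<sigma> ` B) ` singletons k = (\<lambda>j. {j}) ` (\<sigma> ` {..<k})"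
    by (simp add: singletons_def image_image)
  then show ?thesis using permutes_image[OF assms] by (simp add: singletons_def)
qed

lemma isotopic_length: "isotopic L L' \<Longrightarrow> length L = length L'"
  by (auto simp: isotopic_def isotopic_via_def)

lemma isotopy_chain_length: "isotopy_chain L L' \<Longrightarrow> length L = length L'"
  unfolding isotopy_chain_def
  by (induction rule: rtranclp_induct) (auto dest: isotopic_length)

lemma invariant_isotopic_singletons:
  assumes "isotopy_invariant singular_link I" "isotopic L L'"
  shows "I L (singletons (length L)) = I L' (singletons (length L'))"
proof -
  obtain \<sigma> where \<sigma>: "isotopic_via \<sigma> L L'" using assms(2) by (auto simp: isotopic_def)
  have s: "singular_link L" "singular_link L'" "length L = length L'" "\<sigma> permutes {..<length L}"
    using \<sigma> unfolding isotopic_via_def by blast+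
  have "isotopic_cts (L, singletons (length L)) (L', singletons (length L'))"
    unfolding isotopic_cts_def cts_link_def case_prod_conv
    using s \<sigma> induced_by_permutation_singletons[OF s(4)] partition_singletons by metis
  then show ?thesis using assms(1) s unfolding isotopy_invariant_def by blast
qed

lemma invariant_chain_singletons:
  assumes "isotopy_invariant singular_link I" "isotopy_chain L L'"
  shows "I L (singletons (length L)) = I L' (singletons (length L'))"
  using assms(2) unfolding isotopy_chain_def
  by (induction rule: rtranclp_induct) (metis invariant_isotopic_singletons[OF assms(1)])+

text \<open>For the merged partition the numbering matters; isotopies made by interpolation have the
  identity as renumbering.\<close>

lemma invariant_isotopic_id:
  assumes "isotopy_invariant singular_link I" "isotopic_via id L L'" "partition_on {..<length L} J"
  shows "I L J = I L' J"
proof -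
  have s: "singular_link L" "singular_link L'" "length L = length L'"
    using assms(2) by (simp_all add: isotopic_via_def)
  have "J = (\<lambda>B. id ` B) ` J" by simp
  then have "isotopic_cts (L, J) (L', J)"
    unfolding isotopic_cts_def cts_link_def case_prod_conv using s assms by metis
  then show ?thesis using assms(1) s unfolding isotopy_invariant_def by blast
qed

lemma plain_invariant_chain:
  assumes "\<And>L L'. isotopic L L' \<Longrightarrow> Q L = Q L'" "isotopy_chain L L'"
  shows "Q L = Q L'"
  using assms(2) unfolding isotopy_chain_def
  by (induction rule: rtranclp_induct) (auto dest: assms(1))

lemma partition_merge:
  assumes "i < k" shows "partition_on {..<Suc k} (merge i k (singletons (Suc k)))"
  unfolding merge_singletons_Suc[OF assms] partition_on_def disjoint_def using assms by auto

section \<open>Values on the normal form\<close>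

context straight_strand
begin

text \<open>A self-crossing merges nothing, so three of the four terms are taken at singletons, on
  links isotopic to \<open>L\<close>. The fourth is the circle in the block of the strand, which
  rule II does not reach.\<close>

lemma curl_value:
  assumes I: "tied_rules singular_link u a r I"
  shows "1 / r * I L (singletons (length L)) - r * I L (singletons (length L)) =
    1 / r * (1 - 1 / u) * I L (singletons (length L)) +
    (1 - 1 / u) * I (L @ [lowered_circle]) (merge i (length L) (singletons (Suc (length L))))"
proof -
  let ?J = "singletons (length L)" and ?J' = "merge i (length L) (singletons (Suc (length L)))"
  have inv: "isotopy_invariant singular_link I" using I by (simp add: tied_rules_def)
  have K: "classical_link (graft (curl \<sigma>))" "I (graft (curl \<sigma>)) ?J = I L ?J" if "\<sigma>\<^sup>2 = 1" for \<sigma>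
  proof -
    show "classical_link (graft (curl \<sigma>))" by (rule classical_graft[OF regular_arc_curl[OF that]])
    show "I (graft (curl \<sigma>)) ?J = I L ?J"
      using invariant_isotopic_id[OF inv isotopic_curl(1)[OF that], of ?J]
        invariant_isotopic_id[OF inv isotopic_curl(2)[OF that], of ?J]
      by (simp add: partition_singletons)
  qed
  have "cts_link (graft (curl 1)) ?J"
    using classical_singular[OF K(1)[of 1]] by (simp add: cts_link_def partition_singletons)
  then have "1 / r * I (graft (curl 1)) ?J - r * I (graft (curl (-1))) ?J =
      1 / r * (1 - 1 / u) * I (graft (curl 1)) (merge i i ?J) +
      (1 - 1 / u) * I (L @ [flat_circle]) (induced_partition lower_box (graft (curl 1)) (L @ [flat_circle]) (merge i i ?J))"
    using I skein_triple_curl K(1)[of 1] K(1)[of "-1"] classical_flat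
    unfolding tied_rules_def by (simp add: classical_singular)
  moreover have "I (L @ [lowered_circle]) ?J' = I (L @ [flat_circle]) ?J'"
    using invariant_isotopic_id[OF inv isotopic_lowered_flat, of ?J'] partition_merge[OF i] by simp
  ultimately show ?thesis
    by (simp add: K(2) merge_refl_singletons[OF i]
        induced_partition_arc_to_loop[OF curl_splits C1_flat_circle, unfolded merge_refl_singletons[OF i]])
qed

lemma unknot_value:
  assumes I: "tied_rules singular_link u a r I"
  shows "I (L @ [lowered_circle]) (singletons (Suc (length L))) = 1 / (a * r) * I L (singletons (length L))"
proof -
  have inv: "isotopy_invariant singular_link I" using I by (simp add: tied_rules_def)
  have "I (L @ [lowered_circle]) (singletons (Suc (length L))) = I (L @ [flat_circle]) (singletons (Suc (length L)))"
    using invariant_isotopic_id[OF inv isotopic_lowered_flat, of "singletons (Suc (length L))"]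
    by (simp add: partition_singletons)
  also have "\<dots> = I (L @ [flat_circle]) (insert {length L} (singletons (length L)))"
    by (simp add: singletons_Suc)
  also have "\<dots> = 1 / (a * r) * I L (singletons (length L))"
    using I classical_singular[OF classical] classical_singular[OF classical_flat] add_unknot_flat
    unfolding tied_rules_def by (simp add: cts_link_def partition_singletons)
  finally show ?thesis .
qed

lemma detour_value:
  assumes "isotopy_invariant singular_link I"
  shows "I (graft detour) (singletons (length L)) = I L (singletons (length L))"
  using invariant_isotopic_id[OF assms isotopic_detour, of "singletons (length L)"]
  by (simp add: partition_singletons)

text \<open>The rules of Phi and Psi differ only in the partition of the positive resolution.
  \<open>R\<close> stands for it: \<open>merge\<close> for Phi, the unchanged partition for
  Psi.\<close>

lemma singular_value:
  assumes I: "isotopy_invariant singular_link I"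
    and rule: "\<And>D i j Lx Lp L0 J. singular_link Lp \<and> singular_link L0 \<and> cts_link Lx J \<and>
      skein_triple D i j 0 1 Lx Lp L0 \<Longrightarrow>
      I Lx J = x * I L0 (induced_partition D Lx L0 (merge i j J)) + y * I Lp (R i j J)"
  shows "I (L @ [tilted_circle]) (singletons (Suc (length L))) =
    x * I L (singletons (length L)) +
    y * I (L @ [lowered_circle]) (R i (length L) (singletons (Suc (length L))))"
proof -
  have "cts_link (L @ [tilted_circle]) (singletons (Suc (length L)))"
    using singular_tilted by (simp add: cts_link_def partition_singletons)
  then have "I (L @ [tilted_circle]) (singletons (Suc (length L))) =
      x * I (graft detour) (induced_partition right_box (L @ [tilted_circle]) (graft detour)
        (merge i (length L) (singletons (Suc (length L))))) +
      y * I (L @ [lowered_circle]) (R i (length L) (singletons (Suc (length L))))"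
    by (intro rule conjI classical_singular[OF classical_lowered]
        classical_singular[OF classical_graft[OF regular_arc_detour]] skein_triple_singular)
  then show ?thesis
    unfolding induced_partition_loop_to_arc[OF detour_splits C1_tilted_circle] detour_value[OF I] .
qed

lemma Phi_value:
  assumes "is_Phi u a r x y \<Phi>" "u \<noteq> 0" "u \<noteq> 1"
  shows "\<Phi> (L @ [tilted_circle]) (singletons (Suc (length L))) =
    (x + y * ((1 / (u * r) - r) / (1 - 1 / u))) * \<Phi> L (singletons (length L))"
proof -
  let ?f = "\<Phi> L (singletons (length L))"
  let ?g = "\<Phi> (L @ [lowered_circle]) (merge i (length L) (singletons (Suc (length L))))"
  have t: "tied_rules singular_link u a r \<Phi>" using assms by (simp add: is_Phi_def)
  have n: "1 - 1 / u \<noteq> 0" using assms by (simp add: field_simps)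
  \<comment> \<open>The terms of \<open>curl_value\<close> with 1/r combine to 1/(u r), the leading
    coefficient of the Homflypt rule; so this factor reappears for I_PR.\<close>
  have "(1 - 1 / u) * ?g = (1 / (u * r) - r) * ?f"
    using curl_value[OF t] by (simp add: algebra_simps)
  then have "?g = (1 / (u * r) - r) / (1 - 1 / u) * ?f" using n by (simp add: eq_divide_eq mult.commute)
  moreover have "\<Phi> (L @ [tilted_circle]) (singletons (Suc (length L))) = x * ?f + y * ?g"
    by (rule singular_value) (use assms in \<open>auto simp: is_Phi_def tied_rules_def\<close>)
  ultimately show ?thesis by (simp add: algebra_simps)
qed

lemma Psi_value:
  assumes "is_Psi u a r x y \<Psi>"
  shows "\<Psi> (L @ [tilted_circle]) (singletons (Suc (length L))) =
    (x + y * (1 / (a * r))) * \<Psi> L (singletons (length L))"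
proof -
  have t: "tied_rules singular_link u a r \<Psi>" using assms by (simp add: is_Psi_def)
  have "\<Psi> (L @ [tilted_circle]) (singletons (Suc (length L))) = x * \<Psi> L (singletons (length L)) +
      y * \<Psi> (L @ [lowered_circle]) (singletons (Suc (length L)))"
    by (rule singular_value[where R = "\<lambda>i j J. J"])
      (use assms in \<open>auto simp: is_Psi_def tied_rules_def\<close>)
  then show ?thesis unfolding unknot_value[OF t] by (simp add: algebra_simps)
qed

lemma Paris_Rabenda_value:
  assumes P: "is_Homflypt u r P" and Q: "is_Paris_Rabenda x y P Q" and u: "u \<noteq> 0" "u \<noteq> 1"
  shows "Q (L @ [tilted_circle]) = (x + y * ((1 / (u * r) - r) / (1 - 1 / u))) * P L"
proof -
  have inv: "\<And>L L'. isotopic_via \<sigma> L L' \<Longrightarrow> Q L = Q L'" for \<sigma>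
    using Q by (auto simp: is_Paris_Rabenda_def isotopic_def)
  have QP: "\<And>L. classical_link L \<Longrightarrow> Q L = P L" using Q by (simp add: is_Paris_Rabenda_def)
  have n: "1 - 1 / u \<noteq> 0" using u by (simp add: field_simps)
  have K: "classical_link (graft (curl \<sigma>))" "P (graft (curl \<sigma>)) = P L" if "\<sigma>\<^sup>2 = 1" for \<sigma>
  proof -
    show c: "classical_link (graft (curl \<sigma>))" by (rule classical_graft[OF regular_arc_curl[OF that]])
    show "P (graft (curl \<sigma>)) = P L"
      using inv[OF isotopic_curl(1)[OF that]] inv[OF isotopic_curl(2)[OF that]] QP[OF c] QP[OF classical] by simp
  qed
  have "1 / (u * r) * P (graft (curl 1)) - r * P (graft (curl (-1))) = (1 - 1 / u) * P (L @ [flat_circle])"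
    using P skein_triple_curl K(1)[of 1] K(1)[of "-1"] classical_flat
    unfolding is_Homflypt_def by simp
  then have "(1 - 1 / u) * P (L @ [flat_circle]) = (1 / (u * r) - r) * P L"
    by (simp add: K(2) algebra_simps)
  then have U: "P (L @ [flat_circle]) = (1 / (u * r) - r) / (1 - 1 / u) * P L"
    using n by (simp add: eq_divide_eq mult.commute)
  have c: "classical_link (graft detour)" by (rule classical_graft[OF regular_arc_detour])
  have "Q (L @ [tilted_circle]) = x * Q (graft detour) + y * Q (L @ [lowered_circle])"
    using Q skein_triple_singular singular_tilted classical_singular[OF classical_lowered] classical_singular[OF c]
    unfolding is_Paris_Rabenda_def by blast
  also have "Q (graft detour) = P L" using inv[OF isotopic_detour] QP[OF classical] by simp
  also have "Q (L @ [lowered_circle]) = P (L @ [flat_circle])"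
    using inv[OF isotopic_lowered_flat] QP[OF classical_flat] by simp
  finally show ?thesis unfolding U by (simp add: algebra_simps)
qed

end

section \<open>Nonvanishing of the factors\<close>

lemma complex_embedding_simps:
  assumes "complex_embedding h"
  shows "h 1 = 1" "h 0 = 0" "h (- 1) = - 1"
proof -
  show 1: "h 1 = 1" using assms by (simp add: complex_embedding_def)
  have add: "h (z + w) = h z + h w" for z w using assms by (simp add: complex_embedding_def)
  have "h 0 = h 0 + h 0" using add[of 0 0] by (simp only: add_0)
  then show 0: "h 0 = 0" by (rule add_cancel_right_right[THEN iffD1])
  have "h (- 1) + h 1 = h 0" using add[of "- 1" 1] by simp
  then show "h (- 1) = - 1" using 0 1 by (simp add: eq_neg_iff_add_eq_0)
qed

text \<open>Every polynomial needed below can be arranged as two monomials minus two others, all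
  distinct, so one coefficient function with values 1 and -1 serves for all of them. Exponents are
  listed in the order u, a, b, x, y.\<close>

lemma independent_four_terms:
  assumes h: "complex_embedding h" and ind: "independent_variables h [u, a, b, x, y]"
    and "distinct [e1, e2, e3, e4]" "\<forall>e\<in>set [e1, e2, e3, e4]. length e = 5"
  defines "m \<equiv> \<lambda>e. u ^ (e ! 0) * a ^ (e ! 1) * b ^ (e ! 2) * x ^ (e ! 3) * y ^ (e ! 4)"
  shows "m e1 + m e2 - m e3 - m e4 \<noteq> 0"
proof
  assume z: "m e1 + m e2 - m e3 - m e4 = 0"
  define q :: "nat list \<Rightarrow> complex" where "q e = (if e = e1 \<or> e = e2 then 1 else -1)" for e
  have me: "(\<Prod>i<length [u, a, b, x, y]. ([u, a, b, x, y] ! i) ^ (e ! i)) = m e" for e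
    by (simp add: m_def lessThan_Suc eval_nat_numeral mult_ac)
  have "(\<Sum>e\<in>{e1, e2, e3, e4}. h (q e) * m e) = m e1 + m e2 - m e3 - m e4"
    using assms(3) complex_embedding_simps[OF h] by (auto simp: q_def)
  then have "\<forall>e\<in>{e1, e2, e3, e4}. q e = 0"
    using ind[unfolded independent_variables_def, rule_format, of "{e1, e2, e3, e4}" q] z assms(4)
    unfolding me by auto
  then have "q e1 = 0" by simp
  then show False by (simp add: q_def)
qed

text \<open>The root r is controlled by r^2 a u = a + (1 - u) b. If a factor vanished, isolating the
  term that is odd in r and squaring would give a relation among the variables, namely the vanishing
  of \<open>phi\<close> or \<open>psi\<close>.\<close>

lemma variables_nondegenerate:
  assumes h: "complex_embedding h" and ind: "independent_variables h [u, a, b, x, y]"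
    and r: "r ^ 2 = (a + (1 - u) * b) / (a * u)"
  shows "u \<noteq> 0" "u \<noteq> 1" "x + y * ((1 / (u * r) - r) / (1 - 1 / u)) \<noteq> 0" "x + y * (1 / (a * r)) \<noteq> 0"
proof -
  note four = independent_four_terms[OF h ind]
  \<comment> \<open>What remains of the relation for the first factor after cancelling (u - 1)^2;
    the elimination rests on a (1 - u r^2) = (u - 1) b.\<close>
  have phi: "x\<^sup>2 * a\<^sup>2 + x\<^sup>2 * a * b - u * x\<^sup>2 * a * b - u * y\<^sup>2 * b\<^sup>2 \<noteq> 0"
    using four[of "[0, 2, 0, 2, 0]" "[0, 1, 1, 2, 0]" "[1, 1, 1, 2, 0]" "[1, 0, 2, 0, 2]"]
    by (simp add: mult_ac)
  have psi: "x\<^sup>2 * a\<^sup>2 + x\<^sup>2 * a * b - u * x\<^sup>2 * a * b - u * y\<^sup>2 \<noteq> 0"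
    using four[of "[0, 2, 0, 2, 0]" "[0, 1, 1, 2, 0]" "[1, 1, 1, 2, 0]" "[1, 0, 0, 0, 2]"]
    by (simp add: mult_ac)
  \<comment> \<open>This vanishes for a = 0 and for u = 1, so both are excluded at once; the next
    polynomial is divisible by u and excludes u = 0.\<close>
  have "u * a + u\<^sup>2 * a - a - u ^ 3 * a \<noteq> 0"
    using four[of "[1, 1, 0, 0, 0]" "[2, 1, 0, 0, 0]" "[0, 1, 0, 0, 0]" "[3, 1, 0, 0, 0]"]
    by (simp add: mult_ac)
  then have u1: "u \<noteq> 1" and a0: "a \<noteq> 0" by auto
  then show "u \<noteq> 1" by simp
  have "u * a + u\<^sup>2 * a - u ^ 4 * a - u ^ 3 * a \<noteq> 0"
    using four[of "[1, 1, 0, 0, 0]" "[2, 1, 0, 0, 0]" "[4, 1, 0, 0, 0]" "[3, 1, 0, 0, 0]"]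
    by (simp add: mult_ac)
  then show u0: "u \<noteq> 0" by auto
  have rr: "r\<^sup>2 * (a * u) = a + (1 - u) * b" using r a0 u0 by simp
  have r0: "r \<noteq> 0"
  proof
    assume "r = 0"
    then have c: "a + (1 - u) * b = 0" using rr by simp
    \<comment> \<open>Multiplication by a - b turns the three terms of a + (1 - u) b into the
      required four.\<close>
    have "a\<^sup>2 + u * b\<^sup>2 - b\<^sup>2 - u * a * b \<noteq> 0"
      using four[of "[0, 2, 0, 0, 0]" "[1, 0, 2, 0, 0]" "[0, 0, 2, 0, 0]" "[1, 1, 1, 0, 0]"]
      by (simp add: mult_ac)
    moreover have "a\<^sup>2 + u * b\<^sup>2 - b\<^sup>2 - u * a * b = (a + (1 - u) * b) * (a - b)" by algebra
    ultimately show False using c by simp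
  qed
  show "x + y * ((1 / (u * r) - r) / (1 - 1 / u)) \<noteq> 0"
  proof
    assume z: "x + y * ((1 / (u * r) - r) / (1 - 1 / u)) = 0"
    define d where "d = r * (u - 1)"
    have d0: "d \<noteq> 0" using r0 u1 by (simp add: d_def)
    have "(1 / (u * r) - r) / (1 - 1 / u) = (1 - r\<^sup>2 * u) / d"
      using u0 u1 r0 unfolding d_def by (simp add: field_simps power2_eq_square)
    then have "x + y * ((1 - r\<^sup>2 * u) / d) = 0" using z by simp
    moreover have "x * d + y * (1 - r\<^sup>2 * u) = (x + y * ((1 - r\<^sup>2 * u) / d)) * d"
      using d0 by (simp add: distrib_right)
    ultimately have "x * (r * (u - 1)) + y * (1 - r\<^sup>2 * u) = 0" by (simp add: d_def)
    then have "(x * (r * (u - 1)))\<^sup>2 = (y * (1 - r\<^sup>2 * u))\<^sup>2"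
      by (simp add: eq_neg_iff_add_eq_0[symmetric])
    then have "(x * (r * (u - 1)))\<^sup>2 * (a\<^sup>2 * u) = (y * (1 - r\<^sup>2 * u))\<^sup>2 * (a\<^sup>2 * u)" by simp
    then have "(u - 1)\<^sup>2 * (x\<^sup>2 * a\<^sup>2 + x\<^sup>2 * a * b - u * x\<^sup>2 * a * b - u * y\<^sup>2 * b\<^sup>2) = 0"
      using rr by algebra
    then show False using phi u1 by simp
  qed
  show "x + y * (1 / (a * r)) \<noteq> 0"
  proof
    assume z: "x + y * (1 / (a * r)) = 0"
    then have "x * (a * r) + y = 0" using a0 r0 by (simp add: field_simps)
    then have "x\<^sup>2 * a\<^sup>2 + x\<^sup>2 * a * b - u * x\<^sup>2 * a * b - u * y\<^sup>2 = 0"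
      using rr by algebra
    then show False using psi by simp
  qed
qed

lemma adding_circle_values:
  assumes L: "classical_link L" and M: "obtained_by_adding L i M"
    and u: "u \<noteq> 0" "u \<noteq> 1"
    and \<Phi>: "is_Phi u a r x y \<Phi>" and \<Psi>: "is_Psi u a r x y \<Psi>"
    and P: "is_Homflypt u r P" and Q: "is_Paris_Rabenda x y P Q"
  shows "length M = Suc (length L)"
    "\<Phi> M (singletons (length M)) = (x + y * ((1 / (u * r) - r) / (1 - 1 / u))) * \<Phi> L (singletons (length L))"
    "\<Psi> M (singletons (length M)) = (x + y * (1 / (a * r))) * \<Psi> L (singletons (length L))"
    "Q M = (x + y * ((1 / (u * r) - r) / (1 - 1 / u))) * P L"
proof -
  obtain L' i' s0 V where str: "straight_strand L' i' s0 V" and cL: "isotopy_chain L L'"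
    and cM: "isotopy_chain M (L' @ [tilted_circle])"
    by (rule obtained_by_adding_normal_form[OF L M])
  interpret straight_strand L' i' s0 V by (rule str)
  show "length M = Suc (length L)"
    using isotopy_chain_length[OF cL] isotopy_chain_length[OF cM] by simp
  have inv: "isotopy_invariant singular_link \<Phi>" "isotopy_invariant singular_link \<Psi>"
    using \<Phi> \<Psi> by (simp_all add: is_Phi_def is_Psi_def tied_rules_def)
  show "\<Phi> M (singletons (length M)) =
      (x + y * ((1 / (u * r) - r) / (1 - 1 / u))) * \<Phi> L (singletons (length L))"
    using invariant_chain_singletons[OF inv(1) cL] invariant_chain_singletons[OF inv(1) cM] Phi_value[OF \<Phi> u]
    by simp
  show "\<Psi> M (singletons (length M)) = (x + y * (1 / (a * r))) * \<Psi> L (singletons (length L))"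
    using invariant_chain_singletons[OF inv(2) cL] invariant_chain_singletons[OF inv(2) cM] Psi_value[OF \<Psi>]
    by simp
  have invQ: "\<And>L L'. isotopic L L' \<Longrightarrow> Q L = Q L'" and QP: "\<And>L. classical_link L \<Longrightarrow> Q L = P L"
    using Q by (simp_all add: is_Paris_Rabenda_def)
  have "P L = P L'"
    using plain_invariant_chain[of Q, OF invQ cL] QP[OF L] QP[OF classical] by simp
  then show "Q M = (x + y * ((1 / (u * r) - r) / (1 - 1 / u))) * P L"
    using plain_invariant_chain[of Q, OF invQ cM] Paris_Rabenda_value[OF P Q u] by simp
qed

theorem theorem16:
  fixes h :: "complex \<Rightarrow> 'k::field"
    and u a b x y r :: 'k
    and F \<Phi> \<Psi> :: "link \<Rightarrow> nat set set \<Rightarrow> 'k"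
    and P I_PR :: "link \<Rightarrow> 'k"
    and L1 L2 M1 M2 :: link
    and i1 i2 :: nat
  assumes "complex_embedding h"
    and "independent_variables h [u, a, b, x, y]"
    and "r ^ 2 = (a + (1 - u) * b) / (a * u)"
    and "is_F u a r F"
    and "is_Phi u a r x y \<Phi>" and "restricts_to \<Phi> F"
    and "is_Psi u a r x y \<Psi>" and "restricts_to \<Psi> F"
    and "is_Homflypt u r P"
    and "is_Paris_Rabenda x y P I_PR"
    and "classical_link L1" and "classical_link L2"
    and "length L1 = length L2"
    and "\<not> isotopic L1 L2"
    and "distinguished F L1 L2"
    and "\<not> distinguished_plain P L1 L2"
    and "i1 < length L1" and "obtained_by_adding L1 i1 M1"
    and "i2 < length L2" and "obtained_by_adding L2 i2 M2"
  shows "distinguished \<Phi> M1 M2 \<and> distinguished \<Psi> M1 M2 \<and> \<not> distinguished_plain I_PR M1 M2"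
proof -
  \<comment> \<open>Both factors involve only the variables and the root, not the link or the chosen
    component. So the nonzero ones carry the inequality of the values of F over to the enlarged
    links, and the equality of the values of P is carried over as well.\<close>
  let ?c = "x + y * ((1 / (u * r) - r) / (1 - 1 / u))" and ?d = "x + y * (1 / (a * r))"
  note nz = variables_nondegenerate[OF assms(1-3)]
  note v1 = adding_circle_values[OF assms(11,18) nz(1,2) assms(5,7,9,10)]
  note v2 = adding_circle_values[OF assms(12,20) nz(1,2) assms(5,7,9,10)]
  have len: "length M1 = length M2" using v1(1) v2(1) assms(13) by simp
  have F: "F L1 (singletons (length L1)) \<noteq> F L2 (singletons (length L2))"
    using assms(15) unfolding distinguished_def by (rule conjunct2)
  have R: "I L (singletons (length L)) = F L (singletons (length L))"
    if "restricts_to I F" "classical_link L" for I L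
    using that by (simp add: restricts_to_def cts_link_def classical_singular partition_singletons)
  have P: "P L1 = P L2" using assms(13,16) by (simp add: distinguished_plain_def)
  have "distinguished \<Phi> M1 M2"
    using len F nz(3) unfolding distinguished_def v1(2) v2(2) R[OF assms(6,11)] R[OF assms(6,12)] by simp
  moreover have "distinguished \<Psi> M1 M2"
    using len F nz(4) unfolding distinguished_def v1(3) v2(3) R[OF assms(8,11)] R[OF assms(8,12)] by simp
  moreover have "\<not> distinguished_plain I_PR M1 M2"
    unfolding distinguished_plain_def v1(4) v2(4) P by simp
  ultimately show ?thesis by blast
qed

end
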